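(* Let $L\subset\mathbb{R}^n$ be a non-Cartesian crystallographic root lattice and let $T$ be the tessellation of $\mathbb{R}^n$ by the Voronoi cells of $L$. Then the splines obtained by convolving the Voronoi cell of $L$ are not refinable: for every order $k\ge1$ there is no scaled-down copy $T^1$ of $T$ such that every Voronoi spline of order $k$ on $T$ is a linear combination of Voronoi splines of order $k$ on $T^1$.
   Context: The (symmetric crystallographic) root lattices considered are, up to similarity, $\mathcal{A}_n,\mathcal{A}_n^*,\mathcal{B}_n,\mathcal{D}_n,\mathcal{D}_n^*$ and $\mathcal{E}_6,\mathcal{E}_7,\mathcal{E}_8$ in the standard (Conway–Sloane) notation: $\mathcal{A}_n=\{x\in\mathbb{Z}^{n+1}:\sum x_i=0\}$ viewed as a lattice in its $n$-dimensional span ($n\ge2$), $\mathcal{D}_n=\{x\in\mathbb{Z}^n:\sum x_i \text{ even}\}$ ($n\ge3$), $^*$ denotes the dual lattice, $\mathcal{E}_j$ is the lattice generated by the root system $E_j$, and $\mathcal{B}_n=\mathbb{Z}^n$ is the Cartesian lattice. The non-Cartesian ones are $\mathcal{A}_n,\mathcal{A}_n^*$ ($n\ge2$), $\mathcal{D}_n,\mathcal{D}_n^*$ ($n\ge3$), $\mathcal{E}_6,\mathcal{E}_7,\mathcal{E}_8$. The Voronoi (nearest-neighbor) cell of a lattice point $p\in L$ is the set of points of $\mathbb{R}^n$ at least as close to $p$ as to any other point of $L$; these cells form a tessellation $T$ by translates of the Voronoi cell $V$ of the origin. Let $\chi_V$ be the indicator function of $V$ and $\chi_V^{*k}$ its $k$-fold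 convolution ($\chi_V^{*1}=\chi_V$). The Voronoi splines of order $k$ on $T$ are the functions $x\mapsto\chi_V^{*k}(x-p)$, $p\in L$. A scaled-down copy of $T$ is a tessellation $T^1=\lambda T+v$ with $0<\lambda<1$, $v\in\mathbb{R}^n$; the Voronoi splines of order $k$ on $T^1$ are the functions $x\mapsto\chi_{\lambda V}^{*k}(x-p)$, $p\in\lambda L+v$. Linear combinations may be infinite (the sums are locally finite); equality for $k=1$ is meant up to values on cell boundaries. *)

theory Defs
  imports "HOL-Analysis.Analysis" "HOL-Library.Numeral_Type"
begin

section \<open>The root lattices and their duals\<close>

definition int_span :: "'a::real_vector set \<Rightarrow> 'a set" where
  "int_span S = {\<Sum>r\<in>F. of_int (c r) *\<^sub>R r | F (c :: 'a \<Rightarrow> int). finite F \<and> F \<subseteq> S}"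

text \<open>The ambient inner product space may be larger than the span of the lattice (as for
  \<open>A\<^sub>n\<close>); the dual is taken inside the span.\<close>

definition dual_lattice :: "'a::euclidean_space set \<Rightarrow> 'a set" where
  "dual_lattice M = {y \<in> span M. \<forall>x\<in>M. x \<bullet> y \<in> \<int>}"

text \<open>\<open>A\<^sub>n\<close> lives in \<open>n + 1\<close> coordinates: for an index type with \<open>n\<close> elements, \<open>'n option\<close>
  has \<open>n + 1\<close> elements.\<close>

definition lattice_A :: "(real ^ ('n::finite option)) set" where
  "lattice_A = {x. (\<forall>i. x $ i \<in> \<int>) \<and> (\<Sum>i\<in>UNIV. x $ i) = 0}"

definition lattice_D :: "(real ^ 'n::finite) set" where
  "lattice_D = {x. (\<forall>i. x $ i \<in> \<int>) \<and> (\<exists>m::int. even m \<and> (\<Sum>i\<in>UNIV. x $ i) = of_int m)}"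

text \<open>The root system \<open>E\<^sub>8\<close> in even coordinates; \<open>E\<^sub>7\<close> (126 roots) and \<open>E\<^sub>6\<close> (72 roots) are the
  subsystems of \<open>E\<^sub>8\<close> given by the coordinates of Conway and Sloane. They span subspaces of
  \<open>real ^ 8\<close> of dimension 7 and 6. In the index type \<open>8\<close>, the coordinate \<open>x $ 8\<close> is \<open>x $ 0\<close>.\<close>

definition roots_E8 :: "(real ^ 8) set" where
  "roots_E8 =
     {s *\<^sub>R axis i 1 + t *\<^sub>R axis j 1 | s t i j. s \<in> {-1, 1} \<and> t \<in> {-1, 1} \<and> i \<noteq> j} \<union>
     {x. (\<forall>i. x $ i \<in> {-1/2, 1/2}) \<and> even (card {i. x $ i = -1/2})}"

definition roots_E7 :: "(real ^ 8) set" where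
  "roots_E7 = {x \<in> roots_E8. (\<Sum>i\<in>UNIV. x $ i) = 0}"

definition roots_E6 :: "(real ^ 8) set" where
  "roots_E6 = {x \<in> roots_E8. x $ 1 + x $ 8 = 0 \<and> (\<Sum>i\<in>UNIV - {1, 8}. x $ i) = 0}"

text \<open>\<open>L\<close> is the image of \<open>M\<close> under a similarity (homothety composed with a linear isometry)
  defined on the span of \<open>M\<close>.\<close>

definition similar_to :: "'a::euclidean_space set \<Rightarrow> 'b::euclidean_space set \<Rightarrow> bool" where
  "similar_to L M \<longleftrightarrow>
     (\<exists>f c. linear f \<and> c > 0 \<and> (\<forall>x\<in>span M. norm (f x) = c * norm x) \<and> L = f ` M)"

definition noncartesian_root_lattice :: "(real ^ 'n::finite) set \<Rightarrow> bool" where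
  "noncartesian_root_lattice L \<longleftrightarrow>
     CARD('n) \<ge> 2 \<and> similar_to L (lattice_A :: (real ^ ('n option)) set) \<or>
     CARD('n) \<ge> 2 \<and> similar_to L (dual_lattice (lattice_A :: (real ^ ('n option)) set)) \<or>
     CARD('n) \<ge> 3 \<and> similar_to L (lattice_D :: (real ^ 'n) set) \<or>
     CARD('n) \<ge> 3 \<and> similar_to L (dual_lattice (lattice_D :: (real ^ 'n) set)) \<or>
     CARD('n) = 6 \<and> similar_to L (int_span roots_E6) \<or>
     CARD('n) = 7 \<and> similar_to L (int_span roots_E7) \<or>
     CARD('n) = 8 \<and> similar_to L (int_span roots_E8)"

section \<open>Voronoi tessellations and their splines\<close>

definition voronoi_cell :: "'a::euclidean_space set \<Rightarrow> 'a \<Rightarrow> 'a set" where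
  "voronoi_cell L p = {x. \<forall>q\<in>L. dist x p \<le> dist x q}"

definition voronoi_tessellation :: "'a::euclidean_space set \<Rightarrow> 'a set set" where
  "voronoi_tessellation L = voronoi_cell L ` L"

definition cell_boundaries :: "'a::euclidean_space set set \<Rightarrow> 'a set" where
  "cell_boundaries T = (\<Union>C\<in>T. frontier C)"

definition scaled_copy :: "real \<Rightarrow> 'a::euclidean_space \<Rightarrow> 'a set \<Rightarrow> 'a set" where
  "scaled_copy l v X = (\<lambda>x. l *\<^sub>R x + v) ` X"

definition convolution ::
    "('a::euclidean_space \<Rightarrow> real) \<Rightarrow> ('a \<Rightarrow> real) \<Rightarrow> 'a \<Rightarrow> real" where
  "convolution f g x = (\<integral>y. f y * g (x - y) \<partial>lborel)"

text \<open>\<open>conv_power f k\<close> has \<open>k\<close> factors \<open>f\<close>; only \<open>k \<ge> 1\<close> is meaningful.\<close>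

definition conv_power :: "('a::euclidean_space \<Rightarrow> real) \<Rightarrow> nat \<Rightarrow> 'a \<Rightarrow> real" where
  "conv_power f k = (convolution f ^^ (k - 1)) f"

definition cell_spline :: "nat \<Rightarrow> 'a::euclidean_space set \<Rightarrow> 'a \<Rightarrow> 'a \<Rightarrow> real" where
  "cell_spline k V p x = conv_power (indicat_real V) k (x - p)"

text \<open>Every order-\<open>k\<close> spline on the Voronoi tessellation \<open>T\<close> of \<open>L\<close> is a (possibly infinite)
  linear combination of the order-\<open>k\<close> splines on \<open>l T + v\<close>. For a lattice \<open>L\<close> of full rank and
  \<open>l \<noteq> 0\<close> only finitely many summands are nonzero at each \<open>x\<close>. For \<open>k = 1\<close> the values on
  cell boundaries of either tessellation are disregarded.\<close>

definition voronoi_refines :: "'a::euclidean_space set \<Rightarrow> nat \<Rightarrow> real \<Rightarrow> 'a \<Rightarrow> bool" where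
  "voronoi_refines L k l v \<longleftrightarrow>
     (let V = voronoi_cell L 0;
          T = voronoi_tessellation L;
          T1 = scaled_copy l v ` T
      in \<forall>p\<in>L. \<exists>c :: 'a \<Rightarrow> real. \<forall>x.
           (k = 1 \<longrightarrow> x \<notin> cell_boundaries T \<union> cell_boundaries T1) \<longrightarrow>
           ((\<lambda>q. c q * cell_spline k (scaled_copy l 0 V) q x) has_sum cell_spline k V p x)
             (scaled_copy l v L))"

end

theory Submission imports Defs begin

text \<open>
  Let \<open>f\<close> and \<open>g\<close> be the splines of order \<open>k\<close> of \<open>L\<close> and of \<open>l L\<close>. If translates of \<open>f\<close> are combinations
  of the translates of \<open>g\<close> by \<open>l L\<close>, the coefficients, which need not decay, can be eliminated: the
  Laplace transforms of \<open>f\<close> and \<open>g\<close> have the same ratio at any two exponential characters that agree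
  on \<open>l L\<close>. Both transforms are \<open>k\<close>-th powers, so \<open>k\<close> disappears on taking absolute values. Iterating,
  \<open>r (t, \<eta>) = \<bar>S (t, \<eta>)\<bar> / S (t, 0)\<close> with \<open>S (t, \<eta>)\<close> the integral of
  \<open>exp (t (p \<bullet> x) + 2 \<pi> \<i> (\<eta> \<bullet> x))\<close> over the Voronoi cell satisfies
  \<open>r (t / l ^ j, \<eta> / l ^ j) = r (t, \<eta>)\<close> for \<open>\<eta>\<close> in the dual lattice, unless it vanishes. If \<open>p\<close> is a
  shortest vector and \<open>\<eta>\<close> is not parallel to \<open>p\<close>, then the left-hand side tends to 0, hence
  \<open>S (t, \<eta>) = 0\<close>. The extension of \<open>exp (p \<bullet> x)\<close> from the cell to an \<open>L\<close>-periodic function therefore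
  only has frequencies parallel to \<open>p\<close>, i.e. it depends on \<open>p \<bullet> x\<close> alone. This is impossible as soon as
  \<open>p \<bullet> q\<close> is not a multiple of \<open>p \<bullet> p\<close> for some \<open>q\<close> in \<open>L\<close>, which holds for an irreducible root lattice
  and its dual because a root is not a sum of two nonzero orthogonal lattice vectors.
\<close>

section \<open>Exponential characters and convolution powers\<close>

text \<open>At \<open>t = 0\<close> the dual frequencies carry no information: the cells tile, so
  the transform of every Voronoi cell vanishes at all nonzero ones. The weight
  \<open>exp (p \<bullet> x)\<close> breaks this periodicity and keeps the transform at frequency 0
  positive, hence usable as a denominator. The iteration scales weight and frequency together, so
  the mass moves to the part of the cell farthest in direction \<open>p\<close>, to a depth
  comparable to the wavelength. Were that part a vertex, the oscillation might never be felt; for a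
  shortest \<open>p\<close> it is a facet containing a disc around \<open>p / 2\<close>, on which a
  frequency with a component along the facet oscillates ever faster. Frequencies parallel to
  \<open>p\<close> meet no such cancellation, and the Cartesian lattice shows that they must
  survive: on the cube \<open>exp (p \<bullet> x)\<close> does depend on one coordinate only, and
  the argument stops exactly at the missing \<open>q\<close>.\<close>

lemma
  fixes h :: "'a::euclidean_space \<Rightarrow> 'b::{banach, second_countable_topology}"
  assumes "c \<noteq> 0" and h [measurable]: "integrable lborel h"
  shows integrable_lborel_affine: "integrable lborel (\<lambda>x. h (t + c *\<^sub>R x))"
    and integral_lborel_affine:
      "integral\<^sup>L lborel h = \<bar>c\<bar> ^ DIM('a) *\<^sub>R (\<integral>x. h (t + c *\<^sub>R x) \<partial>lborel)"
proof -
  have h': "integrable (density (distr lborel borel (\<lambda>x. t + c *\<^sub>R x)) (\<lambda>_. ennreal (\<bar>c\<bar> ^ DIM('a)))) h"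
    using h lborel_affine[OF \<open>c \<noteq> 0\<close>, of t] by (simp add: ennreal_power)
  then have "integrable lborel (\<lambda>x. \<bar>c\<bar> ^ DIM('a) *\<^sub>R h (t + c *\<^sub>R x))"
    by (simp add: integrable_density integrable_distr_eq)
  then show "integrable lborel (\<lambda>x. h (t + c *\<^sub>R x))"
    using \<open>c \<noteq> 0\<close> integrable_scaleR_right[of "inverse (\<bar>c\<bar> ^ DIM('a))"
      lborel "\<lambda>x. \<bar>c\<bar> ^ DIM('a) *\<^sub>R h (t + c *\<^sub>R x)"] by simp
  have "integral\<^sup>L lborel h
      = integral\<^sup>L (density (distr lborel borel (\<lambda>x. t + c *\<^sub>R x)) (\<lambda>_. ennreal (\<bar>c\<bar> ^ DIM('a)))) h"
    using lborel_affine[OF \<open>c \<noteq> 0\<close>, of t] by (simp add: ennreal_power)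
  also have "\<dots> = \<bar>c\<bar> ^ DIM('a) *\<^sub>R (\<integral>x. h (t + c *\<^sub>R x) \<partial>lborel)"
    by (simp add: integral_density integral_distr)
  finally show "integral\<^sup>L lborel h = \<bar>c\<bar> ^ DIM('a) *\<^sub>R (\<integral>x. h (t + c *\<^sub>R x) \<partial>lborel)" .
qed

lemma
  fixes h :: "'a::euclidean_space \<Rightarrow> 'b::{banach, second_countable_topology}"
  assumes "integrable lborel h"
  shows integrable_lborel_translate: "integrable lborel (\<lambda>x. h (x + t))"
    and integral_lborel_translate: "(\<integral>x. h (x + t) \<partial>lborel) = integral\<^sup>L lborel h"
  using integrable_lborel_affine[of 1 h t] integral_lborel_affine[of 1 h t] assms
  by (simp_all add: add.commute)

lemma
  fixes h :: "'a::euclidean_space \<Rightarrow> 'b::{banach, second_countable_topology}"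
  assumes "integrable lborel h"
  shows integrable_lborel_minus: "integrable lborel (\<lambda>x. h (- x))"
    and integral_lborel_minus: "(\<integral>x. h (- x) \<partial>lborel) = integral\<^sup>L lborel h"
  using integrable_lborel_affine[of "-1" h 0] integral_lborel_affine[of "-1" h 0] assms
  by simp_all

lemma AE_lborel_translate:
  fixes t :: "'a::euclidean_space"
  assumes "AE x in lborel. P x"
  shows "AE x in lborel. P (x + t)"
proof -
  have "AE x in distr lborel borel ((+) t). P x"
    unfolding lborel_distr_plus by (rule assms)
  then have "AE x in lborel. P (t + x)"
    by (rule AE_distrD[rotated]) simp
  then show ?thesis by (simp add: add.commute)
qed

definition char_exp :: "'a::euclidean_space \<Rightarrow> 'a \<Rightarrow> 'a \<Rightarrow> complex" where
  "char_exp a b x = exp (Complex (a \<bullet> x) (b \<bullet> x))"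

lemma char_exp_add: "char_exp a b (x + y) = char_exp a b x * char_exp a b y"
  by (simp add: char_exp_def inner_add_right exp_add [symmetric] complex_eq_iff complex_add)

lemma char_exp_nonzero [simp]: "char_exp a b x \<noteq> 0"
  by (simp add: char_exp_def)

lemma char_exp_0 [simp]: "char_exp a b 0 = 1"
  by (simp add: char_exp_def flip: zero_complex.code)

lemma char_exp_minus: "char_exp a b (- x) = inverse (char_exp a b x)"
  using char_exp_add[of a b x "- x"] by (simp add: field_simps inverse_eq_divide)

lemma norm_char_exp: "norm (char_exp a b x) = exp (a \<bullet> x)"
  by (simp add: char_exp_def)

lemma char_exp_real: "char_exp a 0 x = of_real (exp (a \<bullet> x))"
  by (simp add: char_exp_def complex_of_real_def[symmetric] exp_of_real)

lemma continuous_on_char_exp [continuous_intros]: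
  "continuous_on S f \<Longrightarrow> continuous_on S (\<lambda>x. char_exp a b (f x))"
  unfolding char_exp_def Complex_eq by (intro continuous_intros)

lemma borel_measurable_char_exp [measurable]: "char_exp a b \<in> borel_measurable borel"
  by (intro borel_measurable_continuous_onI continuous_intros)

section \<open>Laplace transforms of functions with bounded support\<close>

definition transform :: "('a::euclidean_space \<Rightarrow> real) \<Rightarrow> ('a \<Rightarrow> complex) \<Rightarrow> complex" where
  "transform h w = (\<integral>x. h x *\<^sub>R w x \<partial>lborel)"

text \<open>Bounded support makes the integral against an exponentially growing character converge.
  The radius is explicit because it adds up under convolution and later limits the lattice
  translates involved to finitely many.\<close>

definition integrable_supp :: "real \<Rightarrow> ('a::euclidean_space \<Rightarrow> real) \<Rightarrow> bool" where
  "integrable_supp R h \<longleftrightarrow> integrable lborel h \<and> (\<forall>x. R < norm x \<longrightarrow> h x = 0)"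

lemma integrable_suppD:
  assumes "integrable_supp R h"
  shows "integrable lborel h" "h x \<noteq> 0 \<Longrightarrow> norm x \<le> R"
  using assms by (auto simp: integrable_supp_def not_le[symmetric])

lemma integrable_scaleR_continuous:
  fixes w :: "'a::euclidean_space \<Rightarrow> 'b::{banach, second_countable_topology}"
  assumes "integrable_supp R h" "continuous_on UNIV w"
  shows "integrable lborel (\<lambda>x. h x *\<^sub>R w x)"
proof -
  have "compact (w ` cball 0 R)"
    by (intro compact_continuous_image continuous_on_subset[OF assms(2)]) auto
  then obtain B where B: "\<And>x. x \<in> cball 0 R \<Longrightarrow> norm (w x) \<le> B"
    by (meson bounded_iff compact_imp_bounded imageI)
  have [measurable]: "w \<in> borel_measurable borel"
    using assms(2) by (rule borel_measurable_continuous_onI)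
  have [measurable]: "h \<in> borel_measurable borel"
    using integrable_suppD(1)[OF assms(1)] by (auto dest: borel_measurable_integrable)
  show ?thesis
  proof (rule Bochner_Integration.integrable_bound)
    show "integrable lborel (\<lambda>x. \<bar>B\<bar> * h x)"
      using integrable_suppD(1)[OF assms(1)] by simp
    show "AE x in lborel. norm (h x *\<^sub>R w x) \<le> norm (\<bar>B\<bar> * h x)"
    proof (rule AE_I2)
      fix x
      show "norm (h x *\<^sub>R w x) \<le> norm (\<bar>B\<bar> * h x)"
      proof (cases "h x = 0")
        case False
        then have "norm (w x) \<le> \<bar>B\<bar>"
          using integrable_suppD(2)[OF assms(1)] B[of x] by auto
        then show ?thesis
          using mult_left_mono[of "norm (w x)" "\<bar>B\<bar>" "\<bar>h x\<bar>"] by (simp add: abs_mult mult.commute)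
      qed simp
    qed
  qed simp
qed

lemma transform_translate:
  assumes "integrable_supp R h"
  shows "transform (\<lambda>x. h (x - t)) (char_exp a b) = char_exp a b t * transform h (char_exp a b)"
proof -
  have "transform (\<lambda>x. h (x - t)) (char_exp a b)
      = (\<integral>x. h (x - t) *\<^sub>R (char_exp a b t * char_exp a b (x - t)) \<partial>lborel)"
    unfolding transform_def by (simp flip: char_exp_add)
  also have "\<dots> = char_exp a b t * (\<integral>x. h (x + - t) *\<^sub>R char_exp a b (x + - t) \<partial>lborel)"
    by (simp add: flip: integral_mult_right_zero)
  also have "(\<integral>x. h (x + - t) *\<^sub>R char_exp a b (x + - t) \<partial>lborel) = transform h (char_exp a b)"
    unfolding transform_def
    by (rule integral_lborel_translate) (intro integrable_scaleR_continuous[OF assms] continuous_intros)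
  finally show ?thesis .
qed

lemma integrable_supp_translate:
  assumes "integrable_supp R h"
  shows "integrable_supp (R + norm t) (\<lambda>x. h (x - t))"
proof -
  have "h (x - t) = 0" if "R + norm t < norm x" for x
    using integrable_suppD(2)[OF assms, of "x - t"] norm_triangle_ineq2[of x t] that by auto
  then show ?thesis
    using integrable_lborel_translate[OF integrable_suppD(1)[OF assms], of "- t"]
    by (auto simp: integrable_supp_def)
qed

lemma integrable_supp_indicator:
  assumes "S \<in> sets borel" "S \<subseteq> cball 0 R"
  shows "integrable_supp R (indicat_real S)"
proof -
  have "emeasure lborel S < \<infinity>"
    using emeasure_mono[OF assms(2), of lborel] emeasure_lborel_cball_finite[of 0 R]
    by (auto intro: le_less_trans)
  then show ?thesis
    using assms by (auto simp: integrable_supp_def indicator_def)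
qed

lemma
  fixes f g :: "'a::euclidean_space \<Rightarrow> real"
  assumes f: "integrable_supp R f" and g: "integrable_supp R' g"
  shows integrable_convolution_kernel:
      "integrable (lborel \<Otimes>\<^sub>M lborel) (\<lambda>(y, x). (f y * g (x - y)) *\<^sub>R char_exp a b x)"
    and transform_convolution:
      "transform (convolution f g) (char_exp a b) = transform f (char_exp a b) * transform g (char_exp a b)"
proof -
  let ?w = "char_exp a b"
  have [measurable]: "f \<in> borel_measurable borel" "g \<in> borel_measurable borel"
    using integrable_suppD(1)[OF f] integrable_suppD(1)[OF g] by (auto dest: borel_measurable_integrable)
  have intf: "integrable lborel (\<lambda>y. f y *\<^sub>R ?w y)" and intg: "integrable lborel (\<lambda>y. g y *\<^sub>R ?w y)"
    by (intro integrable_scaleR_continuous[OF f] integrable_scaleR_continuous[OF g] continuous_intros)+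
  \<comment> \<open>Multiplicativity of the character splits the weighted kernel into a function of
    \<open>y\<close> and a function of \<open>x - y\<close>, so that Fubini reduces to the
    integrability of each weighted factor.\<close>
  have K: "(f y * g (x - y)) *\<^sub>R ?w x = (f y *\<^sub>R ?w y) * (g (x + - y) *\<^sub>R ?w (x + - y))" for x y
    using char_exp_add[of a b y "x - y"] by simp
  have norm_int: "(\<integral>x. norm ((f y * g (x - y)) *\<^sub>R ?w x) \<partial>lborel)
      = norm (f y *\<^sub>R ?w y) * (\<integral>x. norm (g x *\<^sub>R ?w x) \<partial>lborel)" for y
    unfolding K norm_mult[of "f y *\<^sub>R ?w y"]
    using integral_lborel_translate[OF integrable_norm[OF intg], of "- y"] by simp
  have int_y: "integrable lborel (\<lambda>x. (f y * g (x - y)) *\<^sub>R ?w x)" for y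
    unfolding K using integrable_lborel_translate[OF intg, of "- y"] by (intro integrable_mult_right) simp
  show int: "integrable (lborel \<Otimes>\<^sub>M lborel) (\<lambda>(y, x). (f y * g (x - y)) *\<^sub>R ?w x)"
  proof (rule lborel_pair.Fubini_integrable)
    have "integrable lborel (\<lambda>y. norm (f y *\<^sub>R ?w y) * (\<integral>x. norm (g x *\<^sub>R ?w x) \<partial>lborel))"
      using integrable_norm[OF intf] by (rule integrable_mult_left)
    then show "integrable lborel (\<lambda>y. \<integral>x. norm (case (y, x) of (y, x) \<Rightarrow> (f y * g (x - y)) *\<^sub>R ?w x) \<partial>lborel)"
      using norm_int by simp
  qed (use int_y in auto)
  have "transform (convolution f g) ?w = (\<integral>x. (\<integral>y. (f y * g (x - y)) *\<^sub>R ?w x \<partial>lborel) \<partial>lborel)"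
    unfolding transform_def convolution_def
    by (simp add: scaleR_conv_of_real del: of_real_mult flip: integral_of_real)
  also have "\<dots> = (\<integral>y. (\<integral>x. (f y * g (x - y)) *\<^sub>R ?w x \<partial>lborel) \<partial>lborel)"
    by (rule lborel_pair.Fubini_integral) (use int in simp)
  also have "\<dots> = (\<integral>y. (f y *\<^sub>R ?w y) * transform g ?w \<partial>lborel)"
    by (simp only: K integral_mult_right_zero integral_lborel_translate[OF intg] transform_def)
  also have "\<dots> = transform f ?w * transform g ?w"
    by (simp only: transform_def integral_mult_left_zero)
  finally show "transform (convolution f g) ?w = transform f ?w * transform g ?w" .
qed

lemma integrable_supp_convolution:
  fixes f g :: "'a::euclidean_space \<Rightarrow> real"
  assumes f: "integrable_supp R f" and g: "integrable_supp R' g"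
  shows "integrable_supp (R + R') (convolution f g)"
  unfolding integrable_supp_def
proof (intro conjI allI impI)
  have "integrable (lborel \<Otimes>\<^sub>M lborel) (\<lambda>(y, x). complex_of_real (f y * g (x - y)))"
    using integrable_convolution_kernel[OF f g, of 0 0] by (simp add: char_exp_real scaleR_conv_of_real)
  then have "integrable (lborel \<Otimes>\<^sub>M lborel) (\<lambda>z. complex_of_real (case z of (y, x) \<Rightarrow> f y * g (x - y)))"
    by (simp add: case_prod_unfold)
  then have "integrable (lborel \<Otimes>\<^sub>M lborel) (\<lambda>(y, x). f y * g (x - y))"
    by (simp only: complex_of_real_integrable_eq)
  then show "integrable lborel (convolution f g)"
    unfolding convolution_def by (rule lborel_pair.integrable_snd)
  fix x :: 'a
  assume "R + R' < norm x"
  then have "norm y \<le> R \<Longrightarrow> norm (x - y) \<le> R' \<Longrightarrow> False" for y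
    using norm_triangle_ineq[of y "x - y"] by simp
  then have "f y * g (x - y) = 0" for y
    using integrable_suppD(2)[OF f, of y] integrable_suppD(2)[OF g, of "x - y"] by auto
  then show "convolution f g x = 0"
    by (simp only: convolution_def) simp
qed

text \<open>Stated for \<open>Suc k\<close> because truncated subtraction makes
  \<open>conv_power f 0\<close> equal to \<open>f\<close>, for which the power formula
  fails.\<close>

lemma conv_power_supp_transform:
  assumes "integrable_supp R f"
  shows "\<exists>R'. integrable_supp R' (conv_power f (Suc k))"
    and "transform (conv_power f (Suc k)) (char_exp a b) = transform f (char_exp a b) ^ Suc k"
proof -
  have "(\<exists>R'. integrable_supp R' (conv_power f (Suc k))) \<and>
      transform (conv_power f (Suc k)) (char_exp a b) = transform f (char_exp a b) ^ Suc k"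
  proof (induction k)
    case 0
    then show ?case using assms by (auto simp: conv_power_def)
  next
    case (Suc k)
    then obtain R' where R': "integrable_supp R' (conv_power f (Suc k))" by blast
    have "conv_power f (Suc (Suc k)) = convolution f (conv_power f (Suc k))"
      by (simp add: conv_power_def)
    then show ?case
      using integrable_supp_convolution[OF assms R'] transform_convolution[OF assms R'] Suc by auto
  qed
  then show "\<exists>R'. integrable_supp R' (conv_power f (Suc k))"
    "transform (conv_power f (Suc k)) (char_exp a b) = transform f (char_exp a b) ^ Suc k" by auto
qed

section \<open>Lattices and their Voronoi cells\<close>

text \<open>The usual basis is replaced by a group with positive minimum and full rank. That the
  lattice equals its bidual, which a basis would give, is a separate hypothesis of the lemmas that
  need it.\<close>

locale euclidean_lattice =
  fixes L :: "'a::euclidean_space set"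
  assumes zero_mem [simp]: "0 \<in> L"
    and diff_mem: "x \<in> L \<Longrightarrow> y \<in> L \<Longrightarrow> x - y \<in> L"
    and discrete: "\<exists>m>0. \<forall>x\<in>L. x \<noteq> 0 \<longrightarrow> m \<le> norm x"
    and spanning: "span L = UNIV"
begin

lemma uminus_mem: "x \<in> L \<Longrightarrow> - x \<in> L"
  using diff_mem[of 0 x] by simp

lemma add_mem: "x \<in> L \<Longrightarrow> y \<in> L \<Longrightarrow> x + y \<in> L"
  using diff_mem[of x "- y"] uminus_mem[of y] by simp

lemma of_int_scaleR_mem:
  assumes "x \<in> L"
  shows "of_int n *\<^sub>R x \<in> L"
proof -
  have "of_nat m *\<^sub>R x \<in> L" for m
    by (induction m) (auto simp: scaleR_add_left intro: add_mem assms)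
  then show ?thesis
    by (cases n rule: int_cases2) (auto intro: uminus_mem)
qed

lemma finite_Int_cball: "finite (L \<inter> cball c R)"
proof -
  obtain m where m: "m > 0" "\<And>x. x \<in> L \<Longrightarrow> x \<noteq> 0 \<Longrightarrow> m \<le> norm x"
    using discrete by blast
  have "uniform_discrete L"
    unfolding uniform_discrete_def
  proof (intro exI[of _ m] conjI ballI impI)
    fix x y assume "x \<in> L" "y \<in> L" "dist x y < m"
    then show "x = y"
      using m(2)[of "x - y"] diff_mem[of x y] by (auto simp: dist_norm)
  qed (use m in auto)
  then have "uniform_discrete (L \<inter> cball c R)"
    by (rule uniform_discrete_subset) auto
  then show ?thesis
    using uniform_discrete_finite_iff[of "L \<inter> cball c R"] bounded_subset[OF bounded_cball, of "L \<inter> cball c R"]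
    by auto
qed

lemma countable_lattice: "countable L"
proof -
  have "L = (\<Union>n::nat. L \<inter> cball 0 (real n))"
    using real_arch_simple by auto
  then show ?thesis
    using finite_Int_cball by (metis countable_UN countable_finite uncountable_def UNIV_I countableI_type)
qed

definition V :: "'a set" where "V = voronoi_cell L 0"

lemma mem_V_iff: "x \<in> V \<longleftrightarrow> (\<forall>q\<in>L. x \<bullet> q \<le> (norm q)\<^sup>2 / 2)"
proof -
  have "norm x \<le> norm (x - q) \<longleftrightarrow> x \<bullet> q \<le> (norm q)\<^sup>2 / 2" for q
    unfolding norm_le power2_norm_eq_inner by (auto simp: inner_diff inner_commute algebra_simps)
  then show ?thesis by (simp add: V_def voronoi_cell_def dist_norm)
qed

lemma uminus_mem_V_iff [simp]: "- x \<in> V \<longleftrightarrow> x \<in> V"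
proof -
  have "- x \<in> V" if "x \<in> V" for x
    using that uminus_mem by (fastforce simp: mem_V_iff)
  from this[of x] this[of "- x"] show ?thesis by auto
qed

lemma V_eq_Inter: "V = (\<Inter>q\<in>L. {x. q \<bullet> x \<le> (norm q)\<^sup>2 / 2})"
  by (auto simp: mem_V_iff inner_commute)

lemma closed_V: "closed V"
  unfolding V_eq_Inter by (intro closed_INT ballI closed_halfspace_le)

lemma convex_V: "convex V"
  unfolding V_eq_Inter by (intro convex_INT convex_halfspace_le)

lemma sets_V [measurable]: "V \<in> sets borel"
  using closed_V by (rule borel_closed)

text \<open>The directions in which \<open>V\<close> is bounded form a subspace. It contains every
  \<open>q\<close> in \<open>L\<close>, by the half-spaces of \<open>q\<close> and
  \<open>- q\<close>, hence everything.\<close>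

lemma bounded_V: "bounded V"
proof -
  let ?B = "{e. \<exists>K. \<forall>x\<in>V. \<bar>x \<bullet> e\<bar> \<le> K}"
  have "e \<in> ?B" if "e \<in> span L" for e
    using that
  proof (induction rule: span_induct)
    case base
    have "subspace ?B"
    proof (rule subspaceI)
      show "0 \<in> ?B" by auto
      show "e + e' \<in> ?B" if e: "e \<in> ?B" "e' \<in> ?B" for e e'
      proof -
        obtain K K' where "\<forall>x\<in>V. \<bar>x \<bullet> e\<bar> \<le> K" "\<forall>x\<in>V. \<bar>x \<bullet> e'\<bar> \<le> K'"
          using e by auto
        then have "\<forall>x\<in>V. \<bar>x \<bullet> (e + e')\<bar> \<le> K + K'"
          by (fastforce simp: inner_add_right)
        then show ?thesis by blast
      qed
      show "c *\<^sub>R e \<in> ?B" if e: "e \<in> ?B" for c e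
      proof -
        obtain K where "\<forall>x\<in>V. \<bar>x \<bullet> e\<bar> \<le> K"
          using e by auto
        then have "\<forall>x\<in>V. \<bar>x \<bullet> (c *\<^sub>R e)\<bar> \<le> \<bar>c\<bar> * K"
          by (auto simp: abs_mult mult_left_mono)
        then show ?thesis by blast
      qed
    qed
    then show ?case by simp
  next
    case (step q)
    have "\<forall>x\<in>V. \<bar>x \<bullet> q\<bar> \<le> (norm q)\<^sup>2 / 2"
    proof
      fix x assume "x \<in> V"
      then have "x \<bullet> q \<le> (norm q)\<^sup>2 / 2" "x \<bullet> (- q) \<le> (norm (- q))\<^sup>2 / 2"
        using step uminus_mem[OF step] unfolding mem_V_iff by blast+
      then show "\<bar>x \<bullet> q\<bar> \<le> (norm q)\<^sup>2 / 2" by simp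
    qed
    then show ?case by blast
  qed
  then have "\<forall>e. \<exists>K. \<forall>x\<in>V. \<bar>x \<bullet> e\<bar> \<le> K"
    using spanning by auto
  then obtain K where K: "\<And>e x. x \<in> V \<Longrightarrow> \<bar>x \<bullet> e\<bar> \<le> K e"
    by metis
  have "norm x \<le> (\<Sum>e\<in>Basis. K e)" if "x \<in> V" for x
    by (rule order_trans[OF norm_le_l1]) (intro sum_mono K that)
  then show ?thesis
    by (auto simp: bounded_iff)
qed

lemma compact_V: "compact V"
  using closed_V bounded_V by (simp add: compact_eq_bounded_closed)

lemma voronoi_cell_eq:
  assumes "p \<in> L"
  shows "voronoi_cell L p = (+) p ` V"
proof -
  have "(\<forall>q\<in>L. dist x p \<le> dist x q) \<longleftrightarrow> (\<forall>q\<in>L. norm (x - p) \<le> norm (x - p - q))" for x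
  proof safe
    fix q assume "q \<in> L" and H: "\<forall>q\<in>L. dist x p \<le> dist x q"
    then show "norm (x - p) \<le> norm (x - p - q)"
      using H[rule_format, OF add_mem[OF assms \<open>q \<in> L\<close>]] by (simp add: dist_norm diff_diff_eq)
  next
    fix q assume "q \<in> L" and H: "\<forall>q\<in>L. norm (x - p) \<le> norm (x - p - q)"
    then show "dist x p \<le> dist x q"
      using H[rule_format, OF diff_mem[OF \<open>q \<in> L\<close> assms]] by (simp add: dist_norm)
  qed
  then have "x \<in> voronoi_cell L p \<longleftrightarrow> x - p \<in> V" for x
    by (simp add: V_def voronoi_cell_def dist_norm)
  moreover have "x \<in> (+) p ` V \<longleftrightarrow> x - p \<in> V" for x
    by (metis add_diff_cancel_left' diff_add_cancel add.commute image_iff)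
  ultimately show ?thesis by blast
qed

text \<open>Subtract a nearest lattice point; one exists because only the finitely many within
  distance \<open>norm x\<close>, among them 0, compete.\<close>

lemma exists_add_mem_V: "\<exists>s\<in>L. x + s \<in> V"
proof -
  have fin: "finite (L \<inter> cball x (norm x))"
    by (rule finite_Int_cball)
  have ne: "0 \<in> L \<inter> cball x (norm x)"
    by (simp add: dist_norm)
  then obtain q where q: "q \<in> L \<inter> cball x (norm x)"
      "\<And>q'. q' \<in> L \<inter> cball x (norm x) \<Longrightarrow> dist x q \<le> dist x q'"
    using fin arg_min_if_finite[of "L \<inter> cball x (norm x)" "dist x"]
    by (metis (no_types, lifting) emptyE linorder_not_less)
  have "dist x q \<le> dist x q'" if "q' \<in> L" for q'
    using q that by (cases "q' \<in> cball x (norm x)") auto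
  then have "x \<in> voronoi_cell L q"
    by (simp add: voronoi_cell_def)
  then have "x + - q \<in> V"
    using q by (auto simp: voronoi_cell_eq)
  then show ?thesis using q uminus_mem by blast
qed

text \<open>Two translates of \<open>x\<close> by \<open>s\<close> and \<open>s'\<close> that both
  lie in \<open>V\<close> have equal norm, which puts \<open>x\<close> on a bisecting hyperplane;
  only countably many such hyperplanes occur.\<close>

lemma AE_unique_translate_V: "AE x in lborel. \<exists>!s. s \<in> L \<and> x + s \<in> V"
proof -
  let ?H = "\<lambda>s s'. {x. (s' - s) \<bullet> x = ((norm s)\<^sup>2 - (norm s')\<^sup>2) / 2}"
  have "AE x in lborel. x \<notin> ?H s s'" if "s \<noteq> s'" for s s'
  proof -
    have "?H s s' \<in> null_sets lebesgue"
      unfolding negligible_iff_null_sets[symmetric] by (rule negligible_hyperplane) (use that in simp)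
    moreover have "?H s s' \<in> sets borel"
      by (intro borel_closed closed_hyperplane)
    ultimately have "?H s s' \<in> null_sets lborel"
      by (simp add: null_sets_completion_iff)
    then show ?thesis by (rule AE_not_in)
  qed
  then have "AE x in lborel. \<forall>s\<in>L. \<forall>s'\<in>L. s \<noteq> s' \<longrightarrow> x \<notin> ?H s s'"
    unfolding AE_ball_countable[OF countable_lattice] by (intro ballI AE_impI) blast
  then show ?thesis
  proof eventually_elim
    case (elim x)
    have "s = s'" if "s \<in> L" "x + s \<in> V" "s' \<in> L" "x + s' \<in> V" for s s'
    proof (rule ccontr)
      assume "s \<noteq> s'"
      have "norm (x + s) \<le> norm (x + s - q)" "norm (x + s') \<le> norm (x + s' - q)" if "q \<in> L" for q
        using \<open>x + s \<in> V\<close> \<open>x + s' \<in> V\<close> that by (auto simp: V_def voronoi_cell_def dist_norm)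
      from this(1)[of "s - s'"] this(2)[of "s' - s"] have "norm (x + s) = norm (x + s')"
        using diff_mem[OF \<open>s \<in> L\<close> \<open>s' \<in> L\<close>] diff_mem[OF \<open>s' \<in> L\<close> \<open>s \<in> L\<close>] by simp
      then have "(x + s) \<bullet> (x + s) = (x + s') \<bullet> (x + s')"
        by (simp add: norm_eq)
      then have "x \<in> ?H s s'"
        by (simp add: inner_simps inner_commute power2_norm_eq_inner field_simps)
      then show False using elim that \<open>s \<noteq> s'\<close> by blast
    qed
    then show ?case using exists_add_mem_V[of x] by blast
  qed
qed

text \<open>Unfolding: \<open>V\<close> is a fundamental domain up to a null set. The finite set
  \<open>S\<close> holds every translate that can matter, so no infinite sum is interchanged with
  the integral.\<close>

lemma integral_sum_translates:
  fixes h :: "'a \<Rightarrow> 'b::{banach, second_countable_topology}"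
  assumes h: "integrable lborel h" and S: "finite S" "S \<subseteq> L"
    and supp: "\<And>x s. s \<in> L \<Longrightarrow> x \<in> V \<Longrightarrow> h (x + s) \<noteq> 0 \<Longrightarrow> s \<in> S"
  shows "(\<integral>x. indicat_real V x *\<^sub>R (\<Sum>s\<in>S. h (x + s)) \<partial>lborel) = integral\<^sup>L lborel h"
proof -
  have int1: "integrable lborel (\<lambda>x. indicat_real V x *\<^sub>R h (x + t))" for t
    using integrable_lborel_translate[OF h, of t] by (rule integrable_mult_indicator[rotated]) simp
  have int2: "integrable lborel (\<lambda>x. indicat_real V (x + - t) *\<^sub>R h x)" for t
    using integrable_lborel_translate[OF int1[of t], of "- t"] by simp
  have "(\<integral>x. indicat_real V x *\<^sub>R (\<Sum>s\<in>S. h (x + s)) \<partial>lborel)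
      = (\<Sum>s\<in>S. \<integral>x. indicat_real V x *\<^sub>R h (x + s) \<partial>lborel)"
    using int1 by (simp add: scaleR_sum_right)
  also have "\<dots> = (\<Sum>s\<in>S. \<integral>x. indicat_real V (x + - s) *\<^sub>R h x \<partial>lborel)"
  proof (intro sum.cong refl)
    fix s
    show "(\<integral>x. indicat_real V x *\<^sub>R h (x + s) \<partial>lborel) = (\<integral>x. indicat_real V (x + - s) *\<^sub>R h x \<partial>lborel)"
      using integral_lborel_translate[OF int2[of s], of s] by simp
  qed
  also have "\<dots> = (\<integral>x. (\<Sum>s\<in>S. indicat_real V (x + - s) *\<^sub>R h x) \<partial>lborel)"
    using int2 by (subst Bochner_Integration.integral_sum) auto
  also have "\<dots> = integral\<^sup>L lborel h"
  proof (rule integral_cong_AE)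
    show "(\<lambda>x. \<Sum>s\<in>S. indicat_real V (x + - s) *\<^sub>R h x) \<in> borel_measurable lborel"
      using int2 by (intro borel_measurable_sum borel_measurable_integrable)
    show "AE x in lborel. (\<Sum>s\<in>S. indicat_real V (x + - s) *\<^sub>R h x) = h x"
      using AE_unique_translate_V
    proof eventually_elim
      case (elim x)
      show ?case
      proof (cases "h x = 0")
        case False
        from elim obtain s0 where s0: "s0 \<in> L" "x + s0 \<in> V" and
          unique: "\<And>s. s \<in> L \<Longrightarrow> x + s \<in> V \<Longrightarrow> s = s0" by blast
        \<comment> \<open>The representative of \<open>x\<close> in the cell is
          \<open>x + s0\<close>, so \<open>x\<close> is its translate by
          \<open>- s0\<close>.\<close>
        have mem: "- s0 \<in> S"
          using supp[of "- s0" "x + s0"] s0 False uminus_mem by simp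
        have "indicat_real V (x + - s) = (if s = - s0 then 1 else 0)" if "s \<in> S" for s
        proof (cases "x + - s \<in> V")
          case True
          then have "- s = s0"
            using unique[of "- s"] uminus_mem[of s] that S by blast
          then show ?thesis using True by auto
        next
          case False
          then have "s \<noteq> - s0"
            using s0 by auto
          then show ?thesis using False by simp
        qed
        then have "(\<Sum>s\<in>S. indicat_real V (x + - s) *\<^sub>R h x) = (\<Sum>s\<in>S. if s = - s0 then h x else 0)"
          by (intro sum.cong) auto
        then show ?thesis
          using mem S(1) by simp
      qed simp
    qed
  qed (use borel_measurable_integrable[OF h] in simp_all)
  finally show ?thesis .
qed

section \<open>Elimination of the coefficients\<close>

text \<open>In the finite double sum below, the coefficient \<open>c (- s - s')\<close> is symmetric in \<open>s\<close> and \<open>s'\<close>.\<close>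

lemma exchange_sum:
  assumes g: "integrable_supp R g"
    and x: "\<And>s. s \<in> L \<Longrightarrow> ((\<lambda>q. c q * g (x - s - q)) has_sum f (x - s)) L"
    and y: "\<And>s. s \<in> L \<Longrightarrow> ((\<lambda>q. c q * g (y - s - q)) has_sum f (y - s)) L"
    and S: "finite S" "S \<subseteq> L" "\<And>s. s \<in> L \<Longrightarrow> f (x - s) \<noteq> 0 \<or> g (x + s) \<noteq> 0 \<Longrightarrow> s \<in> S"
  shows "(\<Sum>s\<in>S. f (x - s) * g (y + s)) = (\<Sum>s\<in>S. f (y - s) * g (x + s))"
proof -
  define A where "A z = L \<inter> cball (- z) R" for z
  have A: "finite (A z)" "A z \<subseteq> L" for z
    using finite_Int_cball by (auto simp: A_def)
  have memA: "s \<in> A z" if "s \<in> L" "g (z + s) \<noteq> 0" for s z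
  proof -
    have "dist (- z) s = norm (z + s)"
      by (metis dist_minus dist_norm add.inverse_inverse diff_minus_eq_add)
    then show ?thesis
      using integrable_suppD(2)[OF g that(2)] that(1) by (simp add: A_def)
  qed
  have g0: "g (z + s) = 0" if "s \<in> L" "s \<notin> A z" for s z
    using memA that by blast
  have f0: "f (x - s) = 0" and gx0: "g (x + s) = 0" if "s \<in> L" "s \<notin> S" for s
    using S(3) that by blast+
  have mem: "s \<in> L" if "s \<in> A z \<or> s \<in> S" for s z
    using that A(2) S(2) by blast
  have expand: "f (z - s) = (\<Sum>s'\<in>A z. c (- s - s') * g (z + s'))"
    if H: "((\<lambda>q. c q * g (z - s - q)) has_sum f (z - s)) L" and "s \<in> L" for z s
  proof -
    have "bij_betw (\<lambda>q. - s - q) L L"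
      by (rule bij_betw_byWitness[where f' = "\<lambda>q. - s - q"])
         (use \<open>s \<in> L\<close> diff_mem uminus_mem in auto)
    from has_sum_reindex_bij_betw[OF this, of "\<lambda>q. c q * g (z - s - q)"] H
    have "((\<lambda>s'. c (- s - s') * g (z + s')) has_sum f (z - s)) L"
      by (simp add: algebra_simps)
    then have "((\<lambda>s'. c (- s - s') * g (z + s')) has_sum f (z - s)) (A z)"
      by (rule has_sum_cong_neutral[THEN iffD1, rotated -1]) (use A memA in auto)
    then show ?thesis
      using A(1) has_sum_finite has_sum_unique by blast
  qed
  \<comment> \<open>The index of a nonzero summand lies in both sets: the factor with
    \<open>f\<close> puts it into \<open>S\<close>, the factor with \<open>g\<close> into
    \<open>A y\<close>.\<close>
  have "(\<Sum>s\<in>S. f (x - s) * g (y + s)) = (\<Sum>s\<in>A y. f (x - s) * g (y + s))"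
    by (rule sum.mono_neutral_cong) (use S(1) A(1) in \<open>auto simp: g0 f0 gx0 mem\<close>)
  also have "\<dots> = (\<Sum>s\<in>A y. \<Sum>s'\<in>A x. c (- s - s') * g (x + s') * g (y + s))"
    using A(2)[of y] by (intro sum.cong refl) (simp add: expand[OF x] subset_eq sum_distrib_right)
  also have "\<dots> = (\<Sum>s'\<in>A x. \<Sum>s\<in>A y. c (- s - s') * g (x + s') * g (y + s))"
    by (rule sum.swap)
  also have "\<dots> = (\<Sum>s'\<in>A x. \<Sum>s\<in>A y. c (- s' - s) * g (y + s) * g (x + s'))"
    by (intro sum.cong refl, subst minus_diff_commute) simp
  also have "\<dots> = (\<Sum>s'\<in>A x. f (y - s') * g (x + s'))"
    using A(2)[of x] by (intro sum.cong refl) (simp add: expand[OF y] subset_eq sum_distrib_right)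
  also have "\<dots> = (\<Sum>s\<in>S. f (y - s) * g (x + s))"
    by (rule sum.mono_neutral_cong) (use S(1) A(1) in \<open>auto simp: g0 f0 gx0 mem\<close>)
  finally show ?thesis .
qed

text \<open>The identity of \<open>exchange_sum\<close> no longer mentions the coefficients. It is
  integrated in \<open>y\<close> against the second character over the whole space, then in
  \<open>x\<close> against the first one over \<open>V\<close>, where the sums over \<open>S\<close>
  unfold to full transforms.\<close>

lemma transform_exchange:
  assumes f: "integrable_supp R f" and g: "integrable_supp R' g"
    and expansion: "AE x in lborel. ((\<lambda>q. c q * g (x - q)) has_sum f x) L"
    and eq: "\<And>s. s \<in> L \<Longrightarrow> char_exp a b s = char_exp a' b' s"
  shows "transform f (char_exp a b) * transform g (char_exp a' b')
       = transform f (char_exp a' b') * transform g (char_exp a b)"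
proof -
  let ?w = "char_exp a b" and ?w' = "char_exp a' b'"
  obtain r where r: "V \<subseteq> cball 0 r"
    using bounded_V by (auto simp: bounded_iff subset_eq)
  \<comment> \<open>Large enough for all translates that bring the cell, of radius \<open>r\<close>,
    into one of the supports. Absolute values appear because the radii may be negative, and the ball
    is centred at 0 so that \<open>S\<close> is invariant under negation.\<close>
  define S where "S = L \<inter> cball 0 (r + \<bar>R\<bar> + \<bar>R'\<bar>)"
  have S: "finite S" "S \<subseteq> L" and uminus_S: "uminus ` S = S"
    using uminus_mem by (auto simp: S_def finite_Int_cball image_iff intro!: bexI[of _ "- _"])
  have memS: "s \<in> S" if "s \<in> L" "x \<in> V" "f (x - s) \<noteq> 0 \<or> f (x + s) \<noteq> 0 \<or> g (x + s) \<noteq> 0" for x s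
  proof -
    have "norm x \<le> r" using r that by auto
    moreover have "norm (x - s) \<le> \<bar>R\<bar> \<or> norm (x + s) \<le> \<bar>R\<bar> \<or> norm (x + s) \<le> \<bar>R'\<bar>"
      using integrable_suppD(2)[OF f, of "x - s"] integrable_suppD(2)[OF f, of "x + s"]
        integrable_suppD(2)[OF g, of "x + s"] that by linarith
    moreover have "norm s \<le> norm x + norm (x - s)" "norm s \<le> norm x + norm (x + s)"
      using norm_triangle_ineq4[of x "x - s"] norm_triangle_ineq4[of "x + s" x] by simp_all
    ultimately have "norm s \<le> r + \<bar>R\<bar> + \<bar>R'\<bar>" by linarith
    then show ?thesis using \<open>s \<in> L\<close> by (simp add: S_def)
  qed
  have good: "AE x in lborel. \<forall>s\<in>L. ((\<lambda>q. c q * g (x - s - q)) has_sum f (x - s)) L"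
    using AE_lborel_translate[OF expansion, of "- _"]
    by (subst AE_ball_countable[OF countable_lattice]) auto
  have [measurable]: "f \<in> borel_measurable borel" "g \<in> borel_measurable borel"
    using integrable_suppD(1)[OF f] integrable_suppD(1)[OF g] by (auto dest: borel_measurable_integrable)
  have int_f: "integrable lborel (\<lambda>y. f y *\<^sub>R char_exp a b y)"
    and int_g: "integrable lborel (\<lambda>y. g y *\<^sub>R char_exp a b y)" for a b
    by (intro integrable_scaleR_continuous[OF f] integrable_scaleR_continuous[OF g] continuous_intros)+
  have tr: "integrable lborel (\<lambda>y. h (y + t) *\<^sub>R ?w' y)"
    "(\<integral>y. h (y + t) *\<^sub>R ?w' y \<partial>lborel) = transform h ?w' / ?w' t"
    if "integrable lborel (\<lambda>y. h y *\<^sub>R ?w' y)" for h t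
  proof -
    have *: "h (y + t) *\<^sub>R ?w' y = h (y + t) *\<^sub>R ?w' (y + t) / ?w' t" for y
      by (simp add: char_exp_add scaleR_conv_of_real)
    show "integrable lborel (\<lambda>y. h (y + t) *\<^sub>R ?w' y)"
      unfolding * using integrable_lborel_translate[OF that, of t] by simp
    show "(\<integral>y. h (y + t) *\<^sub>R ?w' y \<partial>lborel) = transform h ?w' / ?w' t"
      unfolding * transform_def using integral_lborel_translate[OF that, of t] by simp
  qed
  have step: "AE x in lborel. x \<in> V \<longrightarrow>
      (\<Sum>s\<in>S. f (x - s) *\<^sub>R (transform g ?w' / ?w s)) = (\<Sum>s\<in>S. g (x + s) *\<^sub>R (transform f ?w' * ?w s))"
    using good
  proof eventually_elim
    case (elim x)
    show ?case
    proof
      assume "x \<in> V"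
      have "(\<Sum>s\<in>S. f (x - s) *\<^sub>R (transform g ?w' / ?w' s))
          = (\<Sum>s\<in>S. f (x - s) *\<^sub>R (\<integral>y. g (y + s) *\<^sub>R ?w' y \<partial>lborel))"
        by (simp only: tr(2)[OF int_g])
      also have "\<dots> = (\<integral>y. (\<Sum>s\<in>S. f (x - s) *\<^sub>R (g (y + s) *\<^sub>R ?w' y)) \<partial>lborel)"
        using tr(1)[OF int_g]
        by (subst Bochner_Integration.integral_sum) (simp_all del: scaleR_scaleR)
      also have "\<dots> = (\<integral>y. (\<Sum>s\<in>S. f (x - s) * g (y + s)) *\<^sub>R ?w' y \<partial>lborel)"
        by (simp only: scaleR_sum_left scaleR_scaleR)
      also have "\<dots> = (\<integral>y. (\<Sum>s\<in>S. f (y - s) * g (x + s)) *\<^sub>R ?w' y \<partial>lborel)"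
      proof (rule integral_cong_AE)
        show "(\<lambda>y. (\<Sum>s\<in>S. f (x - s) * g (y + s)) *\<^sub>R ?w' y) \<in> borel_measurable lborel"
          "(\<lambda>y. (\<Sum>s\<in>S. f (y - s) * g (x + s)) *\<^sub>R ?w' y) \<in> borel_measurable lborel"
          by measurable
        show "AE y in lborel. (\<Sum>s\<in>S. f (x - s) * g (y + s)) *\<^sub>R ?w' y
            = (\<Sum>s\<in>S. f (y - s) * g (x + s)) *\<^sub>R ?w' y"
          using good
        proof eventually_elim
          case y: (elim y)
          have "(\<Sum>s\<in>S. f (x - s) * g (y + s)) = (\<Sum>s\<in>S. f (y - s) * g (x + s))"
          proof (rule exchange_sum[OF g])
            show "((\<lambda>q. c q * g (x - s - q)) has_sum f (x - s)) L" if "s \<in> L" for s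
              using elim that by blast
            show "((\<lambda>q. c q * g (y - s - q)) has_sum f (y - s)) L" if "s \<in> L" for s
              using y that by blast
          qed (use S memS \<open>x \<in> V\<close> in auto)
          then show ?case by simp
        qed
      qed
      also have "\<dots> = (\<integral>y. (\<Sum>s\<in>S. g (x + s) *\<^sub>R (f (y + - s) *\<^sub>R ?w' y)) \<partial>lborel)"
        by (simp only: scaleR_sum_left scaleR_scaleR mult.commute diff_conv_add_uminus)
      also have "\<dots> = (\<Sum>s\<in>S. g (x + s) *\<^sub>R (\<integral>y. f (y + - s) *\<^sub>R ?w' y \<partial>lborel))"
        using tr(1)[OF int_f, of "- _"] 
        by (subst Bochner_Integration.integral_sum) (simp_all del: scaleR_scaleR)
      also have "\<dots> = (\<Sum>s\<in>S. g (x + s) *\<^sub>R (transform f ?w' * ?w' s))"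
        unfolding tr(2)[OF int_f] by (simp add: char_exp_minus divide_inverse)
      \<comment> \<open>The agreement of the characters enters here: at the lattice vectors
        \<open>s\<close> the second one is replaced by the first, which the unfolding over
        \<open>x\<close> requires.\<close>
      finally show "(\<Sum>s\<in>S. f (x - s) *\<^sub>R (transform g ?w' / ?w s))
          = (\<Sum>s\<in>S. g (x + s) *\<^sub>R (transform f ?w' * ?w s))"
        using eq S(2) by (simp add: subset_eq)
    qed
  qed
  have unfold_f: "(\<integral>x. indicat_real V x *\<^sub>R (\<Sum>s\<in>S. f (x + s) *\<^sub>R ?w (x + s)) \<partial>lborel) = transform f ?w"
    unfolding transform_def by (rule integral_sum_translates[OF int_f S]) (use memS in auto)
  have unfold_g: "(\<integral>x. indicat_real V x *\<^sub>R (\<Sum>s\<in>S. g (x + s) *\<^sub>R ?w (x + s)) \<partial>lborel) = transform g ?w"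
    unfolding transform_def by (rule integral_sum_translates[OF int_g S]) (use memS in auto)
  have "transform f ?w * transform g ?w'
      = (\<integral>x. indicat_real V x *\<^sub>R (\<Sum>s\<in>S. f (x + s) *\<^sub>R ?w (x + s)) * transform g ?w' \<partial>lborel)"
    by (simp only: unfold_f integral_mult_left_zero)
  also have "\<dots> = (\<integral>x. indicat_real V x *\<^sub>R (\<Sum>s\<in>S. g (x + s) *\<^sub>R ?w (x + s)) * transform f ?w' \<partial>lborel)"
  proof (rule integral_cong_AE)
    show "(\<lambda>x. indicat_real V x *\<^sub>R (\<Sum>s\<in>S. f (x + s) *\<^sub>R ?w (x + s)) * transform g ?w') \<in> borel_measurable lborel"
      "(\<lambda>x. indicat_real V x *\<^sub>R (\<Sum>s\<in>S. g (x + s) *\<^sub>R ?w (x + s)) * transform f ?w') \<in> borel_measurable lborel"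
      by measurable
    show "AE x in lborel. indicat_real V x *\<^sub>R (\<Sum>s\<in>S. f (x + s) *\<^sub>R ?w (x + s)) * transform g ?w'
        = indicat_real V x *\<^sub>R (\<Sum>s\<in>S. g (x + s) *\<^sub>R ?w (x + s)) * transform f ?w'"
      using step
    proof eventually_elim
      case (elim x)
      show ?case
      proof (cases "x \<in> V")
        case True
        have "(\<Sum>s\<in>S. f (x + s) *\<^sub>R ?w (x + s)) = (\<Sum>s\<in>S. f (x + - s) *\<^sub>R ?w (x + - s))"
          using sum.reindex[of uminus S "\<lambda>s. f (x + s) *\<^sub>R ?w (x + s)"] uminus_S by simp
        then have "(\<Sum>s\<in>S. f (x + s) *\<^sub>R ?w (x + s)) * transform g ?w'
            = ?w x * (\<Sum>s\<in>S. f (x - s) *\<^sub>R (transform g ?w' / ?w s))"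
          by (simp only: sum_distrib_left sum_distrib_right char_exp_add char_exp_minus divide_inverse
              diff_conv_add_uminus mult_scaleR_left mult_scaleR_right mult_ac)
        also have "\<dots> = ?w x * (\<Sum>s\<in>S. g (x + s) *\<^sub>R (transform f ?w' * ?w s))"
          using elim True by simp
        also have "\<dots> = (\<Sum>s\<in>S. g (x + s) *\<^sub>R ?w (x + s)) * transform f ?w'"
          by (simp only: sum_distrib_left sum_distrib_right char_exp_add
              mult_scaleR_left mult_scaleR_right mult_ac)
        finally show ?thesis using True by simp
      qed simp
    qed
  qed
  also have "\<dots> = transform f ?w' * transform g ?w"
    by (simp only: unfold_g integral_mult_left_zero) (rule mult.commute)
  finally show ?thesis .
qed

end

section \<open>Consequences of refinability for the transform of the Voronoi cell\<close>

context euclidean_lattice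
begin

lemma scaled_lattice: "l \<noteq> 0 \<Longrightarrow> euclidean_lattice ((*\<^sub>R) l ` L)"
proof
  assume l: "l \<noteq> 0"
  show "0 \<in> (*\<^sub>R) l ` L"
    by (rule image_eqI[of _ _ 0]) auto
  show "x - y \<in> (*\<^sub>R) l ` L" if "x \<in> (*\<^sub>R) l ` L" "y \<in> (*\<^sub>R) l ` L" for x y
    using that diff_mem by (auto simp flip: scaleR_diff_right)
  obtain m where m: "m > 0" "\<forall>x\<in>L. x \<noteq> 0 \<longrightarrow> m \<le> norm x"
    using discrete by blast
  show "\<exists>m>0. \<forall>x\<in>(*\<^sub>R) l ` L. x \<noteq> 0 \<longrightarrow> m \<le> norm x"
    using l m by (intro exI[of _ "\<bar>l\<bar> * m"]) auto
  have "L \<subseteq> span ((*\<^sub>R) l ` L)"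
  proof
    fix x assume "x \<in> L"
    then have "inverse l *\<^sub>R (l *\<^sub>R x) \<in> span ((*\<^sub>R) l ` L)"
      by (intro span_scale span_base) auto
    then show "x \<in> span ((*\<^sub>R) l ` L)"
      using l by simp
  qed
  then have "span L \<subseteq> span ((*\<^sub>R) l ` L)"
    by (rule span_minimal) (rule subspace_span)
  then show "span ((*\<^sub>R) l ` L) = UNIV"
    using spanning by auto
qed

lemma scaleR_V:
  assumes "l > 0"
  shows "indicat_real ((*\<^sub>R) l ` V) (l *\<^sub>R x) = indicat_real V x"
  using assms by (auto simp: indicator_def)

definition cell_transform :: "'a \<Rightarrow> 'a \<Rightarrow> complex" where
  "cell_transform a b = transform (indicat_real V) (char_exp a b)"

lemma integrable_supp_V: "\<exists>R. integrable_supp R (indicat_real V)"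
proof -
  obtain r where "V \<subseteq> cball 0 r"
    using bounded_V by (auto simp: bounded_iff subset_eq)
  then show ?thesis
    using integrable_supp_indicator[OF sets_V] by blast
qed

lemma integrable_V_continuous:
  fixes h :: "'a \<Rightarrow> 'b::{banach, second_countable_topology}"
  assumes "continuous_on UNIV h"
  shows "integrable lborel (\<lambda>x. indicat_real V x *\<^sub>R h x)"
  using integrable_supp_V integrable_scaleR_continuous[OF _ assms] by blast

lemma transform_scaled_V:
  assumes "l > 0"
  shows "\<exists>R. integrable_supp R (indicat_real ((*\<^sub>R) l ` V))"
    and "transform (indicat_real ((*\<^sub>R) l ` V)) (char_exp a b) = l ^ DIM('a) *\<^sub>R cell_transform (l *\<^sub>R a) (l *\<^sub>R b)"
proof -
  have "compact ((*\<^sub>R) l ` V)"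
    by (intro compact_scaling compact_V)
  then have "(*\<^sub>R) l ` V \<in> sets borel" "bounded ((*\<^sub>R) l ` V)"
    by (auto intro: borel_closed compact_imp_closed compact_imp_bounded)
  then show R: "\<exists>R. integrable_supp R (indicat_real ((*\<^sub>R) l ` V))"
    using integrable_supp_indicator[of "(*\<^sub>R) l ` V"] by (auto simp: bounded_iff subset_eq)
  have "transform (indicat_real ((*\<^sub>R) l ` V)) (char_exp a b)
      = \<bar>l\<bar> ^ DIM('a) *\<^sub>R
        (\<integral>x. indicat_real ((*\<^sub>R) l ` V) (0 + l *\<^sub>R x) *\<^sub>R char_exp a b (0 + l *\<^sub>R x) \<partial>lborel)"
    unfolding transform_def using assms R
    by (intro integral_lborel_affine) (auto intro!: integrable_scaleR_continuous continuous_intros)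
  also have "\<dots> = l ^ DIM('a) *\<^sub>R cell_transform (l *\<^sub>R a) (l *\<^sub>R b)"
    using assms by (simp add: scaleR_V transform_def cell_transform_def char_exp_def)
  finally show "transform (indicat_real ((*\<^sub>R) l ` V)) (char_exp a b) = l ^ DIM('a) *\<^sub>R cell_transform (l *\<^sub>R a) (l *\<^sub>R b)" .
qed

text \<open>The cells are countably many convex sets, and frontiers of convex sets are null. Thus
  the exception made for order 1 costs only a null set, and all orders are treated through
  expansions valid almost everywhere.\<close>

lemma AE_cell_boundaries:
  assumes "l > 0"
  shows "AE x in lborel. x \<notin> cell_boundaries (voronoi_tessellation L) \<union>
           cell_boundaries (scaled_copy l v ` voronoi_tessellation L)"
proof -
  have *: "AE x in lborel. x \<notin> frontier C" if "convex C" for C :: "'a set"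
  proof -
    have "frontier C \<in> null_sets lebesgue"
      using negligible_convex_frontier[OF that] by (simp add: negligible_iff_null_sets)
    then have "frontier C \<in> null_sets lborel"
      by (simp add: null_sets_completion_iff borel_closed)
    then show ?thesis by (rule AE_not_in)
  qed
  have conv: "convex C" if "C \<in> voronoi_tessellation L" for C
    using that convex_V by (auto simp: voronoi_tessellation_def voronoi_cell_eq convex_translation)
  have conv': "convex (scaled_copy l v C)" if "convex C" for C
  proof -
    have "scaled_copy l v C = (+) v ` (*\<^sub>R) l ` C"
      by (auto simp: scaled_copy_def image_image add.commute)
    then show ?thesis using that by (simp add: convex_translation convex_scaling)
  qed
  have "countable (voronoi_tessellation L)"
    unfolding voronoi_tessellation_def using countable_lattice by simp
  then have "AE x in lborel. \<forall>C\<in>voronoi_tessellation L \<union> scaled_copy l v ` voronoi_tessellation L. x \<notin> frontier C"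
    by (subst AE_ball_countable) (use conv conv' * in auto)
  then show ?thesis
    unfolding cell_boundaries_def by eventually_elim auto
qed

lemma refines_expansion:
  assumes "voronoi_refines L k l v" "l > 0" "p \<in> L"
  obtains c where "AE x in lborel. ((\<lambda>q. c q * conv_power (indicat_real ((*\<^sub>R) l ` V)) k (x - q - v))
    has_sum conv_power (indicat_real V) k (x - p)) ((*\<^sub>R) l ` L)"
proof -
  have sc: "scaled_copy l v L = (\<lambda>q. q + v) ` (*\<^sub>R) l ` L" "scaled_copy l 0 V = (*\<^sub>R) l ` V"
    by (auto simp: scaled_copy_def image_image)
  obtain c where c: "\<And>x. x \<notin> cell_boundaries (voronoi_tessellation L) \<union>
           cell_boundaries (scaled_copy l v ` voronoi_tessellation L) \<Longrightarrow>
      ((\<lambda>q. c q * cell_spline k (scaled_copy l 0 V) q x) has_sum cell_spline k V p x) (scaled_copy l v L)"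
    using assms(1,3) unfolding voronoi_refines_def Let_def V_def[symmetric] by blast
  have "AE x in lborel. ((\<lambda>q. c (q + v) * conv_power (indicat_real ((*\<^sub>R) l ` V)) k (x - q - v))
    has_sum conv_power (indicat_real V) k (x - p)) ((*\<^sub>R) l ` L)"
    using AE_cell_boundaries[OF \<open>l > 0\<close>, of v]
  proof eventually_elim
    case (elim x)
    have "((\<lambda>q. c q * cell_spline k ((*\<^sub>R) l ` V) q x) has_sum cell_spline k V p x) ((\<lambda>q. q + v) ` (*\<^sub>R) l ` L)"
      using c[OF elim] unfolding sc .
    then show ?case
      by (subst (asm) has_sum_reindex) (simp_all add: cell_spline_def o_def diff_diff_eq)
  qed
  then show ?thesis by (rule that)
qed

text \<open>The two frequencies 0 and \<open>(2 * pi / l) *\<^sub>R \<eta>\<close> give the same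
  character on the scaled lattice, since the factors \<open>l\<close> cancel and
  \<open>\<eta>\<close> is integral on \<open>L\<close>. The translation \<open>p\<close> is kept:
  comparing different \<open>p\<close> later forces \<open>\<eta> / l\<close> into the dual
  lattice.\<close>

lemma refines_transform:
  assumes ref: "voronoi_refines L k l v" and l: "l > 0" and k: "k \<ge> 1" and "p \<in> L"
    and \<eta>: "\<And>s. s \<in> L \<Longrightarrow> \<eta> \<bullet> s \<in> \<int>"
  shows "char_exp a 0 p * cell_transform a 0 ^ k * (char_exp a ((2 * pi / l) *\<^sub>R \<eta>) v * cell_transform (l *\<^sub>R a) ((2 * pi) *\<^sub>R \<eta>) ^ k)
    = char_exp a ((2 * pi / l) *\<^sub>R \<eta>) p * cell_transform a ((2 * pi / l) *\<^sub>R \<eta>) ^ k * (char_exp a 0 v * cell_transform (l *\<^sub>R a) 0 ^ k)"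
proof -
  interpret M: euclidean_lattice "(*\<^sub>R) l ` L"
    using scaled_lattice l by simp
  obtain k' where k': "k = Suc k'"
    using k by (cases k) auto
  obtain R R' where R: "integrable_supp R (indicat_real V)"
      and R': "integrable_supp R' (indicat_real ((*\<^sub>R) l ` V))"
    using integrable_supp_V transform_scaled_V(1)[OF l] by blast
  define f where "f = conv_power (indicat_real V) k"
  define g where "g = conv_power (indicat_real ((*\<^sub>R) l ` V)) k"
  obtain r r' where r: "integrable_supp r f" and r': "integrable_supp r' g"
    using conv_power_supp_transform(1)[OF R] conv_power_supp_transform(1)[OF R'] k'
    unfolding f_def g_def by blast
  have tf: "transform (\<lambda>x. f (x - p)) (char_exp a b) = char_exp a b p * cell_transform a b ^ k" for b
    unfolding transform_translate[OF r]
    unfolding f_def k' conv_power_supp_transform(2)[OF R] cell_transform_def ..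
  have tg: "transform (\<lambda>x. g (x - v)) (char_exp a b)
      = of_real ((l ^ DIM('a)) ^ k) * (char_exp a b v * cell_transform (l *\<^sub>R a) (l *\<^sub>R b) ^ k)" for b
    unfolding transform_translate[OF r']
    unfolding g_def k' conv_power_supp_transform(2)[OF R'] transform_scaled_V(2)[OF l]
    by (simp add: scaleR_conv_of_real power_mult_distrib)
  obtain c where c: "AE x in lborel. ((\<lambda>q. c q * g (x - q - v)) has_sum f (x - p)) ((*\<^sub>R) l ` L)"
    unfolding f_def g_def using refines_expansion[OF ref l \<open>p \<in> L\<close>] by blast
  have eq: "char_exp a 0 s = char_exp a ((2 * pi / l) *\<^sub>R \<eta>) s" if s: "s \<in> (*\<^sub>R) l ` L" for s
  proof -
    obtain y where y: "y \<in> L" "s = l *\<^sub>R y"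
      using s by auto
    obtain n where n: "\<eta> \<bullet> y = of_int n"
      using \<eta>[OF y(1)] by (auto elim: Ints_cases)
    have "((2 * pi / l) *\<^sub>R \<eta>) \<bullet> s = 2 * pi * of_int n"
      using l n y by simp
    then show ?thesis
      by (simp add: char_exp_def complex_eq_iff Re_exp Im_exp cos_int_2pin sin_int_2pin)
  qed
  have "transform (\<lambda>x. f (x - p)) (char_exp a 0) * transform (\<lambda>x. g (x - v)) (char_exp a ((2 * pi / l) *\<^sub>R \<eta>))
      = transform (\<lambda>x. f (x - p)) (char_exp a ((2 * pi / l) *\<^sub>R \<eta>)) * transform (\<lambda>x. g (x - v)) (char_exp a 0)"
    using c by (intro M.transform_exchange[OF integrable_supp_translate[OF r] integrable_supp_translate[OF r'] _ eq]) auto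
  then show ?thesis
    unfolding tf tg using l by (simp add: mult.assoc)
qed

text \<open>If the integral were zero, \<open>V\<close> would be null, and so would the union of its
  countably many lattice translates, which is the whole space.\<close>

lemma cell_transform_real_pos: "\<exists>r>0. cell_transform a 0 = of_real r"
proof -
  define r where "r = (\<integral>x. indicat_real V x *\<^sub>R exp (a \<bullet> x) \<partial>lborel)"
  have int: "integrable lborel (\<lambda>x. indicat_real V x *\<^sub>R exp (a \<bullet> x))"
    by (intro integrable_V_continuous continuous_intros)
  have "cell_transform a 0 = (\<integral>x. of_real (indicat_real V x *\<^sub>R exp (a \<bullet> x)) \<partial>lborel)"
    by (simp add: cell_transform_def transform_def char_exp_real scaleR_conv_of_real)
  also have "\<dots> = of_real r"
    unfolding r_def by (rule integral_complex_of_real)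
  finally have "cell_transform a 0 = of_real r" .
  moreover have "r > 0"
  proof -
    have "r \<noteq> 0"
    proof
      assume "r = 0"
      then have "AE x in lborel. indicat_real V x *\<^sub>R exp (a \<bullet> x) = 0"
        using integral_nonneg_eq_0_iff_AE[OF int] by (simp add: r_def)
      then have "AE x in lborel. x \<notin> V"
        by eventually_elim (auto simp: indicator_def split: if_splits)
      then have "AE x in lborel. \<forall>s\<in>L. x + s \<notin> V"
        using AE_lborel_translate by (subst AE_ball_countable[OF countable_lattice]) blast
      then have "AE x::'a in lborel. False"
        by eventually_elim (use exists_add_mem_V in blast)
      then show False
        by (simp add: ae_filter_eq_bot_iff trivial_limit_def[symmetric])
    qed
    moreover have "r \<ge> 0"
      unfolding r_def by (rule Bochner_Integration.integral_nonneg) simp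
    ultimately show ?thesis by simp
  qed
  ultimately show ?thesis by blast
qed

definition transform_ratio :: "'a \<Rightarrow> 'a \<Rightarrow> real" where
  "transform_ratio a b = norm (cell_transform a b) / norm (cell_transform a 0)"

text \<open>Changing \<open>p\<close> in the transformed expansion multiplies the two sides by the
  values of the two characters at \<open>p\<close>. If the common value at \<open>p = 0\<close> is
  nonzero, the characters must agree on all of \<open>L\<close>, so \<open>\<eta> / l\<close> is
  again integral; this is what permits the iteration.\<close>

lemma refines_dual_step:
  assumes ref: "voronoi_refines L k l v" and l: "l > 0" and k: "k \<ge> 1"
    and \<eta>: "\<forall>s\<in>L. \<eta> \<bullet> s \<in> \<int>" and nz: "cell_transform a ((2 * pi) *\<^sub>R \<eta>) \<noteq> 0"
  shows "\<forall>s\<in>L. (\<eta> /\<^sub>R l) \<bullet> s \<in> \<int>"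
    and "transform_ratio (a /\<^sub>R l) ((2 * pi) *\<^sub>R (\<eta> /\<^sub>R l)) = transform_ratio a ((2 * pi) *\<^sub>R \<eta>)"
proof -
  define a' \<theta> where "a' = a /\<^sub>R l" and "\<theta> = (2 * pi / l) *\<^sub>R \<eta>"
  have la': "l *\<^sub>R a' = a"
    using l by (simp add: a'_def)
  have *: "char_exp a' 0 p * cell_transform a' 0 ^ k * (char_exp a' \<theta> v * cell_transform a ((2 * pi) *\<^sub>R \<eta>) ^ k)
    = char_exp a' \<theta> p * cell_transform a' \<theta> ^ k * (char_exp a' 0 v * cell_transform a 0 ^ k)" if "p \<in> L" for p
    using refines_transform[OF ref l k that, of \<eta> a'] \<eta> unfolding la' \<theta>_def by blast
  have pos: "cell_transform a 0 \<noteq> 0" "cell_transform a' 0 \<noteq> 0"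
    using cell_transform_real_pos[of a] cell_transform_real_pos[of a'] by auto
  have 0: "cell_transform a' 0 ^ k * (char_exp a' \<theta> v * cell_transform a ((2 * pi) *\<^sub>R \<eta>) ^ k)
      = cell_transform a' \<theta> ^ k * (char_exp a' 0 v * cell_transform a 0 ^ k)" (is "?X = ?Y")
    using *[of 0] by simp
  have X: "?X \<noteq> 0"
    using nz pos by simp
  show "\<forall>s\<in>L. (\<eta> /\<^sub>R l) \<bullet> s \<in> \<int>"
  proof
    fix s assume "s \<in> L"
    have "char_exp a' 0 s * ?X = char_exp a' \<theta> s * ?Y"
      using *[OF \<open>s \<in> L\<close>] by (simp only: mult.assoc)
    then have "char_exp a' 0 s = char_exp a' \<theta> s"
      unfolding 0[symmetric] by (rule mult_right_cancel[OF X, THEN iffD1])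
    then have "cos (\<theta> \<bullet> s) = 1"
      by (simp add: char_exp_def complex_eq_iff Re_exp)
    then obtain n :: int where "\<theta> \<bullet> s = of_int n * 2 * pi"
      by (auto simp: cos_one_2pi_int)
    then have "(2 * pi) * ((\<eta> /\<^sub>R l) \<bullet> s) = (2 * pi) * of_int n"
      by (simp add: \<theta>_def divide_inverse mult_ac)
    then have "(\<eta> /\<^sub>R l) \<bullet> s = of_int n" by simp
    then show "(\<eta> /\<^sub>R l) \<bullet> s \<in> \<int>" by simp
  qed
  \<comment> \<open>The modulus of a character sees only its real exponent, so the shift
    \<open>v\<close> contributes equally to both sides and drops out.\<close>
  have "norm ?X = norm ?Y"
    using 0 by simp
  then have "(norm (cell_transform a' 0) * norm (cell_transform a ((2 * pi) *\<^sub>R \<eta>))) ^ k = (norm (cell_transform a' \<theta>) * norm (cell_transform a 0)) ^ k"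
    by (simp add: norm_mult norm_power norm_char_exp power_mult_distrib)
  then have "norm (cell_transform a' 0) * norm (cell_transform a ((2 * pi) *\<^sub>R \<eta>)) = norm (cell_transform a' \<theta>) * norm (cell_transform a 0)"
    using k by (subst (asm) power_eq_iff_eq_base) auto
  then have "transform_ratio a' \<theta> = transform_ratio a ((2 * pi) *\<^sub>R \<eta>)"
    using pos by (simp add: transform_ratio_def field_simps)
  then show "transform_ratio (a /\<^sub>R l) ((2 * pi) *\<^sub>R (\<eta> /\<^sub>R l)) = transform_ratio a ((2 * pi) *\<^sub>R \<eta>)"
    by (simp add: a'_def \<theta>_def divide_inverse)
qed

lemma refines_dual_iterate:
  assumes ref: "voronoi_refines L k l v" and l: "l > 0" and k: "k \<ge> 1"
    and \<eta>: "\<forall>s\<in>L. \<eta> \<bullet> s \<in> \<int>" and nz: "cell_transform a ((2 * pi) *\<^sub>R \<eta>) \<noteq> 0"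
  shows "(\<forall>s\<in>L. (\<eta> /\<^sub>R l ^ j) \<bullet> s \<in> \<int>) \<and>
    transform_ratio (a /\<^sub>R l ^ j) ((2 * pi) *\<^sub>R (\<eta> /\<^sub>R l ^ j)) = transform_ratio a ((2 * pi) *\<^sub>R \<eta>)"
proof (induction j)
  case (Suc j)
  \<comment> \<open>Since the ratio does not change along the iteration, the nonvanishing required
    by \<open>refines_dual_step\<close> is inherited.\<close>
  have "transform_ratio a ((2 * pi) *\<^sub>R \<eta>) \<noteq> 0"
    using nz cell_transform_real_pos[of a] by (auto simp: transform_ratio_def)
  then have "cell_transform (a /\<^sub>R l ^ j) ((2 * pi) *\<^sub>R (\<eta> /\<^sub>R l ^ j)) \<noteq> 0"
    using Suc by (auto simp: transform_ratio_def)
  from refines_dual_step[OF ref l k _ this] Suc show ?case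
    by (simp add: scaleR_scaleR inverse_mult_distrib mult_ac)
qed (use \<eta> in auto)

end

section \<open>Decay along a shortest vector\<close>

context euclidean_lattice
begin

text \<open>Membership allows an inner product of \<open>(norm q)\<^sup>2 / 2\<close> with
  \<open>q\<close>. Minimality applied to \<open>q - p\<close> shows that \<open>p / 2\<close> uses
  at most half of this, and the radius \<open>norm p / 4\<close> makes the contribution of
  \<open>u\<close> fit into the other half.\<close>

lemma shortest_facet_disc:
  assumes "p \<in> L" and min: "\<And>q. q \<in> L \<Longrightarrow> q \<noteq> 0 \<Longrightarrow> norm p \<le> norm q"
    and "u \<bullet> p = 0" "norm u \<le> norm p / 4"
  shows "p /\<^sub>R 2 - u \<in> V"
  unfolding mem_V_iff
proof
  fix q assume q: "q \<in> L"
  show "(p /\<^sub>R 2 - u) \<bullet> q \<le> (norm q)\<^sup>2 / 2"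
  proof (cases "q = 0 \<or> q = p")
    case True
    then show ?thesis using assms(3) by (auto simp: inner_diff power2_norm_eq_inner)
  next
    case False
    have "norm p \<le> norm (q - p)"
      using False q \<open>p \<in> L\<close> diff_mem by (intro min) auto
    then have "p \<bullet> p \<le> (q - p) \<bullet> (q - p)"
      by (simp add: norm_le)
    then have "p \<bullet> q \<le> (norm q)\<^sup>2 / 2"
      by (simp add: inner_diff inner_commute power2_norm_eq_inner)
    moreover have "- (u \<bullet> q) \<le> (norm q)\<^sup>2 / 4"
    proof -
      have "- (u \<bullet> q) \<le> norm u * norm q"
        using Cauchy_Schwarz_ineq2[of u q] by linarith
      also have "\<dots> \<le> norm q / 4 * norm q"
        using assms(4) min[OF q] False by (intro mult_right_mono) auto
      finally show ?thesis by (simp add: power2_eq_square)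
    qed
    ultimately show ?thesis
      by (simp add: inner_diff_left)
  qed
qed

text \<open>Translation by \<open>u\<close> changes the sign of the integrand, so only the symmetric difference of \<open>V\<close>
  and \<open>V + u\<close> contributes. Both contain the contraction of \<open>V\<close> towards the facet centre \<open>p / 2\<close>,
  and this contraction does not decrease \<open>exp (t * (p \<bullet> x))\<close> on \<open>V\<close>.\<close>

lemma transform_ratio_decay:
  assumes "p \<in> L" and min: "\<And>q. q \<in> L \<Longrightarrow> q \<noteq> 0 \<Longrightarrow> norm p \<le> norm q"
    and u: "u \<bullet> p = 0" "b \<bullet> u = pi" "norm u \<le> \<theta> * (norm p / 4)"
    and \<theta>: "0 < \<theta>" "\<theta> < 1" and "0 \<le> t"
  shows "transform_ratio (t *\<^sub>R p) b \<le> 1 - (1 - \<theta>) ^ DIM('a)"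
proof -
  let ?E = "char_exp (t *\<^sub>R p) b" and ?e = "\<lambda>x. exp (t *\<^sub>R p \<bullet> x)"
  define W where "W = (\<lambda>x. \<theta> *\<^sub>R (p /\<^sub>R 2) + (1 - \<theta>) *\<^sub>R x) ` V"
  define S0 where "S0 = (\<integral>x. indicat_real V x *\<^sub>R ?e x \<partial>lborel)"
  have "compact W"
    unfolding W_def by (intro compact_continuous_image compact_V continuous_intros)
  then have W_supp: "\<exists>R. integrable_supp R (indicat_real W)"
    using integrable_supp_indicator[of W] compact_imp_bounded[of W]
    by (auto simp: bounded_iff subset_eq borel_closed compact_imp_closed)
  have int_e: "integrable lborel (\<lambda>x. indicat_real V x *\<^sub>R ?e x)"
    and int_E: "integrable lborel (\<lambda>x. indicat_real V x *\<^sub>R ?E x)"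
    by (intro integrable_V_continuous continuous_intros)+
  have int_W: "integrable lborel (\<lambda>x. indicat_real W x *\<^sub>R ?e x)"
  proof -
    have "continuous_on UNIV ?e" by (intro continuous_intros)
    then show ?thesis using W_supp integrable_scaleR_continuous by blast
  qed
  have e_u: "?e (x - u) = ?e x" for x
    using u by (simp add: inner_diff_right inner_commute)
  have E_u: "?E (x + - u) = - ?E x" for x
  proof -
    have "?E (x + - u) = ?E x * inverse (?E u)"
      by (simp only: char_exp_add char_exp_minus)
    moreover have "?E u = -1"
      using u by (simp add: char_exp_def inner_commute complex_eq_iff Re_exp Im_exp)
    ultimately show ?thesis by simp
  qed
  have int_eu: "integrable lborel (\<lambda>x. indicat_real V (x - u) *\<^sub>R ?e x)"
    and S0_u: "(\<integral>x. indicat_real V (x - u) *\<^sub>R ?e x \<partial>lborel) = S0"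
    using integrable_lborel_translate[OF int_e, of "- u"] integral_lborel_translate[OF int_e, of "- u"]
    by (simp_all add: e_u[unfolded inner_scaleR_left] S0_def)
  have int_Eu: "integrable lborel (\<lambda>x. indicat_real V (x - u) *\<^sub>R ?E x)"
    and cell_transform_u: "(\<integral>x. indicat_real V (x - u) *\<^sub>R ?E x \<partial>lborel) = - cell_transform (t *\<^sub>R p) b"
    using integrable_lborel_translate[OF int_E, of "- u"] integral_lborel_translate[OF int_E, of "- u"]
    unfolding E_u by (simp_all add: cell_transform_def transform_def minus_equation_iff)
  have W_sub: "x \<in> V \<and> x - u \<in> V" if x: "x \<in> W" for x
  proof -
    obtain z where z: "z \<in> V" "x = \<theta> *\<^sub>R (p /\<^sub>R 2) + (1 - \<theta>) *\<^sub>R z"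
      using x by (auto simp: W_def)
    have "p /\<^sub>R 2 - 0 \<in> V"
      using assms by (intro shortest_facet_disc) auto
    then have "x \<in> V"
      unfolding z using z(1) \<theta> by (intro convexD[OF convex_V]) auto
    \<comment> \<open>Contracting towards this centre instead of \<open>p / 2\<close> moves the
      image of \<open>z\<close> by exactly \<open>- u\<close>; the bound on \<open>norm u\<close>
      keeps the centre in the disc of the facet.\<close>
    moreover have "p /\<^sub>R 2 - u /\<^sub>R \<theta> \<in> V"
      using assms by (intro shortest_facet_disc) (auto simp: field_simps)
    then have "\<theta> *\<^sub>R (p /\<^sub>R 2 - u /\<^sub>R \<theta>) + (1 - \<theta>) *\<^sub>R z \<in> V"
      using z(1) \<theta> by (intro convexD[OF convex_V]) auto
    then have "x - u \<in> V"
      using \<theta> by (simp add: z scaleR_diff_right algebra_simps)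
    ultimately show ?thesis by blast
  qed
  have "2 * cell_transform (t *\<^sub>R p) b
      = (\<integral>x. indicat_real V x *\<^sub>R ?E x - indicat_real V (x - u) *\<^sub>R ?E x \<partial>lborel)"
    using int_E int_Eu cell_transform_u by (simp add: cell_transform_def transform_def)
  then have "2 * norm (cell_transform (t *\<^sub>R p) b)
      = norm (\<integral>x. indicat_real V x *\<^sub>R ?E x - indicat_real V (x - u) *\<^sub>R ?E x \<partial>lborel)"
    by (metis norm_mult norm_numeral)
  also have "\<dots> \<le> (\<integral>x. indicat_real V x *\<^sub>R ?e x + indicat_real V (x - u) *\<^sub>R ?e x
      - 2 * (indicat_real W x *\<^sub>R ?e x) \<partial>lborel)"
  proof (rule Bochner_Integration.integral_norm_bound_integral)
    fix x
    have "norm (indicat_real V x *\<^sub>R ?E x - indicat_real V (x - u) *\<^sub>R ?E x)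
        = \<bar>indicat_real V x - indicat_real V (x - u)\<bar> * ?e x"
      by (simp add: norm_char_exp flip: scaleR_diff_left)
    also have "\<dots> \<le> (indicat_real V x + indicat_real V (x - u) - 2 * indicat_real W x) * ?e x"
      using W_sub[of x] by (intro mult_right_mono) (auto simp: indicator_def)
    finally show "norm (indicat_real V x *\<^sub>R ?E x - indicat_real V (x - u) *\<^sub>R ?E x)
        \<le> indicat_real V x *\<^sub>R ?e x + indicat_real V (x - u) *\<^sub>R ?e x - 2 * (indicat_real W x *\<^sub>R ?e x)"
      by (simp add: algebra_simps)
  qed (intro Bochner_Integration.integrable_diff Bochner_Integration.integrable_add
      integrable_mult_right int_E int_Eu int_e int_eu int_W)+
  also have "\<dots> = 2 * S0 - 2 * (\<integral>x. indicat_real W x *\<^sub>R ?e x \<partial>lborel)"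
    using int_e int_eu int_W S0_u by (simp add: S0_def)
  finally have bound: "norm (cell_transform (t *\<^sub>R p) b) \<le> S0 - (\<integral>x. indicat_real W x *\<^sub>R ?e x \<partial>lborel)"
    by simp
  \<comment> \<open>The power of \<open>1 - \<theta>\<close> is the Jacobian of the contraction that
    maps \<open>V\<close> onto \<open>W\<close>.\<close>
  have "(1 - \<theta>) ^ DIM('a) * S0 \<le> (1 - \<theta>) ^ DIM('a) *
      (\<integral>x. indicat_real V x *\<^sub>R ?e (\<theta> *\<^sub>R (p /\<^sub>R 2) + (1 - \<theta>) *\<^sub>R x) \<partial>lborel)"
    unfolding S0_def
  proof (intro mult_left_mono integral_mono)
    show "integrable lborel (\<lambda>x. indicat_real V x *\<^sub>R ?e (\<theta> *\<^sub>R (p /\<^sub>R 2) + (1 - \<theta>) *\<^sub>R x))"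
      by (intro integrable_V_continuous continuous_intros)
    fix x
    show "indicat_real V x *\<^sub>R ?e x \<le> indicat_real V x *\<^sub>R ?e (\<theta> *\<^sub>R (p /\<^sub>R 2) + (1 - \<theta>) *\<^sub>R x)"
    proof (cases "x \<in> V")
      case True
      then have "p \<bullet> x \<le> p \<bullet> p / 2"
        using \<open>p \<in> L\<close> by (auto simp: mem_V_iff power2_norm_eq_inner inner_commute)
      then have "\<theta> * (p \<bullet> x) \<le> \<theta> * (p \<bullet> p / 2)"
        using \<theta> by (intro mult_left_mono) auto
      then have "p \<bullet> x \<le> p \<bullet> (\<theta> *\<^sub>R (p /\<^sub>R 2) + (1 - \<theta>) *\<^sub>R x)"
        by (simp add: inner_add_right algebra_simps)
      then have "t *\<^sub>R p \<bullet> x \<le> t *\<^sub>R p \<bullet> (\<theta> *\<^sub>R (p /\<^sub>R 2) + (1 - \<theta>) *\<^sub>R x)"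
        unfolding inner_scaleR_left using \<open>0 \<le> t\<close> by (rule mult_left_mono)
      then show ?thesis using True by simp
    qed simp
  qed (use \<theta> int_e in auto)
  also have "\<dots> = (\<integral>x. indicat_real W x *\<^sub>R ?e x \<partial>lborel)"
  proof -
    have "inj (\<lambda>x. \<theta> *\<^sub>R (p /\<^sub>R 2) + (1 - \<theta>) *\<^sub>R x)"
      using \<theta> by (auto simp: inj_on_def)
    then have "\<theta> *\<^sub>R (p /\<^sub>R 2) + (1 - \<theta>) *\<^sub>R x \<in> W \<longleftrightarrow> x \<in> V" for x
      unfolding W_def by (rule inj_image_mem_iff)
    then have "indicat_real W (\<theta> *\<^sub>R (p /\<^sub>R 2) + (1 - \<theta>) *\<^sub>R x) = indicat_real V x" for x
      unfolding indicator_def by simp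
    then show ?thesis
      using \<theta> by (subst integral_lborel_affine[OF _ int_W, of "1 - \<theta>" "\<theta> *\<^sub>R (p /\<^sub>R 2)"]) auto
  qed
  finally have "norm (cell_transform (t *\<^sub>R p) b) \<le> S0 * (1 - (1 - \<theta>) ^ DIM('a))"
    using bound by (simp add: algebra_simps)
  moreover have "cell_transform (t *\<^sub>R p) 0 = of_real S0"
    unfolding cell_transform_def transform_def S0_def integral_complex_of_real[symmetric]
    by (simp add: char_exp_real scaleR_conv_of_real)
  moreover from this have "S0 > 0"
    using cell_transform_real_pos[of "t *\<^sub>R p"] by auto
  ultimately show ?thesis
    by (simp add: transform_ratio_def field_simps)
qed

lemma refines_cell_transform_eq_0:
  assumes ref: "voronoi_refines L k l v" and l: "0 < l" "l < 1" and k: "k \<ge> 1"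
    and p: "p \<in> L" "p \<noteq> 0" and min: "\<And>q. q \<in> L \<Longrightarrow> q \<noteq> 0 \<Longrightarrow> norm p \<le> norm q"
    and \<eta>: "\<forall>s\<in>L. \<eta> \<bullet> s \<in> \<int>" and nonpar: "\<eta> \<noteq> (\<eta> \<bullet> p / (p \<bullet> p)) *\<^sub>R p"
  shows "cell_transform p ((2 * pi) *\<^sub>R \<eta>) = 0"
proof (rule ccontr)
  assume nz: "cell_transform p ((2 * pi) *\<^sub>R \<eta>) \<noteq> 0"
  \<comment> \<open>The component of \<open>\<eta>\<close> along the facet: the only one that a
    shift orthogonal to \<open>p\<close> can exploit.\<close>
  define \<delta> where "\<delta> = \<eta> - (\<eta> \<bullet> p / (p \<bullet> p)) *\<^sub>R p"
  have \<delta>: "\<delta> \<noteq> 0" "\<delta> \<bullet> p = 0"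
    using nonpar p by (auto simp: \<delta>_def inner_diff_left)
  have \<eta>\<delta>: "\<eta> \<bullet> \<delta> = \<delta> \<bullet> \<delta>"
  proof -
    have "\<eta> = \<delta> + (\<eta> \<bullet> p / (p \<bullet> p)) *\<^sub>R p" by (simp add: \<delta>_def)
    then show ?thesis
      using \<delta>(2) by (metis add.right_neutral inner_add_left inner_commute inner_scaleR_left mult_zero_right)
  qed
  define C where "C = 2 * norm \<delta> / ((\<delta> \<bullet> \<delta>) * norm p)"
  have C: "C > 0"
    using \<delta> p by (simp add: C_def)
  have bound: "transform_ratio p ((2 * pi) *\<^sub>R \<eta>) \<le> 1 - (1 - C * l ^ j) ^ DIM('a)" if "C * l ^ j < 1" for j
  proof -
    \<comment> \<open>Half a wavelength of the rescaled frequency, taken along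
      \<open>\<delta>\<close>. The constant \<open>C\<close> is such that the norm of
      \<open>u\<close> is exactly \<open>C * l ^ j * (norm p / 4)\<close>, so
      \<open>C * l ^ j\<close> serves as contraction factor in the decay bound.\<close>
    define u where "u = (l ^ j / (2 * (\<delta> \<bullet> \<delta>))) *\<^sub>R \<delta>"
    have "transform_ratio (inverse (l ^ j) *\<^sub>R p) ((2 * pi) *\<^sub>R (\<eta> /\<^sub>R l ^ j)) \<le> 1 - (1 - C * l ^ j) ^ DIM('a)"
    proof (rule transform_ratio_decay[OF p(1) min])
      show "u \<bullet> p = 0" using \<delta> by (simp add: u_def)
      show "(2 * pi) *\<^sub>R (\<eta> /\<^sub>R l ^ j) \<bullet> u = pi"
        using \<delta> l by (simp add: u_def \<eta>\<delta>)
      show "norm u \<le> C * l ^ j * (norm p / 4)"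
        using \<delta> l p by (simp add: u_def C_def field_simps)
    qed (use that C l in auto)
    then show ?thesis
      using refines_dual_iterate[OF ref l(1) k \<eta> nz, of j] by simp
  qed
  have tendsto: "(\<lambda>j. C * l ^ j) \<longlonglongrightarrow> 0"
    using l by (intro tendsto_mult_right_zero LIMSEQ_power_zero) auto
  have "(\<lambda>j. 1 - (1 - C * l ^ j) ^ DIM('a)) \<longlonglongrightarrow> 1 - (1 - 0) ^ DIM('a)"
    by (intro tendsto_intros tendsto)
  moreover have "eventually (\<lambda>j. C * l ^ j < 1) sequentially"
    using order_tendstoD(2)[OF tendsto, of 1] by simp
  then have "eventually (\<lambda>j. transform_ratio p ((2 * pi) *\<^sub>R \<eta>) \<le> 1 - (1 - C * l ^ j) ^ DIM('a)) sequentially"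
    by eventually_elim (rule bound)
  ultimately have "transform_ratio p ((2 * pi) *\<^sub>R \<eta>) \<le> 1 - (1 - 0) ^ DIM('a)"
    by (intro tendsto_lowerbound) auto
  moreover have "transform_ratio p ((2 * pi) *\<^sub>R \<eta>) > 0"
    using nz cell_transform_real_pos[of p] by (auto simp: transform_ratio_def)
  ultimately show False by simp
qed

end

section \<open>Concentration of trigonometric polynomials\<close>

text \<open>Otherwise the contribution near \<open>y\<close>, at least of order
  \<open>r1 ^ N\<close>, would be outweighed for every \<open>N\<close> by the contribution outside
  the ball, at most of order \<open>r ^ N\<close> with \<open>r < r1\<close>.\<close>

lemma integral_power_concentration:
  fixes h m :: "'a::euclidean_space \<Rightarrow> real"
  assumes S: "compact S" "ball y \<epsilon> \<subseteq> S" "\<epsilon> > 0"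
    and cont: "continuous_on UNIV h" "continuous_on UNIV m"
    and h: "c > 0" "\<And>x. x \<in> ball y \<epsilon> \<Longrightarrow> c \<le> h x"
    and m: "\<And>x. 0 \<le> m x" "m y = 1" "\<And>x. x \<in> S - ball y \<epsilon> \<Longrightarrow> m x \<le> r" "0 \<le> r" "r < 1"
  shows "\<exists>N. (\<integral>x. indicat_real S x * (h x * m x ^ N) \<partial>lborel) > 0"
proof (rule ccontr)
  assume contra: "\<nexists>N. (\<integral>x. indicat_real S x * (h x * m x ^ N) \<partial>lborel) > 0"
  obtain R where R: "S \<subseteq> cball 0 R"
    using compact_imp_bounded[OF S(1)] by (auto simp: bounded_iff subset_eq)
  have [measurable]: "S \<in> sets borel"
    using S(1) by (intro borel_closed compact_imp_closed)
  have supp: "integrable_supp R (indicat_real S)"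
    using R by (intro integrable_supp_indicator) auto
  \<comment> \<open>A value strictly between \<open>r\<close> and 1; \<open>m\<close> exceeds it
    near \<open>y\<close> because \<open>m y = 1\<close>.\<close>
  define r1 where "r1 = (1 + r) / 2"
  have r1: "r < r1" "r1 < 1" "0 < r1"
    using m by (auto simp: r1_def)
  have "compact (h ` S)"
    using S(1) cont(1) by (intro compact_continuous_image continuous_on_subset[OF cont(1)]) auto
  then obtain C where C: "\<And>x. x \<in> S \<Longrightarrow> \<bar>h x\<bar> \<le> C"
    by (metis bounded_iff compact_imp_bounded imageI real_norm_def)
  have "C \<ge> 0"
    using C[of y] S by (meson abs_ge_zero centre_in_ball order_trans subsetD)
  have "open {x. r1 < m x}"
    using cont(2) by (intro open_Collect_less continuous_intros)
  then obtain e where e: "e > 0" "ball y e \<subseteq> {x. r1 < m x}"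
    using r1 m(2) by (metis mem_Collect_eq openE)
  define U where "U = ball y (min e \<epsilon>)"
  have U: "U \<subseteq> S" "U \<subseteq> ball y \<epsilon>" "\<And>x. x \<in> U \<Longrightarrow> r1 \<le> m x"
    using e S(2) by (force simp: U_def)+
  have int_S: "integrable lborel (indicat_real S)" and int_U: "integrable lborel (indicat_real U)"
    using integrable_suppD(1)[OF supp] emeasure_lborel_ball_finite[of y "min e \<epsilon>"] by (auto simp: U_def)
  define \<mu> where "\<mu> = measure lborel U"
  have "\<mu> > 0"
    unfolding \<mu>_def U_def using e S(3) content_ball_pos[of "min e \<epsilon>" y] by simp
  have le: "c * r1 ^ N * \<mu> \<le> C * r ^ N * measure lborel S" for N
  proof -
    have "(\<integral>x. c * r1 ^ N * indicat_real U x - C * r ^ N * indicat_real S x \<partial>lborel)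
        \<le> (\<integral>x. indicat_real S x * (h x * m x ^ N) \<partial>lborel)"
    proof (rule integral_mono)
      show "integrable lborel (\<lambda>x. c * r1 ^ N * indicat_real U x - C * r ^ N * indicat_real S x)"
        using int_S int_U by simp
      have "continuous_on UNIV (\<lambda>x. h x * m x ^ N)"
        by (intro continuous_intros cont)
      from integrable_scaleR_continuous[OF supp this]
      show "integrable lborel (\<lambda>x. indicat_real S x * (h x * m x ^ N))" by simp
      fix x :: 'a
      have CrN: "0 \<le> C * r ^ N"
        using \<open>0 \<le> C\<close> m(4) by simp
      consider "x \<in> U" | "x \<in> ball y \<epsilon>" "x \<notin> U" | "x \<in> S - ball y \<epsilon>" | "x \<notin> S" "x \<notin> U"
        using U(1) by blast
      then show "c * r1 ^ N * indicat_real U x - C * r ^ N * indicat_real S x \<le> indicat_real S x * (h x * m x ^ N)"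
      proof cases
        case 1
        then have "c \<le> h x" "r1 \<le> m x"
          using U h(2) by blast+
        then have "c * r1 ^ N \<le> h x * m x ^ N"
          using h(1) r1(3) by (intro mult_mono power_mono) auto
        then show ?thesis using 1 U(1) CrN by (auto simp: indicator_def)
      next
        case 2
        then have "0 \<le> h x * m x ^ N"
          using h m(1) by (meson less_imp_le mult_nonneg_nonneg order_trans zero_le_power)
        then show ?thesis using 2 CrN by (auto simp: indicator_def)
      next
        case 3
        have "\<bar>h x * m x ^ N\<bar> \<le> C * r ^ N"
          unfolding abs_mult power_abs[symmetric]
          using 3 C[of x] m(1,3)[of x] \<open>0 \<le> C\<close> by (intro mult_mono) (auto intro: power_mono)
        then show ?thesis using 3 U(2) by (auto simp: indicator_def abs_le_iff)
      next
        case 4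
        then show ?thesis by simp
      qed
    qed
    also have "\<dots> \<le> 0"
      using contra by (simp add: not_less)
    finally show ?thesis
      using int_S int_U by (simp add: \<mu>_def)
  qed
  have "(\<lambda>N. C * measure lborel S * (r / r1) ^ N) \<longlonglongrightarrow> C * measure lborel S * 0"
    using r1 m(4) by (intro tendsto_intros LIMSEQ_power_zero) auto
  moreover have "c * \<mu> \<le> C * measure lborel S * (r / r1) ^ N" for N
    using le[of N] r1 by (simp add: power_divide field_simps)
  ultimately have "c * \<mu> \<le> 0"
    by (intro tendsto_lowerbound[where f = "\<lambda>N. C * measure lborel S * (r / r1) ^ N"]) auto
  then show False using h(1) \<open>\<mu> > 0\<close> by (simp add: mult_le_0_iff)
qed

context euclidean_lattice
begin

text \<open>An inductive predicate rather than explicit coefficients, so that a linear property has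
  to be computed only on characters.\<close>

inductive trig_poly :: "('a \<Rightarrow> complex) \<Rightarrow> bool" where
  trig_char: "(\<And>s. s \<in> L \<Longrightarrow> \<eta> \<bullet> s \<in> \<int>) \<Longrightarrow> trig_poly (char_exp 0 ((2 * pi) *\<^sub>R \<eta>))"
| trig_scale: "trig_poly K \<Longrightarrow> trig_poly (\<lambda>x. z * K x)"
| trig_add: "trig_poly K \<Longrightarrow> trig_poly K' \<Longrightarrow> trig_poly (\<lambda>x. K x + K' x)"

lemma trig_const: "trig_poly (\<lambda>_. z)"
  using trig_scale[OF trig_char[of 0], of z] by (simp add: char_exp_real)

lemma trig_sum: "(\<And>i. i \<in> I \<Longrightarrow> trig_poly (K i)) \<Longrightarrow> trig_poly (\<lambda>x. \<Sum>i\<in>I. K i x)"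
  by (induction I rule: infinite_finite_induct) (auto intro: trig_const trig_add)

lemma trig_mult: "trig_poly K \<Longrightarrow> trig_poly K' \<Longrightarrow> trig_poly (\<lambda>x. K x * K' x)"
proof (induction rule: trig_poly.induct)
  case (trig_char \<eta>)
  from trig_char(2) show ?case
  proof (induction rule: trig_poly.induct)
    case (trig_char \<eta>')
    have "(\<eta> + \<eta>') \<bullet> s \<in> \<int>" if "s \<in> L" for s
      using that trig_char \<open>\<And>s. s \<in> L \<Longrightarrow> \<eta> \<bullet> s \<in> \<int>\<close> by (simp add: inner_add_left)
    from trig_poly.trig_char[OF this]
    have "trig_poly (char_exp 0 ((2 * pi) *\<^sub>R (\<eta> + \<eta>')))" .
    moreover have "char_exp 0 ((2 * pi) *\<^sub>R (\<eta> + \<eta>'))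
        = (\<lambda>x. char_exp 0 ((2 * pi) *\<^sub>R \<eta>) x * char_exp 0 ((2 * pi) *\<^sub>R \<eta>') x)"
      by (simp add: fun_eq_iff char_exp_def inner_add_left ring_distribs flip: exp_add)
         (simp add: complex_eq_iff Re_exp Im_exp)
    ultimately show ?case by simp
  next
    case (trig_scale K z)
    from trig_poly.trig_scale[OF trig_scale.IH, of z] show ?case by (simp add: mult_ac)
  next
    case (trig_add K K')
    from trig_poly.trig_add[OF trig_add.IH] show ?case by (simp add: ring_distribs)
  qed
next
  case (trig_scale K z)
  from trig_poly.trig_scale[OF trig_scale.IH[OF trig_scale.prems], of z] show ?case by (simp add: mult_ac)
next
  case (trig_add K K')
  from trig_poly.trig_add[OF trig_add.IH(1)[OF trig_add.prems] trig_add.IH(2)[OF trig_add.prems]]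
  show ?case by (simp add: ring_distribs)
qed

lemma trig_power: "trig_poly K \<Longrightarrow> trig_poly (\<lambda>x. K x ^ N)"
  by (induction N) (auto intro: trig_const trig_mult)

lemma trig_cos:
  assumes "\<And>s. s \<in> L \<Longrightarrow> \<eta> \<bullet> s \<in> \<int>"
  shows "trig_poly (\<lambda>x. of_real (cos (2 * pi * (\<eta> \<bullet> x))))"
proof -
  have "(- \<eta>) \<bullet> s \<in> \<int>" if "s \<in> L" for s
    using assms[OF that] by simp
  from trig_scale[OF trig_add[OF trig_char[OF assms] trig_char[OF this]], of "1 / 2"]
  have "trig_poly (\<lambda>x. 1 / 2 * (char_exp 0 ((2 * pi) *\<^sub>R \<eta>) x + char_exp 0 ((2 * pi) *\<^sub>R - \<eta>) x))" .
  moreover have "1 / 2 * (char_exp 0 ((2 * pi) *\<^sub>R \<eta>) x + char_exp 0 ((2 * pi) *\<^sub>R - \<eta>) x)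
      = of_real (cos (2 * pi * (\<eta> \<bullet> x)))" for x
    by (simp add: char_exp_def complex_eq_iff Re_exp Im_exp)
  ultimately show ?thesis by simp
qed

lemma trig_continuous: "trig_poly K \<Longrightarrow> continuous_on UNIV K"
  by (induction rule: trig_poly.induct) (intro continuous_intros, assumption?)+

text \<open>A frequency \<open>\<eta>\<close> parallel to \<open>p\<close> does not distinguish \<open>y\<close> and \<open>- y\<close>, since \<open>2 y\<close> differs from a
  lattice vector by a vector orthogonal to \<open>p\<close>. All other frequencies are annihilated by
  \<open>refines_cell_transform_eq_0\<close>.\<close>

lemma refines_trig_integral_eq_0:
  assumes ref: "voronoi_refines L k l v" and l: "0 < l" "l < 1" and k: "k \<ge> 1"
    and p: "p \<in> L" "p \<noteq> 0" and min: "\<And>q. q \<in> L \<Longrightarrow> q \<noteq> 0 \<Longrightarrow> norm p \<le> norm q"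
    and y: "q \<in> L" "(q - 2 *\<^sub>R y) \<bullet> p = 0"
    and K: "trig_poly K"
  shows "(\<integral>x. indicat_real V x *\<^sub>R (exp (p \<bullet> x) *\<^sub>R (K (x - y) - K (x + y))) \<partial>lborel) = 0"
  using K
proof (induction rule: trig_poly.induct)
  case (trig_char \<eta>)
  let ?b = "(2 * pi) *\<^sub>R \<eta>"
  let ?K = "char_exp 0 ?b"
  have split: "exp (p \<bullet> x) *\<^sub>R (?K (x - y) - ?K (x + y)) = char_exp p ?b x * (?K (- y) - ?K y)" for x
  proof -
    have "?K (x - y) = ?K x * ?K (- y)" "?K (x + y) = ?K x * ?K y"
      using char_exp_add[of 0 ?b x "- y"] char_exp_add[of 0 ?b x y] by simp_all
    moreover have "exp (p \<bullet> x) *\<^sub>R ?K x = char_exp p ?b x"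
      by (simp add: char_exp_def complex_eq_iff Re_exp Im_exp)
    ultimately show ?thesis
      by (simp only: mult_scaleR_left [symmetric] right_diff_distrib [symmetric])
  qed
  have "(\<integral>x. indicat_real V x *\<^sub>R (exp (p \<bullet> x) *\<^sub>R (?K (x - y) - ?K (x + y))) \<partial>lborel)
      = cell_transform p ?b * (?K (- y) - ?K y)"
    by (simp only: split cell_transform_def transform_def mult_scaleR_left [symmetric] integral_mult_left_zero)
  also have "\<dots> = 0"
  proof (cases "\<eta> = (\<eta> \<bullet> p / (p \<bullet> p)) *\<^sub>R p")
    case True
    then obtain c where "\<eta> = c *\<^sub>R p" by blast
    then have "\<eta> \<bullet> (q - 2 *\<^sub>R y) = 0"
      using y(2) by (simp add: inner_commute)
    then have "2 * (\<eta> \<bullet> y) \<in> \<int>"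
      using trig_char[OF y(1)] by (simp add: inner_diff_right)
    then obtain n where n: "2 * (\<eta> \<bullet> y) = of_int n"
      by (auto elim: Ints_cases)
    then have "?b \<bullet> (2 *\<^sub>R y) = 2 * pi * of_int n" by simp
    then have "?K (2 *\<^sub>R y) = 1"
      by (simp only: char_exp_def inner_zero_left)
         (simp add: complex_eq_iff Re_exp Im_exp cos_int_2pin sin_int_2pin)
    then have "?K (- y) = ?K y"
      using char_exp_add[of 0 ?b "- y" "2 *\<^sub>R y"] by (simp add: scaleR_2)
    then show ?thesis by simp
  next
    case False
    have "\<forall>s\<in>L. \<eta> \<bullet> s \<in> \<int>" using trig_char by blast
    from refines_cell_transform_eq_0[OF ref l k p min this False] show ?thesis by simp
  qed
  finally show ?case .
next
  case (trig_scale K z)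
  have "(\<integral>x. indicat_real V x *\<^sub>R (exp (p \<bullet> x) *\<^sub>R (z * K (x - y) - z * K (x + y))) \<partial>lborel)
      = (\<integral>x. z * (indicat_real V x *\<^sub>R (exp (p \<bullet> x) *\<^sub>R (K (x - y) - K (x + y)))) \<partial>lborel)"
    by (simp add: algebra_simps)
  also have "\<dots> = 0"
    by (simp only: integral_mult_right_zero trig_scale.IH mult_zero_right)
  finally show ?case .
next
  case (trig_add K K')
  have int: "integrable lborel (\<lambda>x. indicat_real V x *\<^sub>R (exp (p \<bullet> x) *\<^sub>R (K (x - y) - K (x + y))))"
    if "trig_poly K" for K
    by (intro integrable_V_continuous continuous_intros
        continuous_on_compose2[OF trig_continuous[OF that]]) auto
  have "(\<integral>x. indicat_real V x *\<^sub>R (exp (p \<bullet> x) *\<^sub>R (K (x - y) + K' (x - y) - (K (x + y) + K' (x + y)))) \<partial>lborel)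
      = (\<integral>x. indicat_real V x *\<^sub>R (exp (p \<bullet> x) *\<^sub>R (K (x - y) - K (x + y)))
            + indicat_real V x *\<^sub>R (exp (p \<bullet> x) *\<^sub>R (K' (x - y) - K' (x + y))) \<partial>lborel)"
    by (simp add: algebra_simps)
  also have "\<dots> = 0"
    using trig_add.IH by (simp only: Bochner_Integration.integral_add[OF int int, OF trig_add.hyps]) simp
  finally show ?case .
qed

text \<open>Each point off the lattice is detected by some dual frequency, and by compactness
  finitely many detect all points of \<open>S\<close>. The average of \<open>(1 + cos) / 2\<close>
  over these frequencies is the peak; its powers act as periodic bumps at the lattice
  points.\<close>

lemma trig_peak:
  assumes dual: "\<And>x. (\<And>\<eta>. (\<And>s. s \<in> L \<Longrightarrow> \<eta> \<bullet> s \<in> \<int>) \<Longrightarrow> \<eta> \<bullet> x \<in> \<int>) \<Longrightarrow> x \<in> L"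
    and S: "compact S" "\<And>x. x \<in> S \<Longrightarrow> x \<notin> L"
  obtains Q r where "trig_poly (\<lambda>x. of_real (Q x))" "continuous_on UNIV Q" "\<And>x. 0 \<le> Q x" "Q 0 = 1"
    "\<And>x. Q (- x) = Q x" "\<And>x. x \<in> S \<Longrightarrow> Q x \<le> r" "0 \<le> r" "r < 1"
proof -
  define D where "D = {\<eta>. \<forall>s\<in>L. \<eta> \<bullet> s \<in> \<int>}"
  define O' where "O' \<eta> = {x. cos (2 * pi * (\<eta> \<bullet> x)) < 1}" for \<eta> :: 'a
  have "S \<subseteq> (\<Union>\<eta>\<in>D. O' \<eta>)"
  proof
    fix x assume "x \<in> S"
    then obtain \<eta> where \<eta>: "\<eta> \<in> D" "\<eta> \<bullet> x \<notin> \<int>"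
      using dual S(2) unfolding D_def by blast
    have "cos (2 * pi * (\<eta> \<bullet> x)) \<noteq> 1"
    proof
      assume "cos (2 * pi * (\<eta> \<bullet> x)) = 1"
      then obtain n :: int where "2 * pi * (\<eta> \<bullet> x) = of_int n * 2 * pi"
        by (auto simp: cos_one_2pi_int)
      then have "\<eta> \<bullet> x = of_int n" by simp
      then show False using \<eta> by simp
    qed
    then show "x \<in> (\<Union>\<eta>\<in>D. O' \<eta>)"
      using \<eta>(1) cos_le_one[of "2 * pi * (\<eta> \<bullet> x)"] by (auto simp: O'_def less_le)
  qed
  moreover have "open (O' \<eta>)" for \<eta>
    unfolding O'_def by (intro open_Collect_less continuous_intros)
  ultimately obtain B0 where B0: "B0 \<subseteq> D" "finite B0" "S \<subseteq> (\<Union>\<eta>\<in>B0. O' \<eta>)"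
    using compactE_image[OF S(1), of D O'] by metis
  \<comment> \<open>The frequency 0 keeps the average well defined when \<open>S\<close> is empty;
    it only adds the constant 1.\<close>
  define B where "B = insert 0 B0"
  have B: "B \<subseteq> D" "finite B" "S \<subseteq> (\<Union>\<eta>\<in>B. O' \<eta>)" "card B > 0"
    using B0 by (auto simp: B_def D_def card_gt_0_iff)
  define Q where "Q x = (\<Sum>\<eta>\<in>B. 1 + cos (2 * pi * (\<eta> \<bullet> x))) / (2 * real (card B))" for x
  have contQ: "continuous_on A Q" for A
    unfolding Q_def using B(4) by (intro continuous_intros) auto
  have "trig_poly (\<lambda>x. of_real (1 / (2 * real (card B))) * (\<Sum>\<eta>\<in>B. 1 + of_real (cos (2 * pi * (\<eta> \<bullet> x)))))"
    using B(1) by (intro trig_scale trig_sum trig_add trig_const trig_cos) (auto simp: D_def)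
  then have trig: "trig_poly (\<lambda>x. of_real (Q x))"
    by (simp add: Q_def)
  have nonneg: "0 \<le> Q x" for x
  proof -
    have "0 \<le> 1 + cos (2 * pi * (\<eta> \<bullet> x))" for \<eta>
      using cos_ge_minus_one[of "2 * pi * (\<eta> \<bullet> x)"] by linarith
    then show ?thesis
      unfolding Q_def by (intro divide_nonneg_nonneg sum_nonneg) auto
  qed
  have lt1: "Q x < 1" if "x \<in> S" for x
  proof -
    have "(\<Sum>\<eta>\<in>B. 1 + cos (2 * pi * (\<eta> \<bullet> x))) < (\<Sum>\<eta>\<in>B. 2)"
      using B(2,3) that by (intro sum_strict_mono_ex1) (auto simp: O'_def)
    then show ?thesis using B(4) by (simp add: Q_def)
  qed
  obtain r where r: "\<And>x. x \<in> S \<Longrightarrow> Q x \<le> r" "0 \<le> r" "r < 1"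
  proof (cases "S = {}")
    case True
    then show ?thesis using that[of 0] by simp
  next
    case False
    then obtain x0 where "x0 \<in> S" "\<And>x. x \<in> S \<Longrightarrow> Q x \<le> Q x0"
      using continuous_attains_sup[OF S(1) False contQ] by blast
    then show ?thesis using that[of "Q x0"] lt1 nonneg by blast
  qed
  show ?thesis
    by (rule that[OF trig contQ nonneg _ _ r]) (use B(4) in \<open>auto simp: Q_def\<close>)
qed

text \<open>The point \<open>y\<close> is half the projection of a lattice vector onto
  \<open>p\<close>, so no dual frequency parallel to \<open>p\<close> separates it from
  \<open>- y\<close>. Both points lie inside the cell, where \<open>exp (p \<bullet> x)\<close>
  takes different values at them. Yet bumps centred at the two points must give equal weighted
  integrals, which sharp bumps refute.\<close>

theorem not_voronoi_refines:
  assumes dual: "\<And>x. (\<And>\<eta>. (\<And>s. s \<in> L \<Longrightarrow> \<eta> \<bullet> s \<in> \<int>) \<Longrightarrow> \<eta> \<bullet> x \<in> \<int>) \<Longrightarrow> x \<in> L"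
    and p: "p \<in> L" "p \<noteq> 0" and min: "\<And>q. q \<in> L \<Longrightarrow> q \<noteq> 0 \<Longrightarrow> norm p \<le> norm q"
    and q: "q \<in> L" "p \<bullet> q / (p \<bullet> p) \<notin> \<int>"
    and l: "0 < l" "l < 1" and k: "k \<ge> 1"
  shows "\<not> voronoi_refines L k l v"
proof
  assume ref: "voronoi_refines L k l v"
  \<comment> \<open>The fractional part reduces the projection modulo \<open>p\<close>:
    \<open>\<alpha> > 0\<close> separates \<open>y\<close> from \<open>- y\<close>, and
    \<open>\<alpha> < 1\<close> makes \<open>y\<close> shorter than half a shortest vector, hence
    interior to the cell.\<close>
  define \<alpha> where "\<alpha> = frac (p \<bullet> q / (p \<bullet> p))"
  have \<alpha>: "0 < \<alpha>" "\<alpha> < 1"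
    using q(2) by (auto simp: \<alpha>_def frac_gt_0_iff frac_lt_1)
  define y where "y = (\<alpha> / 2) *\<^sub>R p"
  define q' where "q' = q - of_int \<lfloor>p \<bullet> q / (p \<bullet> p)\<rfloor> *\<^sub>R p"
  have "2 *\<^sub>R y = \<alpha> *\<^sub>R p"
    by (simp add: y_def)
  then have "q' - 2 *\<^sub>R y = q - (p \<bullet> q / (p \<bullet> p)) *\<^sub>R p"
    by (simp add: q'_def \<alpha>_def frac_def scaleR_diff_left)
  then have q': "q' \<in> L" "(q' - 2 *\<^sub>R y) \<bullet> p = 0"
  proof -
    assume eq: "q' - 2 *\<^sub>R y = q - (p \<bullet> q / (p \<bullet> p)) *\<^sub>R p"
    show "q' \<in> L"
      unfolding q'_def by (intro diff_mem of_int_scaleR_mem q p)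
    show "(q' - 2 *\<^sub>R y) \<bullet> p = 0"
      unfolding eq inner_diff_left using p(2) by (simp add: inner_commute)
  qed
  have "norm y < norm p / 2"
    using \<alpha> p by (simp add: y_def)
  moreover have "p \<bullet> y > 0"
    using \<alpha> p by (simp add: y_def)
  ultimately have "y \<in> {x. norm x < norm p / 2} \<inter> {x. p \<bullet> x > p \<bullet> y / 2}" (is "_ \<in> ?O")
    by simp
  moreover have "open ?O"
    by (intro open_Int open_Collect_less continuous_intros)
  ultimately obtain \<epsilon> where \<epsilon>: "\<epsilon> > 0" "ball y \<epsilon> \<subseteq> ?O"
    unfolding open_contains_ball by blast
  have small: "x \<bullet> s < (norm s)\<^sup>2 / 2" if "norm x < norm p / 2" "s \<in> L" "s \<noteq> 0" for x s
  proof -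
    have "x \<bullet> s \<le> norm x * norm s" by (rule norm_cauchy_schwarz)
    also have "\<dots> < norm s / 2 * norm s"
      using that min[of s] by (intro mult_strict_right_mono) auto
    finally show ?thesis by (simp add: power2_eq_square)
  qed
  have small_V: "x \<in> V" if "norm x < norm p / 2" for x
    unfolding mem_V_iff using small[OF that] by (metis inner_zero_right less_eq_real_def norm_zero zero_le_divide_iff zero_le_power2 zero_le_numeral)
  have ball_V: "ball y \<epsilon> \<subseteq> V"
    using \<epsilon>(2) small_V by blast
  \<comment> \<open>The places where the peak centred at \<open>y\<close> has to be small. None is a
    lattice vector: for \<open>x = z - y\<close> in \<open>L\<close>, the cell inequalities bound
    \<open>z \<bullet> x\<close> by half of \<open>x \<bullet> x\<close> and
    \<open>- y \<bullet> x\<close> strictly by the other half, but the two add up to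
    \<open>x \<bullet> x\<close>.\<close>
  define S where "S = (\<lambda>x. x - y) ` (V - ball y \<epsilon>)"
  have "compact S"
    unfolding S_def by (intro compact_continuous_image continuous_intros compact_diff compact_V) auto
  moreover have "x \<notin> L" if "x \<in> S" for x
  proof
    assume "x \<in> L"
    from that obtain z where z: "z \<in> V" "z \<notin> ball y \<epsilon>" "x = z - y"
      by (auto simp: S_def)
    then have "x \<noteq> 0" using \<epsilon>(1) by auto
    have "z \<bullet> x \<le> (norm x)\<^sup>2 / 2"
      using z(1) \<open>x \<in> L\<close> by (simp add: mem_V_iff)
    moreover have "- y \<bullet> x < (norm x)\<^sup>2 / 2"
      using small[of "- y" x] \<open>norm y < norm p / 2\<close> \<open>x \<in> L\<close> \<open>x \<noteq> 0\<close> by simp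
    moreover have "z \<bullet> x + - y \<bullet> x = (norm x)\<^sup>2"
      by (simp add: z(3) power2_norm_eq_inner inner_diff_left inner_diff_right)
    ultimately show False by linarith
  qed
  ultimately obtain Q r where Q: "trig_poly (\<lambda>x. of_real (Q x))" "continuous_on UNIV Q" "\<And>x. 0 \<le> Q x" "Q 0 = 1"
    "\<And>x. Q (- x) = Q x" "\<And>x. x \<in> S \<Longrightarrow> Q x \<le> r" "0 \<le> r" "r < 1"
    using trig_peak[OF dual] by blast
  \<comment> \<open>Reflection in 0 preserves \<open>V\<close> and \<open>Q\<close>, carries the
    bump at \<open>- y\<close> to the one at \<open>y\<close>, and turns
    \<open>exp (p \<bullet> x)\<close> into \<open>exp (- (p \<bullet> x))\<close>. Hence a single
    bump remains, weighted by \<open>h\<close>.\<close>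
  define h where "h x = exp (p \<bullet> x) - exp (- (p \<bullet> x))" for x
  have contQ': "continuous_on UNIV (\<lambda>x. Q (x - y))" "continuous_on UNIV (\<lambda>x. Q (x + y))"
    by (intro continuous_on_compose2[OF Q(2)] continuous_intros; simp)+
  have "(\<integral>x. indicat_real V x * (h x * Q (x - y) ^ N) \<partial>lborel) = 0" for N
  proof -
    have int1: "integrable lborel (\<lambda>x. indicat_real V x *\<^sub>R (exp (p \<bullet> x) * Q (x - y) ^ N))"
      and int2: "integrable lborel (\<lambda>x. indicat_real V x *\<^sub>R (exp (p \<bullet> x) * Q (x + y) ^ N))"
      by (intro integrable_V_continuous continuous_intros contQ')+
    have reflect: "indicat_real V (- x) *\<^sub>R (exp (p \<bullet> (- x)) * Q (- x + y) ^ N)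
        = indicat_real V x *\<^sub>R (exp (- (p \<bullet> x)) * Q (x - y) ^ N)" for x
      using Q(5)[of "x - y"] by (simp add: indicator_def)
    have int3: "integrable lborel (\<lambda>x. indicat_real V x *\<^sub>R (exp (- (p \<bullet> x)) * Q (x - y) ^ N))"
      and eq: "(\<integral>x. indicat_real V x *\<^sub>R (exp (p \<bullet> x) * Q (x + y) ^ N) \<partial>lborel)
        = (\<integral>x. indicat_real V x *\<^sub>R (exp (- (p \<bullet> x)) * Q (x - y) ^ N) \<partial>lborel)"
      using integrable_lborel_minus[OF int2] integral_lborel_minus[OF int2] unfolding reflect by simp_all
    have "complex_of_real (\<integral>x. indicat_real V x *\<^sub>R (exp (p \<bullet> x) * (Q (x - y) ^ N - Q (x + y) ^ N)) \<partial>lborel) = 0"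
      using refines_trig_integral_eq_0[OF ref l k p min q' trig_power[OF Q(1)], of N]
      by (simp add: scaleR_conv_of_real flip: integral_complex_of_real of_real_power of_real_diff of_real_mult)
    then have "(\<integral>x. indicat_real V x *\<^sub>R (exp (p \<bullet> x) * Q (x - y) ^ N)
        - indicat_real V x *\<^sub>R (exp (p \<bullet> x) * Q (x + y) ^ N) \<partial>lborel) = 0"
      by (simp add: right_diff_distrib)
    then have "(\<integral>x. indicat_real V x *\<^sub>R (exp (p \<bullet> x) * Q (x - y) ^ N) \<partial>lborel)
        - (\<integral>x. indicat_real V x *\<^sub>R (exp (- (p \<bullet> x)) * Q (x - y) ^ N) \<partial>lborel) = 0"
      by (simp only: Bochner_Integration.integral_diff[OF int1 int2] eq)
    then have "(\<integral>x. indicat_real V x *\<^sub>R (exp (p \<bullet> x) * Q (x - y) ^ N)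
        - indicat_real V x *\<^sub>R (exp (- (p \<bullet> x)) * Q (x - y) ^ N) \<partial>lborel) = 0"
      by (simp only: Bochner_Integration.integral_diff[OF int1 int3])
    then show ?thesis
      by (simp add: h_def algebra_simps)
  qed
  moreover have "\<exists>N. (\<integral>x. indicat_real V x * (h x * Q (x - y) ^ N) \<partial>lborel) > 0"
  proof (rule integral_power_concentration[OF compact_V ball_V \<epsilon>(1)])
    show "continuous_on UNIV h" unfolding h_def by (intro continuous_intros)
    \<comment> \<open>The ball was chosen inside the half-space where \<open>p \<bullet> x\<close>
      exceeds \<open>p \<bullet> y / 2\<close>; the subtracted exponential is at most 1
      there.\<close>
    show "0 < exp (p \<bullet> y / 2) - 1" using \<open>p \<bullet> y > 0\<close> by simp
    show "exp (p \<bullet> y / 2) - 1 \<le> h x" if "x \<in> ball y \<epsilon>" for x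
    proof -
      have "p \<bullet> y / 2 < p \<bullet> x" using that \<epsilon>(2) by auto
      then have "exp (p \<bullet> y / 2) \<le> exp (p \<bullet> x)" "exp (- (p \<bullet> x)) \<le> 1"
        using \<open>p \<bullet> y > 0\<close> by auto
      then show ?thesis unfolding h_def by linarith
    qed
    show "Q (x - y) \<le> r" if "x \<in> V - ball y \<epsilon>" for x
      using that by (intro Q(6)) (auto simp: S_def)
  qed (use contQ' Q in auto)
  ultimately show False by auto
qed

end

section \<open>Lattices without an orthogonal splitting\<close>

context euclidean_lattice
begin

lemma shortest_vector_exists: "\<exists>p\<in>L. p \<noteq> 0 \<and> (\<forall>q\<in>L. q \<noteq> 0 \<longrightarrow> norm p \<le> norm q)"
proof -
  have "\<exists>q\<in>L. q \<noteq> 0"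
  proof (rule ccontr)
    assume "\<not> ?thesis"
    then have "span L \<subseteq> {0}"
      by (intro span_minimal) auto
    moreover obtain b :: 'a where "b \<in> Basis" using nonempty_Basis by blast
    ultimately show False using spanning nonzero_Basis by blast
  qed
  then obtain q0 where q0: "q0 \<in> L" "q0 \<noteq> 0" by blast
  define F where "F = (L \<inter> cball 0 (norm q0)) - {0}"
  have F: "finite F" "q0 \<in> F"
    using q0 finite_Int_cball by (auto simp: F_def)
  then obtain p where p: "p \<in> F" "\<And>q. q \<in> F \<Longrightarrow> norm p \<le> norm q"
    using arg_min_if_finite[of F norm] by (metis emptyE linorder_not_less)
  have "norm p \<le> norm q" if "q \<in> L" "q \<noteq> 0" for q
    using p(2)[of q] p(2)[OF F(2)] that by (cases "norm q \<le> norm q0") (auto simp: F_def)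
  then show ?thesis using p(1) by (auto simp: F_def)
qed

end

text \<open>The hypotheses of \<open>not_voronoi_refines\<close> relative to the span, since the
  ambient space may be larger. Asking for \<open>unsplit\<close> at every nonzero vector avoids
  identifying the shortest vectors of each lattice.\<close>

locale unsplit_lattice =
  fixes M :: "'b::euclidean_space set"
  assumes zero_mem [simp]: "0 \<in> M"
    and diff_mem: "x \<in> M \<Longrightarrow> y \<in> M \<Longrightarrow> x - y \<in> M"
    and discrete: "\<exists>m>0. \<forall>x\<in>M. x \<noteq> 0 \<longrightarrow> m \<le> norm x"
    and bidual: "x \<in> span M \<Longrightarrow> (\<And>\<eta>. (\<And>y. y \<in> M \<Longrightarrow> \<eta> \<bullet> y \<in> \<int>) \<Longrightarrow> \<eta> \<bullet> x \<in> \<int>) \<Longrightarrow> x \<in> M"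
    and unsplit: "p \<in> M \<Longrightarrow> p \<noteq> 0 \<Longrightarrow> \<exists>q\<in>M. p \<bullet> q / (p \<bullet> p) \<notin> \<int>"

lemma project_functional:
  fixes \<eta> :: "'b::euclidean_space"
  shows "\<exists>\<eta>'\<in>span S. \<forall>x\<in>span S. \<eta>' \<bullet> x = \<eta> \<bullet> x"
proof -
  obtain y z where "y \<in> span S" "\<And>w. w \<in> span S \<Longrightarrow> orthogonal z w" "\<eta> = y + z"
    using orthogonal_subspace_decomp_exists[of S \<eta>] by blast
  then show ?thesis
    by (auto simp: inner_add_left orthogonal_def)
qed

lemma (in unsplit_lattice) similar_not_refines:
  fixes L :: "'a::euclidean_space set"
  assumes sim: "similar_to L M" and dim: "dim M = DIM('a)"
    and "0 < l" "l < 1" "k \<ge> 1"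
  shows "\<not> voronoi_refines L k l v"
proof -
  obtain f c where f: "linear f" "c > 0" "\<And>x. x \<in> span M \<Longrightarrow> norm (f x) = c * norm x" "L = f ` M"
    using sim unfolding similar_to_def by blast
  interpret f: linear f by (rule f(1))
  have inner_f: "f x \<bullet> f y = c\<^sup>2 * (x \<bullet> y)" if "x \<in> span M" "y \<in> span M" for x y
  proof -
    have "norm (f (x + y)) = c * norm (x + y)" "norm (f x) = c * norm x" "norm (f y) = c * norm y"
      using that f(3) span_add by blast+
    then show ?thesis
      unfolding dot_norm f.add[symmetric] by (simp add: power_mult_distrib field_simps)
  qed
  have inj: "inj_on f (span M)"
    unfolding linear_injective_on_subspace_0[OF f(1) subspace_span] using f(2,3) by fastforce
  have "dim L = DIM('a)"
    unfolding f(4) using dim_image_eq[OF f(1) inj] dim by simp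
  then have spanL: "span L = UNIV"
    by (simp add: dim_eq_full)
  have f_span: "f ` span M = UNIV"
    using spanL unfolding f(4) by (simp only: linear_span_image[OF f(1)])
  interpret euclidean_lattice L
  proof
    show "0 \<in> L" unfolding f(4) by (rule image_eqI[of _ _ 0]) auto
    show "x - y \<in> L" if "x \<in> L" "y \<in> L" for x y
      using that diff_mem unfolding f(4) by (auto simp flip: f.diff)
    obtain m where m: "m > 0" "\<And>x. x \<in> M \<Longrightarrow> x \<noteq> 0 \<Longrightarrow> m \<le> norm x"
      using discrete by blast
    show "\<exists>m>0. \<forall>x\<in>L. x \<noteq> 0 \<longrightarrow> m \<le> norm x"
    proof (intro exI[of _ "c * m"] conjI ballI impI)
      fix x assume "x \<in> L" "x \<noteq> 0"
      then obtain z where z: "z \<in> M" "x = f z" "z \<noteq> 0"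
        unfolding f(4) by (metis f.zero imageE)
      then show "c * m \<le> norm x"
        using m(2)[of z] f(2,3) span_base[of z M] by simp
    qed (use f m in simp)
  qed (rule spanL)
  have dualL: "x \<in> L" if H: "\<And>\<eta>. (\<And>s. s \<in> L \<Longrightarrow> \<eta> \<bullet> s \<in> \<int>) \<Longrightarrow> \<eta> \<bullet> x \<in> \<int>" for x
  proof -
    obtain z where z: "z \<in> span M" "x = f z"
      using f_span by (metis UNIV_I imageE)
    have "z \<in> M"
    proof (rule bidual[OF z(1)])
      fix \<eta>0 :: 'b
      assume \<eta>0: "\<And>y. y \<in> M \<Longrightarrow> \<eta>0 \<bullet> y \<in> \<int>"
      obtain \<eta>' where \<eta>': "\<eta>' \<in> span M" "\<And>w. w \<in> span M \<Longrightarrow> \<eta>' \<bullet> w = \<eta>0 \<bullet> w"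
        using project_functional[of M \<eta>0] by blast
      \<comment> \<open>A functional is transported through its representative in the span, the only
        place where \<open>f\<close> is known to be a similarity; \<open>c\<^sup>2\<close> undoes
        the scaling of inner products.\<close>
      have eq: "(f \<eta>' /\<^sub>R c\<^sup>2) \<bullet> f w = \<eta>0 \<bullet> w" if "w \<in> span M" for w
        using inner_f[OF \<eta>'(1) that] \<eta>'(2)[OF that] f(2) by simp
      have "(f \<eta>' /\<^sub>R c\<^sup>2) \<bullet> x \<in> \<int>"
      proof (rule H)
        fix s assume "s \<in> L"
        then obtain w where "w \<in> M" "s = f w" unfolding f(4) by blast
        then show "(f \<eta>' /\<^sub>R c\<^sup>2) \<bullet> s \<in> \<int>"
          using eq[OF span_base, of w] \<eta>0 by simp
      qed
      then show "\<eta>0 \<bullet> z \<in> \<int>"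
        using eq[OF z(1)] z(2) by simp
    qed
    then show ?thesis unfolding f(4) z(2) by blast
  qed
  obtain p where p: "p \<in> L" "p \<noteq> 0" and min: "\<And>q. q \<in> L \<Longrightarrow> q \<noteq> 0 \<Longrightarrow> norm p \<le> norm q"
    using shortest_vector_exists by blast
  obtain p0 where p0: "p0 \<in> M" "p = f p0" "p0 \<noteq> 0"
    using p unfolding f(4) by (metis f.zero imageE)
  then obtain q0 where q0: "q0 \<in> M" "p0 \<bullet> q0 / (p0 \<bullet> p0) \<notin> \<int>"
    using unsplit by blast
  have "p \<bullet> f q0 / (p \<bullet> p) \<notin> \<int>"
    using q0 p0 f(2) by (simp add: inner_f span_base)
  moreover have "f q0 \<in> L" unfolding f(4) using q0 by blast
  ultimately show ?thesis
    using not_voronoi_refines[OF dualL p min] assms(3-) by blast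
qed

text \<open>In \<open>irreducible\<close>, no line of the span may have every norm-2 vector of
  \<open>N\<close> either on it or orthogonal to it. Letting \<open>\<alpha>\<close> range over the
  span, not just over \<open>N\<close>, makes this applicable to dual vectors.\<close>

locale root_lattice =
  fixes N :: "'b::euclidean_space set"
  assumes zero_mem [simp]: "0 \<in> N"
    and diff_mem: "x \<in> N \<Longrightarrow> y \<in> N \<Longrightarrow> x - y \<in> N"
    and norm_ge: "x \<in> N \<Longrightarrow> x \<noteq> 0 \<Longrightarrow> 2 \<le> x \<bullet> x"
    and bidual: "x \<in> span N \<Longrightarrow> (\<And>\<eta>. (\<And>y. y \<in> N \<Longrightarrow> \<eta> \<bullet> y \<in> \<int>) \<Longrightarrow> \<eta> \<bullet> x \<in> \<int>) \<Longrightarrow> x \<in> N"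
    and irreducible: "\<alpha> \<in> span N \<Longrightarrow> \<alpha> \<noteq> 0 \<Longrightarrow>
      \<exists>r\<in>N. r \<bullet> r = 2 \<and> r \<bullet> \<alpha> \<noteq> 0 \<and> (\<forall>c. r \<noteq> c *\<^sub>R \<alpha>)"
begin

lemma of_int_scaleR_mem:
  assumes "x \<in> N"
  shows "of_int n *\<^sub>R x \<in> N"
proof -
  have "- y \<in> N" if "y \<in> N" for y
    using diff_mem[of 0 y] that by simp
  moreover have "x + y \<in> N" if "y \<in> N" for y
    using diff_mem[OF assms calculation[OF that]] by simp
  then have "of_nat m *\<^sub>R x \<in> N" for m
    by (induction m) (auto simp: scaleR_add_left)
  ultimately show ?thesis
    by (cases n rule: int_cases2) auto
qed

text \<open>A root would decompose into two orthogonal nonzero lattice vectors, hence have squared length at least 4.\<close>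

lemma exists_not_multiple:
  assumes "\<alpha> \<in> N" "\<alpha> \<noteq> 0"
  shows "\<exists>r\<in>N. r \<bullet> \<alpha> / (\<alpha> \<bullet> \<alpha>) \<notin> \<int>"
proof (rule ccontr)
  assume contra: "\<not> ?thesis"
  obtain r where r: "r \<in> N" "r \<bullet> r = 2" "r \<bullet> \<alpha> \<noteq> 0" "\<And>c. r \<noteq> c *\<^sub>R \<alpha>"
    using irreducible[OF span_base assms(2)] assms(1) by blast
  then obtain a where a: "r \<bullet> \<alpha> / (\<alpha> \<bullet> \<alpha>) = of_int a"
    using contra by (metis Ints_cases)
  then have a': "r \<bullet> \<alpha> = of_int a * (\<alpha> \<bullet> \<alpha>)" "a \<noteq> 0"
    using assms(2) r(3) by (auto simp: field_simps)
  define r' where "r' = r - of_int a *\<^sub>R \<alpha>"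
  have "r' \<in> N" "r' \<noteq> 0"
    using diff_mem r(1,4) of_int_scaleR_mem[OF assms(1)] by (auto simp: r'_def)
  then have "2 \<le> r' \<bullet> r'" by (rule norm_ge)
  have "of_int a *\<^sub>R \<alpha> \<noteq> 0"
    using a'(2) assms(2) by simp
  then have "2 \<le> (of_int a *\<^sub>R \<alpha>) \<bullet> (of_int a *\<^sub>R \<alpha>)"
    by (intro norm_ge of_int_scaleR_mem assms)
  moreover have "r \<bullet> r = r' \<bullet> r' + (of_int a *\<^sub>R \<alpha>) \<bullet> (of_int a *\<^sub>R \<alpha>)"
    using a'(1) by (simp add: r'_def inner_diff inner_commute)
  ultimately show False
    using \<open>2 \<le> r' \<bullet> r'\<close> r(2) by simp
qed

lemma unsplit_lattice: "unsplit_lattice N"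
proof
  show "\<exists>m>0. \<forall>x\<in>N. x \<noteq> 0 \<longrightarrow> m \<le> norm x"
  proof (intro exI[of _ 1] conjI ballI impI)
    fix x assume "x \<in> N" "x \<noteq> 0"
    then have "1\<^sup>2 \<le> (norm x)\<^sup>2"
      using norm_ge[of x] by (simp add: power2_norm_eq_inner)
    then show "1 \<le> norm x"
      by (rule power2_le_imp_le) simp
  qed simp
  show "\<exists>q\<in>N. p \<bullet> q / (p \<bullet> p) \<notin> \<int>" if "p \<in> N" "p \<noteq> 0" for p
    using exists_not_multiple[OF that] by (simp add: inner_commute)
qed (use diff_mem bidual in auto)

text \<open>If a dual vector \<open>p\<close> violated \<open>unsplit\<close>, then
  \<open>p / (p \<bullet> p)\<close> would be integral on the dual, hence in \<open>N\<close>. The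
  non-integer that \<open>exists_not_multiple\<close> finds for it equals
  \<open>r \<bullet> p\<close>, an integer by duality. Discreteness holds because some root pairs
  with a given nonzero dual vector in a nonzero integer.\<close>

lemma unsplit_dual_lattice: "unsplit_lattice (dual_lattice N)"
proof
  show "0 \<in> dual_lattice N"
    by (simp add: dual_lattice_def span_zero)
  show "x - y \<in> dual_lattice N" if "x \<in> dual_lattice N" "y \<in> dual_lattice N" for x y
    using that by (auto simp: dual_lattice_def span_diff inner_diff_right)
  show "\<exists>m>0. \<forall>x\<in>dual_lattice N. x \<noteq> 0 \<longrightarrow> m \<le> norm x"
  proof (intro exI[of _ "1 / 2"] conjI ballI impI)
    fix y assume y: "y \<in> dual_lattice N" "y \<noteq> 0"
    then obtain r where r: "r \<in> N" "r \<bullet> r = 2" "r \<bullet> y \<noteq> 0"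
      using irreducible[of y] by (auto simp: dual_lattice_def)
    then have "r \<bullet> y \<in> \<int>"
      using y by (simp add: dual_lattice_def)
    then have "1 \<le> \<bar>r \<bullet> y\<bar>"
      using r(3) by (rule Ints_nonzero_abs_ge1)
    also have "\<dots> \<le> norm r * norm y"
      by (rule Cauchy_Schwarz_ineq2)
    also have "\<dots> \<le> 2 * norm y"
    proof (rule mult_right_mono)
      have "(norm r)\<^sup>2 \<le> 2\<^sup>2"
        using r(2) by (simp add: power2_norm_eq_inner)
      then show "norm r \<le> 2" by (rule power2_le_imp_le) simp
    qed simp
    finally show "1 / 2 \<le> norm y" by simp
  qed simp
  have span_le: "span (dual_lattice N) \<subseteq> span N"
    by (intro span_minimal) (auto simp: dual_lattice_def)
  show "x \<in> dual_lattice N" if x: "x \<in> span (dual_lattice N)"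
    and H: "\<And>\<eta>. (\<And>y. y \<in> dual_lattice N \<Longrightarrow> \<eta> \<bullet> y \<in> \<int>) \<Longrightarrow> \<eta> \<bullet> x \<in> \<int>" for x
    using x span_le H unfolding dual_lattice_def by blast
  show "\<exists>q\<in>dual_lattice N. p \<bullet> q / (p \<bullet> p) \<notin> \<int>" if p: "p \<in> dual_lattice N" "p \<noteq> 0" for p
  proof (rule ccontr)
    assume contra: "\<not> ?thesis"
    define \<alpha> where "\<alpha> = p /\<^sub>R (p \<bullet> p)"
    have "\<alpha> \<in> N"
    proof (rule bidual)
      show "\<alpha> \<in> span N"
        using p by (simp add: \<alpha>_def dual_lattice_def span_scale)
      fix \<eta> assume \<eta>: "\<And>y. y \<in> N \<Longrightarrow> \<eta> \<bullet> y \<in> \<int>"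
      obtain \<eta>' where \<eta>': "\<eta>' \<in> span N" "\<And>x. x \<in> span N \<Longrightarrow> \<eta>' \<bullet> x = \<eta> \<bullet> x"
        using project_functional[of N \<eta>] by blast
      have "\<eta>' \<in> dual_lattice N"
        using \<eta> \<eta>' by (auto simp: dual_lattice_def inner_commute span_base)
      then have "p \<bullet> \<eta>' / (p \<bullet> p) \<in> \<int>"
        using contra by blast
      moreover have "p \<bullet> \<eta>' = \<eta> \<bullet> p"
        using \<eta>'(2)[of p] p(1) by (simp add: dual_lattice_def inner_commute)
      ultimately show "\<eta> \<bullet> \<alpha> \<in> \<int>"
        by (simp add: \<alpha>_def divide_inverse mult.commute)
    qed
    moreover have "\<alpha> \<noteq> 0"
      using p(2) by (simp add: \<alpha>_def)
    ultimately obtain r where "r \<in> N" "r \<bullet> \<alpha> / (\<alpha> \<bullet> \<alpha>) \<notin> \<int>"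
      using exists_not_multiple by blast
    moreover have "r \<bullet> \<alpha> / (\<alpha> \<bullet> \<alpha>) = r \<bullet> p"
      using p(2) by (simp add: \<alpha>_def field_simps)
    ultimately show False
      using p(1) by (simp add: dual_lattice_def)
  qed
qed

lemma dim_dual_lattice:
  assumes "\<And>x y. x \<in> N \<Longrightarrow> y \<in> N \<Longrightarrow> x \<bullet> y \<in> \<int>"
  shows "dim (dual_lattice N) = dim N"
proof -
  have "N \<subseteq> dual_lattice N" "dual_lattice N \<subseteq> span N"
    using assms by (auto simp: dual_lattice_def span_base)
  then have "dim N \<le> dim (dual_lattice N)" "dim (dual_lattice N) \<le> dim (span N)"
    by (simp_all only: dim_subset)
  then show ?thesis by simp
qed

end

section \<open>The root lattices\<close>

lemma int_spanI: "finite F \<Longrightarrow> F \<subseteq> S \<Longrightarrow> (\<Sum>r\<in>F. of_int (c r) *\<^sub>R r) \<in> int_span S"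
  by (auto simp: int_span_def)

lemma int_span_diff:
  assumes "x \<in> int_span S" "y \<in> int_span S"
  shows "x - y \<in> int_span S"
proof -
  obtain F c where F: "finite F" "F \<subseteq> S" "x = (\<Sum>r\<in>F. of_int (c r) *\<^sub>R r)"
    using assms(1) by (auto simp: int_span_def)
  obtain G d where G: "finite G" "G \<subseteq> S" "y = (\<Sum>r\<in>G. of_int (d r) *\<^sub>R r)"
    using assms(2) by (auto simp: int_span_def)
  have x: "x = (\<Sum>r\<in>F \<union> G. of_int (if r \<in> F then c r else 0) *\<^sub>R r)"
    unfolding F(3) using F(1) G(1) by (intro sum.mono_neutral_cong_left) auto
  have y: "y = (\<Sum>r\<in>F \<union> G. of_int (if r \<in> G then d r else 0) *\<^sub>R r)"
    unfolding G(3) using F(1) G(1) by (intro sum.mono_neutral_cong_left) auto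
  have eq: "x - y = (\<Sum>r\<in>F \<union> G. of_int ((if r \<in> F then c r else 0) - (if r \<in> G then d r else 0)) *\<^sub>R r)"
    unfolding x y sum_subtractf[symmetric] by (intro sum.cong refl) (simp only: of_int_diff scaleR_diff_left)
  show ?thesis
    unfolding eq by (rule int_spanI) (use F G in auto)
qed

lemma int_span_zero: "0 \<in> int_span S"
  using int_spanI[of "{}" S] by simp

lemma int_span_add: "x \<in> int_span S \<Longrightarrow> y \<in> int_span S \<Longrightarrow> x + y \<in> int_span S"
  using int_span_diff[of x S "0 - y"] int_span_diff[of 0 S y] int_span_zero[of S] by simp

lemma int_span_base: "x \<in> S \<Longrightarrow> x \<in> int_span S"
  using int_spanI[of "{x}" S "\<lambda>_. 1"] by simp

lemma int_span_sum: "(\<And>i. i \<in> I \<Longrightarrow> f i \<in> int_span S) \<Longrightarrow> (\<Sum>i\<in>I. f i) \<in> int_span S"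
  by (induction I rule: infinite_finite_induct) (auto intro: int_span_zero int_span_add)

lemma int_span_scale:
  assumes "x \<in> int_span S" "a \<in> \<int>"
  shows "a *\<^sub>R x \<in> int_span S"
proof -
  obtain F c where F: "finite F" "F \<subseteq> S" "x = (\<Sum>r\<in>F. of_int (c r) *\<^sub>R r)"
    using assms(1) by (auto simp: int_span_def)
  obtain n where "a = of_int n" using assms(2) by (auto elim: Ints_cases)
  then have eq: "a *\<^sub>R x = (\<Sum>r\<in>F. of_int (n * c r) *\<^sub>R r)"
    by (simp add: F(3) scaleR_sum_right)
  show ?thesis unfolding eq by (rule int_spanI[OF F(1,2)])
qed

lemma int_span_minimal:
  assumes "S \<subseteq> M" "0 \<in> M" "\<And>x y. x \<in> M \<Longrightarrow> y \<in> M \<Longrightarrow> x - y \<in> M"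
  shows "int_span S \<subseteq> M"
proof -
  have minus: "- x \<in> M" if "x \<in> M" for x using assms(3)[OF assms(2) that] by simp
  have add: "x + y \<in> M" if "x \<in> M" "y \<in> M" for x y using assms(3)[OF that(1) minus[OF that(2)]] by simp
  have nat: "of_nat n *\<^sub>R x \<in> M" if "x \<in> M" for n x
    by (induction n) (use that assms(2) add in \<open>auto simp: scaleR_add_left\<close>)
  have of_int: "of_int n *\<^sub>R x \<in> M" if "x \<in> M" for n x
    using nat[OF that] minus[OF nat[OF that]] by (cases n rule: int_cases2) auto
  have "(\<Sum>r\<in>F. of_int (c r) *\<^sub>R r) \<in> M" if "finite F" "F \<subseteq> S" for F c
    using that by (induction F rule: finite_induct) (use assms(1,2) add of_int in auto)
  then show ?thesis by (auto simp: int_span_def)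
qed

lemma Ints_half_mult_pred:
  fixes z :: real
  assumes "z \<in> \<int>"
  shows "z * (z - 1) / 2 \<in> \<int>"
proof -
  obtain n where "z = of_int n" using assms by (auto elim: Ints_cases)
  moreover have "even (n * (n - 1))" by simp
  then obtain m where "n * (n - 1) = 2 * m" by blast
  then have "of_int n * (of_int n - 1 :: real) = 2 * of_int m"
    by (metis of_int_1 of_int_diff of_int_mult of_int_numeral)
  ultimately show ?thesis by simp
qed

lemma inner_self_ge_2:
  fixes x :: "'a::real_inner"
  assumes "x \<bullet> x / 2 \<in> \<int>" "x \<noteq> 0"
  shows "2 \<le> x \<bullet> x"
proof -
  obtain n where n: "x \<bullet> x / 2 = of_int n" using assms(1) by (auto elim: Ints_cases)
  moreover have "0 < x \<bullet> x / 2" using assms(2) by simp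
  ultimately have "n \<ge> 1" by simp
  then have "(1::real) \<le> of_int n" by simp
  then show ?thesis using n by linarith
qed

lemma inner_self_half_eq:
  fixes x :: "real ^ 'n::finite"
  shows "x \<bullet> x / 2 = (\<Sum>i\<in>UNIV. x $ i * (x $ i - 1) / 2) + (\<Sum>i\<in>UNIV. x $ i) / 2"
  unfolding inner_vec_def inner_real_def sum_divide_distrib sum.distrib[symmetric]
  by (intro sum.cong refl) (simp add: field_simps)

lemma inner_self_half_Ints:
  fixes x :: "real ^ 'n::finite"
  assumes "\<And>i. x $ i \<in> \<int>" "(\<Sum>i\<in>UNIV. x $ i) / 2 \<in> \<int>"
  shows "x \<bullet> x / 2 \<in> \<int>"
  unfolding inner_self_half_eq using assms by (intro Ints_add Ints_sum Ints_half_mult_pred)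

lemma inner_axis_diff: "(axis i 1 - axis j 1) \<bullet> (x :: real ^ 'n::finite) = x $ i - x $ j"
  by (simp add: inner_diff_left inner_axis')

lemma inner_axis_add: "(axis i 1 + axis j 1) \<bullet> (x :: real ^ 'n::finite) = x $ i + x $ j"
  by (simp add: inner_add_left inner_axis')

lemma norm_axis_diff:
  "i \<noteq> j \<Longrightarrow> (axis i 1 - axis j 1) \<bullet> (axis i 1 - axis j 1 :: real ^ 'n::finite) = 2"
  by (simp add: inner_axis_diff) (simp add: axis_def)

text \<open>If \<open>axis i 1 - axis j 1\<close> is parallel to \<open>\<alpha>\<close>, then \<open>axis i 1 - axis k 1\<close> is not.\<close>

lemma irreducible_axis_diff:
  fixes \<alpha> :: "real ^ 'n::finite"
  assumes "\<alpha> $ i \<noteq> \<alpha> $ j" "k \<noteq> i" "k \<noteq> j"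
    and N: "axis i 1 - axis j 1 \<in> N" "axis i 1 - axis k 1 \<in> N"
  shows "\<exists>r\<in>N. r \<bullet> r = 2 \<and> r \<bullet> \<alpha> \<noteq> 0 \<and> (\<forall>c. r \<noteq> c *\<^sub>R \<alpha>)"
proof (cases "\<exists>c. axis i 1 - axis j 1 = c *\<^sub>R \<alpha>")
  case False
  have "i \<noteq> j" using assms(1) by auto
  then show ?thesis
    using assms(1) False N norm_axis_diff[OF \<open>i \<noteq> j\<close>]
    by (intro bexI[of _ "axis i 1 - axis j 1"]) (auto simp: inner_axis_diff)
next
  case True
  then obtain c where c: "axis i 1 - axis j 1 = c *\<^sub>R \<alpha>" by blast
  have "i \<noteq> j" using assms(1) by auto
  have comp: "(axis i 1 - axis j 1) $ m = c * \<alpha> $ m" for m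
    unfolding c by simp
  have "c * \<alpha> $ i = 1" "c * \<alpha> $ k = 0"
    using comp[of i] comp[of k] \<open>i \<noteq> j\<close> assms(2,3) by (auto simp: axis_def)
  then have \<alpha>: "\<alpha> $ i \<noteq> 0" "\<alpha> $ k = 0" by auto
  have "axis i 1 - axis k 1 \<noteq> d *\<^sub>R \<alpha>" for d
  proof
    assume "axis i 1 - axis k 1 = d *\<^sub>R \<alpha>"
    then have "(axis i 1 - axis k 1 :: real ^ 'n) $ k = d * \<alpha> $ k" by simp
    then show False using assms(2) \<alpha> by (simp add: axis_def)
  qed
  then show ?thesis
    using \<alpha> N norm_axis_diff[of i k] assms(2)
    by (intro bexI[of _ "axis i 1 - axis k 1"]) (auto simp: inner_axis_diff)
qed

text \<open>The coefficients are the coordinates themselves, so the same expansion serves real and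
  integer spans.\<close>

lemma vec_eq_sum_axis_diff:
  fixes x :: "real ^ 'n::finite"
  shows "x = (\<Sum>i\<in>UNIV. x $ i *\<^sub>R (axis i 1 - axis k 1)) + (\<Sum>i\<in>UNIV. x $ i) *\<^sub>R axis k 1"
proof -
  have "(\<Sum>i\<in>UNIV. x $ i *\<^sub>R axis i 1) = x"
    by (simp add: vec_eq_iff axis_def if_distrib cong: if_cong)
  then show ?thesis
    by (simp add: scaleR_diff_right sum_subtractf scaleR_sum_left)
qed

lemma card_ge_3_obtain:
  assumes "card I \<ge> 3"
  obtains k where "k \<in> I" "k \<noteq> i" "k \<noteq> j"
proof -
  have "card {i, j} \<le> 2"
    by (simp add: card_insert_if)
  then have "\<not> I \<subseteq> {i, j}"
    using assms card_mono[of "{i, j}" I] by fastforce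
  then show ?thesis using that by blast
qed

lemma exists_distinct_coords:
  fixes \<alpha> :: "'i \<Rightarrow> real"
  assumes "finite I" "(\<Sum>i\<in>I. \<alpha> i) = 0" "i0 \<in> I" "\<alpha> i0 \<noteq> 0"
  shows "\<exists>j\<in>I. \<alpha> i0 \<noteq> \<alpha> j"
proof (rule ccontr)
  assume "\<not> ?thesis"
  then have "(\<Sum>i\<in>I. \<alpha> i) = (\<Sum>i\<in>I. \<alpha> i0)" by (intro sum.cong) auto
  then show False using assms by auto
qed

section \<open>Vectors of coordinate sum zero and the lattices A_n\<close>

definition zero_sum :: "(real ^ 'n::finite) set" where
  "zero_sum = {x. (\<Sum>i\<in>UNIV. x $ i) = 0}"

lemma subspace_zero_sum: "subspace zero_sum"
  by (rule subspaceI) (auto simp: zero_sum_def sum.distrib simp flip: sum_distrib_left)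

lemma zero_sum_eq: "zero_sum = {x :: real ^ 'n::finite. (\<chi> i. 1) \<bullet> x = 0}"
  by (simp add: zero_sum_def inner_vec_def)

lemma span_zero_sum:
  fixes N :: "(real ^ 'n::finite) set"
  assumes "N \<subseteq> zero_sum" and "\<And>i j. i \<noteq> j \<Longrightarrow> axis i 1 - axis j 1 \<in> N"
  shows "span N = zero_sum"
proof
  show "span N \<subseteq> zero_sum"
    using assms(1) subspace_zero_sum by (rule span_minimal)
  show "zero_sum \<subseteq> span N"
  proof
    fix x :: "real ^ 'n" assume "x \<in> zero_sum"
    then have "x = (\<Sum>i\<in>UNIV. x $ i *\<^sub>R (axis i 1 - axis k 1))" for k
      using vec_eq_sum_axis_diff[of x k] by (simp add: zero_sum_def)
    moreover have "axis i 1 - axis k 1 \<in> span N" for i k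
      using assms(2)[of i k] by (cases "i = k") (auto intro: span_base span_zero)
    then have "(\<Sum>i\<in>UNIV. x $ i *\<^sub>R (axis i 1 - axis k 1)) \<in> span N" for k
      by (intro span_sum span_scale)
    ultimately show "x \<in> span N" by metis
  qed
qed

lemma dim_zero_sum: "dim (zero_sum :: (real ^ 'n::finite) set) = CARD('n) - 1"
proof -
  have "(\<chi> i. 1) \<noteq> (0 :: real ^ 'n)" by (simp add: vec_eq_iff)
  then show ?thesis
    unfolding zero_sum_eq by (simp add: dim_hyperplane)
qed

text \<open>A nonzero vector of coordinate sum 0 has two different coordinates. The third index that
  \<open>irreducible_axis_diff\<close> asks for is where the bound on the dimension enters.\<close>

lemma irreducible_zero_sum:
  fixes \<alpha> :: "real ^ 'n::finite"
  assumes "CARD('n) \<ge> 3" and "\<And>i j. i \<noteq> j \<Longrightarrow> axis i 1 - axis j 1 \<in> N"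
    and "\<alpha> \<in> zero_sum" "\<alpha> \<noteq> 0"
  shows "\<exists>r\<in>N. r \<bullet> r = 2 \<and> r \<bullet> \<alpha> \<noteq> 0 \<and> (\<forall>c. r \<noteq> c *\<^sub>R \<alpha>)"
proof -
  obtain i where "\<alpha> $ i \<noteq> 0" using assms(4) by (auto simp: vec_eq_iff)
  then obtain j where j: "\<alpha> $ i \<noteq> \<alpha> $ j"
    using exists_distinct_coords[of UNIV "\<lambda>i. \<alpha> $ i" i] assms(3) by (auto simp: zero_sum_def)
  obtain k where "k \<noteq> i" "k \<noteq> j" using card_ge_3_obtain[OF assms(1)] by metis
  moreover have "i \<noteq> j" using j by auto
  ultimately show ?thesis
    by (intro irreducible_axis_diff[OF j]) (auto intro: assms(2))
qed

lemma inner_Ints: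
  fixes x y :: "real ^ 'n::finite"
  assumes "\<And>i. x $ i \<in> \<int>" "\<And>i. y $ i \<in> \<int>"
  shows "x \<bullet> y \<in> \<int>"
  unfolding inner_vec_def using assms by (intro Ints_sum) auto

lemma
  assumes "CARD('n::finite) \<ge> 2"
  shows root_lattice_A: "root_lattice (lattice_A :: (real ^ 'n option) set)"
    and dim_lattice_A: "dim (lattice_A :: (real ^ 'n option) set) = CARD('n)"
proof -
  let ?A = "lattice_A :: (real ^ 'n option) set"
  have roots: "axis i 1 - axis j 1 \<in> ?A" if "i \<noteq> j" for i j
    using that by (auto simp: lattice_A_def axis_def sum_subtractf)
  have "?A \<subseteq> zero_sum"
    by (auto simp: lattice_A_def zero_sum_def)
  from span_zero_sum[OF this roots] have span: "span ?A = zero_sum" .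
  show "dim ?A = CARD('n)"
    using dim_span[of ?A] unfolding span dim_zero_sum by simp
  show "root_lattice ?A"
  proof
    show "0 \<in> ?A" by (simp add: lattice_A_def)
    show "x - y \<in> ?A" if "x \<in> ?A" "y \<in> ?A" for x y
      using that by (simp add: lattice_A_def sum_subtractf)
    show "2 \<le> x \<bullet> x" if "x \<in> ?A" "x \<noteq> 0" for x
      using that by (intro inner_self_ge_2 inner_self_half_Ints) (auto simp: lattice_A_def)
    show "x \<in> ?A" if "x \<in> span ?A" and H: "\<And>\<eta>. (\<And>y. y \<in> ?A \<Longrightarrow> \<eta> \<bullet> y \<in> \<int>) \<Longrightarrow> \<eta> \<bullet> x \<in> \<int>" for x
    proof -
      \<comment> \<open>Unit vectors lie outside the span of the lattice, but the bidual condition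
        admits test vectors from the whole ambient space.\<close>
      have "x $ i \<in> \<int>" for i
        using H[of "axis i 1"] by (simp add: inner_axis' lattice_A_def)
      then show ?thesis
        using that(1) unfolding span by (simp add: lattice_A_def zero_sum_def)
    qed
    show "\<exists>r\<in>?A. r \<bullet> r = 2 \<and> r \<bullet> \<alpha> \<noteq> 0 \<and> (\<forall>c. r \<noteq> c *\<^sub>R \<alpha>)" if "\<alpha> \<in> span ?A" "\<alpha> \<noteq> 0" for \<alpha>
      using that assms roots unfolding span by (intro irreducible_zero_sum) auto
  qed
qed

lemma lattice_A_integral: "x \<in> lattice_A \<Longrightarrow> y \<in> lattice_A \<Longrightarrow> x \<bullet> y \<in> \<int>"
  by (intro inner_Ints) (auto simp: lattice_A_def)

section \<open>The lattices D_n\<close>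

lemma mem_lattice_D_iff: "x \<in> lattice_D \<longleftrightarrow> (\<forall>i. x $ i \<in> \<int>) \<and> (\<Sum>i\<in>UNIV. x $ i) / 2 \<in> \<int>"
proof -
  have "(\<exists>m::int. even m \<and> z = of_int m) \<longleftrightarrow> z / 2 \<in> \<int>" for z :: real
  proof
    assume "z / 2 \<in> \<int>"
    then obtain m where "z / 2 = of_int m" by (auto elim: Ints_cases)
    then show "\<exists>m::int. even m \<and> z = of_int m"
      by (intro exI[of _ "2 * m"]) auto
  qed auto
  then show ?thesis by (simp add: lattice_D_def)
qed

lemma axis_mem_lattice_D:
  assumes "i \<noteq> j"
  shows "axis i 1 - axis j 1 \<in> lattice_D" "axis i 1 + axis j 1 \<in> lattice_D"
  using assms by (auto simp: mem_lattice_D_iff axis_def sum_subtractf sum.distrib)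

text \<open>Differences of unit vectors detect every direction but the constant one, for which a sum
  of two unit vectors steps in; a third coordinate keeps that sum from being constant.
  \<open>N\<close> need only contain D_n, so that E_8 is covered too.\<close>

lemma irreducible_D:
  fixes \<alpha> :: "real ^ 'n::finite"
  assumes "CARD('n) \<ge> 3" "\<alpha> \<noteq> 0" "lattice_D \<subseteq> N"
  shows "\<exists>r\<in>N. r \<bullet> r = 2 \<and> r \<bullet> \<alpha> \<noteq> 0 \<and> (\<forall>c. r \<noteq> c *\<^sub>R \<alpha>)"
proof (cases "\<exists>i j. \<alpha> $ i \<noteq> \<alpha> $ j")
  case True
  then obtain i j where ij: "\<alpha> $ i \<noteq> \<alpha> $ j" by blast
  obtain k where "k \<noteq> i" "k \<noteq> j" using card_ge_3_obtain[OF assms(1)] by metis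
  moreover have "i \<noteq> j" using ij by auto
  ultimately show ?thesis
    using assms(3) by (intro irreducible_axis_diff[OF ij]) (auto intro: axis_mem_lattice_D(1))
next
  case False
  then obtain a where a: "\<And>i. \<alpha> $ i = a" by metis
  then have "a \<noteq> 0" using assms(2) by (auto simp: vec_eq_iff)
  obtain i j :: 'n where ij: "i \<noteq> j"
    using card_ge_3_obtain[OF assms(1)] by metis
  obtain k where k: "k \<noteq> i" "k \<noteq> j" using card_ge_3_obtain[OF assms(1)] by metis
  have "axis i 1 + axis j 1 \<noteq> d *\<^sub>R \<alpha>" for d
  proof
    assume eq: "axis i 1 + axis j 1 = d *\<^sub>R \<alpha>"
    have "(axis i 1 + axis j 1 :: real ^ 'n) $ m = d * a" for m
      unfolding eq by (simp add: a)
    from this[of k] this[of i] show False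
      using ij k by (auto simp: axis_def split: if_splits)
  qed
  moreover have "(axis i 1 + axis j 1) \<bullet> (axis i 1 + axis j 1 :: real ^ 'n) = 2"
    using ij by (simp add: inner_axis_add) (simp add: axis_def)
  ultimately show ?thesis
    using \<open>a \<noteq> 0\<close> axis_mem_lattice_D(2)[OF ij] assms(3)
    by (intro bexI[of _ "axis i 1 + axis j 1"]) (auto simp: inner_axis_add a)
qed

lemma span_lattice_D:
  assumes "CARD('n::finite) \<ge> 3"
  shows "span (lattice_D :: (real ^ 'n) set) = UNIV"
proof -
  have "axis i 1 \<in> span (lattice_D :: (real ^ 'n) set)" for i
  proof -
    obtain j where "j \<noteq> i" using card_ge_3_obtain[OF assms] by metis
    then have "(1 / 2) *\<^sub>R ((axis i 1 - axis j 1) + (axis i 1 + axis j 1)) \<in> span (lattice_D :: (real ^ 'n) set)"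
      by (intro span_scale span_add span_base axis_mem_lattice_D) auto
    then show ?thesis by simp
  qed
  then have "span Basis \<subseteq> span (lattice_D :: (real ^ 'n) set)"
    by (intro span_minimal) (auto simp: Basis_vec_def)
  then show ?thesis by auto
qed

lemma root_lattice_D:
  assumes "CARD('n::finite) \<ge> 3"
  shows "root_lattice (lattice_D :: (real ^ 'n) set)"
proof
  let ?D = "lattice_D :: (real ^ 'n) set"
  show "0 \<in> ?D" by (simp add: mem_lattice_D_iff)
  show "x - y \<in> ?D" if "x \<in> ?D" "y \<in> ?D" for x y
    using that by (simp add: mem_lattice_D_iff sum_subtractf diff_divide_distrib)
  show "2 \<le> x \<bullet> x" if "x \<in> ?D" "x \<noteq> 0" for x
    using that by (intro inner_self_ge_2 inner_self_half_Ints) (auto simp: mem_lattice_D_iff)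
  show "x \<in> ?D" if H: "\<And>\<eta>. (\<And>y. y \<in> ?D \<Longrightarrow> \<eta> \<bullet> y \<in> \<int>) \<Longrightarrow> \<eta> \<bullet> x \<in> \<int>" for x
  proof -
    have "x $ i \<in> \<int>" for i
      using H[of "axis i 1"] by (simp add: inner_axis' mem_lattice_D_iff)
    \<comment> \<open>The all-halves vector is integral on the lattice and tests the parity of the
      coordinate sum.\<close>
    moreover have half: "(\<chi> i. 1 / 2) \<bullet> y = (\<Sum>i\<in>UNIV. y $ i) / 2" for y :: "real ^ 'n"
      by (simp add: inner_vec_def sum_divide_distrib)
    have "(\<Sum>i\<in>UNIV. x $ i) / 2 \<in> \<int>"
      using H[of "\<chi> i. 1 / 2"] unfolding half by (simp add: mem_lattice_D_iff)
    ultimately show ?thesis by (simp add: mem_lattice_D_iff)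
  qed
  show "\<exists>r\<in>?D. r \<bullet> r = 2 \<and> r \<bullet> \<alpha> \<noteq> 0 \<and> (\<forall>c. r \<noteq> c *\<^sub>R \<alpha>)" if "\<alpha> \<noteq> 0" for \<alpha>
    using irreducible_D[OF assms that subset_refl] .
qed

lemma lattice_D_integral: "x \<in> lattice_D \<Longrightarrow> y \<in> lattice_D \<Longrightarrow> x \<bullet> y \<in> \<int>"
  by (intro inner_Ints) (auto simp: mem_lattice_D_iff)

section \<open>The lattice E_8 as D_8 together with its half-integral coset\<close>

definition coords_E8 :: "(real ^ 8) set" where
  "coords_E8 = {x. ((\<forall>i. x $ i \<in> \<int>) \<or> (\<forall>i. x $ i - 1 / 2 \<in> \<int>)) \<and> (\<Sum>i\<in>UNIV. x $ i) / 2 \<in> \<int>}"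

definition half_vec :: "8 set \<Rightarrow> real ^ 8" where
  "half_vec A = (\<chi> i. if i \<in> A then - 1 / 2 else 1 / 2)"

lemma half_vec_nth: "half_vec A $ i = 1 / 2 - (if i \<in> A then 1 else 0)"
  by (simp add: half_vec_def)

lemma half_vec_mem_roots: "even (card A) \<Longrightarrow> half_vec A \<in> roots_E8"
  by (simp add: roots_E8_def half_vec_def cong: if_cong)

lemma axis_mem_roots:
  assumes "i \<noteq> j"
  shows "axis i 1 - axis j 1 \<in> roots_E8" "axis i 1 + axis j 1 \<in> roots_E8"
proof -
  have "1 *\<^sub>R axis i 1 + (-1) *\<^sub>R axis j 1 \<in> roots_E8" "1 *\<^sub>R axis i 1 + 1 *\<^sub>R axis j 1 \<in> roots_E8"
    unfolding roots_E8_def using assms by blast+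
  then show "axis i 1 - axis j 1 \<in> roots_E8" "axis i 1 + axis j 1 \<in> roots_E8" by simp_all
qed

lemma roots_E8_cases:
  assumes "r \<in> roots_E8"
  obtains s t i j where "r = s *\<^sub>R axis i 1 + t *\<^sub>R axis j 1" "s \<in> {-1, 1}" "t \<in> {-1, 1}" "i \<noteq> j"
  | A where "r = half_vec A" "even (card A)"
proof -
  from assms consider "\<exists>s t i j. r = s *\<^sub>R axis i 1 + t *\<^sub>R axis j 1 \<and> s \<in> {-1, 1} \<and> t \<in> {-1, 1} \<and> i \<noteq> j"
    | "\<forall>i. r $ i \<in> {-1/2, 1/2}" "even (card {i. r $ i = -1/2})"
    unfolding roots_E8_def by blast
  then show ?thesis
  proof cases
    case 1
    then show ?thesis using that(1) by blast
  next
    case 2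
    have "r = half_vec {i. r $ i = -1/2}"
      using 2(1) by (auto simp: vec_eq_iff half_vec_def)
    then show ?thesis using that(2) 2(2) by blast
  qed
qed

lemma sum_half_vec:
  "(\<Sum>i\<in>I. half_vec A $ i) = real (card I) / 2 - real (card (I \<inter> A))"
  by (simp add: half_vec_nth sum_subtractf sum.If_cases)

lemma inner_half_vec: "half_vec A \<bullet> y = (\<Sum>i\<in>UNIV. y $ i) / 2 - (\<Sum>i\<in>A. y $ i)"
proof -
  have "half_vec A \<bullet> y = (\<Sum>i\<in>UNIV. y $ i / 2 - (if i \<in> A then y $ i else 0))"
    unfolding inner_vec_def by (intro sum.cong) (auto simp: half_vec_nth)
  then show ?thesis
    by (simp add: sum_subtractf sum_divide_distrib sum.If_cases)
qed

lemma coords_E8_diff: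
  assumes "x \<in> coords_E8" "y \<in> coords_E8"
  shows "x - y \<in> coords_E8"
proof -
  have "(\<Sum>i\<in>UNIV. (x - y) $ i) / 2 \<in> \<int>"
    using assms by (simp add: coords_E8_def sum_subtractf diff_divide_distrib)
  moreover have "(\<forall>i. (x - y) $ i \<in> \<int>) \<or> (\<forall>i. (x - y) $ i - 1 / 2 \<in> \<int>)"
  proof -
    have D: "a - b \<in> \<int>" if "a - 1 / 2 \<in> \<int>" "b - 1 / 2 \<in> \<int>" for a b :: real
      using Ints_diff[OF that] by simp
    have E: "a - b - 1 / 2 \<in> \<int>" if "a \<in> \<int>" "b - 1 / 2 \<in> \<int>" for a b :: real
      using Ints_diff[OF Ints_diff[OF that] Ints_1] by (simp add: algebra_simps)
    have G: "a - b - 1 / 2 \<in> \<int>" if "a - 1 / 2 \<in> \<int>" "b \<in> \<int>" for a b :: real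
      using Ints_diff[OF that] by (simp add: algebra_simps)
    show ?thesis
      using assms D E G by (auto simp: coords_E8_def)
  qed
  ultimately show ?thesis by (simp add: coords_E8_def)
qed

lemma sum_signs_half_Ints: "s \<in> {-1, 1} \<Longrightarrow> t \<in> {-1, 1} \<Longrightarrow> (s + t) / 2 \<in> (\<int> :: real set)"
  by auto

lemma sum_axis: "(\<Sum>k\<in>UNIV. (axis i 1 :: real ^ 'n::finite) $ k) = 1"
  by (simp add: axis_def)

lemma roots_subset_coords: "roots_E8 \<subseteq> coords_E8"
proof
  fix r assume "r \<in> roots_E8"
  then show "r \<in> coords_E8"
  proof (cases rule: roots_E8_cases)
    case (1 s t i j)
    then have "(\<Sum>i\<in>UNIV. r $ i) = s + t"
      by (simp add: sum.distrib sum_axis flip: sum_distrib_left)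
    moreover have "r $ k \<in> \<int>" for k
      using 1 by (auto simp: axis_def)
    ultimately show ?thesis
      using sum_signs_half_Ints[OF 1(2,3)] by (simp add: coords_E8_def)
  next
    case (2 A)
    obtain m where "card A = 2 * m" using 2(2) by blast
    then have "(\<Sum>i\<in>UNIV. r $ i) / 2 = 2 - real m"
      unfolding 2(1) sum_half_vec by simp
    moreover have "2 - real m \<in> \<int>" by simp
    ultimately have "(\<Sum>i\<in>UNIV. r $ i) / 2 \<in> \<int>" by (simp only:)
    then show ?thesis by (simp add: coords_E8_def 2(1) half_vec_nth)
  qed
qed

lemma inner_root_Ints:
  assumes "r \<in> roots_E8" "y \<in> coords_E8"
  shows "r \<bullet> y \<in> \<int>"
  using assms(1)
proof (cases rule: roots_E8_cases)
  case (1 s t i j)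
  have r: "r \<bullet> y = s * y $ i + t * y $ j"
    by (simp add: 1 inner_add_left inner_axis')
  have st: "s \<in> \<int>" "t \<in> \<int>" using 1 by auto
  consider "\<forall>i. y $ i \<in> \<int>" | "\<forall>i. y $ i - 1 / 2 \<in> \<int>"
    using assms(2) by (auto simp: coords_E8_def)
  then show ?thesis
  proof cases
    case 1
    then show ?thesis using st by (simp add: r)
  next
    case 2
    have "r \<bullet> y = s * (y $ i - 1 / 2) + t * (y $ j - 1 / 2) + (s + t) / 2"
      by (simp add: r field_simps)
    then show ?thesis
      using st 2 sum_signs_half_Ints[OF 1(2,3)] by simp
  qed
next
  case (2 A)
  have "(\<Sum>i\<in>A. y $ i) \<in> \<int>"
  proof -
    consider "\<forall>i. y $ i \<in> \<int>" | "\<forall>i. y $ i - 1 / 2 \<in> \<int>"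
      using assms(2) by (auto simp: coords_E8_def)
    then show ?thesis
    proof cases
      case 1
      then show ?thesis by auto
    next
      case y: 2
      obtain m where "card A = 2 * m" using 2(2) by blast
      then have "(\<Sum>i\<in>A. y $ i) = (\<Sum>i\<in>A. y $ i - 1 / 2) + real m"
        by (simp add: sum_subtractf)
      moreover have "(\<Sum>i\<in>A. y $ i - 1 / 2) \<in> \<int>" using y by auto
      ultimately show ?thesis by simp
    qed
  qed
  then show ?thesis
    using assms(2) unfolding 2(1) inner_half_vec by (simp add: coords_E8_def)
qed

text \<open>The all-halves root controls the parity; sums and differences of unit vectors make
  doubled coordinates integral and all coordinates congruent modulo 1. With
  \<open>inner_root_Ints\<close> this is the self-duality of E_8, tested on roots alone.\<close>

lemma coords_E8I:
  assumes "\<And>r. r \<in> roots_E8 \<Longrightarrow> r \<bullet> x \<in> \<int>"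
  shows "x \<in> coords_E8"
proof -
  have "(\<Sum>i\<in>UNIV. x $ i) / 2 \<in> \<int>"
    using assms[OF half_vec_mem_roots[of "{}"]] by (simp add: inner_half_vec)
  moreover
  obtain i j :: 8 where "i \<noteq> j"
    using card_ge_3_obtain[of "UNIV :: 8 set"] by force
  then have "x $ i + x $ j \<in> \<int>" "x $ i - x $ j \<in> \<int>"
    using assms[OF axis_mem_roots(1)] assms[OF axis_mem_roots(2)]
    unfolding inner_axis_diff inner_axis_add by blast+
  then have "2 * x $ i \<in> \<int>"
    using Ints_add by fastforce
  then obtain n where n: "2 * x $ i = of_int n" by (auto elim: Ints_cases)
  have diff: "x $ k - x $ i \<in> \<int>" for k
    using assms[OF axis_mem_roots(1)[of k i]] unfolding inner_axis_diff by (cases "k = i") auto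
  have "(\<forall>i. x $ i \<in> \<int>) \<or> (\<forall>i. x $ i - 1 / 2 \<in> \<int>)"
  proof (cases "even n")
    case True
    then obtain m where "n = 2 * m" by blast
    then have "x $ i \<in> \<int>" using n by simp
    then have "x $ k \<in> \<int>" for k using Ints_add[OF diff[of k]] by fastforce
    then show ?thesis by blast
  next
    case False
    then obtain m where "n = 2 * m + 1" by (auto elim: oddE)
    then have "x $ i - 1 / 2 = of_int m" using n by simp
    then have "x $ i - 1 / 2 \<in> \<int>" by simp
    then have "x $ k - 1 / 2 \<in> \<int>" for k using Ints_add[OF diff[of k]] by fastforce
    then show ?thesis by blast
  qed
  ultimately show ?thesis by (simp add: coords_E8_def)
qed

lemma coords_E8_inner_self:
  assumes "x \<in> coords_E8"
  shows "x \<bullet> x / 2 \<in> \<int>"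
proof -
  consider "\<forall>i. x $ i \<in> \<int>" | "\<forall>i. x $ i - 1 / 2 \<in> \<int>"
    using assms by (auto simp: coords_E8_def)
  then show ?thesis
  proof cases
    case 1
    then show ?thesis using assms by (intro inner_self_half_Ints) (auto simp: coords_E8_def)
  next
    case 2
    define z where "z i = x $ i - 1 / 2" for i
    \<comment> \<open>The remainders \<open>1 / 8\<close> add up to 1 over the eight
      coordinates.\<close>
    have "x \<bullet> x / 2 = (\<Sum>i\<in>UNIV. z i * (z i - 1) / 2 + z i + 1 / 8)"
      unfolding inner_vec_def sum_divide_distrib
      by (intro sum.cong refl) (simp add: z_def field_simps)
    also have "\<dots> = (\<Sum>i\<in>UNIV. z i * (z i - 1) / 2) + (\<Sum>i\<in>UNIV. z i) + 1"
      by (simp add: sum.distrib)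
    also have "\<dots> \<in> \<int>"
      using 2 by (intro Ints_add Ints_sum Ints_half_mult_pred Ints_1) (auto simp: z_def)
    finally show ?thesis .
  qed
qed

lemma int_span_subset_coords:
  assumes "R \<subseteq> roots_E8"
  shows "int_span R \<subseteq> coords_E8"
  using assms roots_subset_coords coords_E8_diff
  by (intro int_span_minimal) (auto simp: coords_E8_def)

text \<open>Every root of E_8, not only those in \<open>R\<close>, is integral on
  \<open>int_span R\<close> and thus a test vector for its bidual. So a bidual element lies in E_8,
  and \<open>gen\<close> asks that E_8 meets the span of \<open>R\<close> in nothing more than
  \<open>int_span R\<close>.\<close>

lemma root_lattice_subsystem:
  assumes R: "R \<subseteq> roots_E8"
    and gen: "\<And>x. x \<in> span (int_span R) \<Longrightarrow> x \<in> coords_E8 \<Longrightarrow> x \<in> int_span R"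
    and irr: "\<And>\<alpha>. \<alpha> \<in> span (int_span R) \<Longrightarrow> \<alpha> \<noteq> 0 \<Longrightarrow>
      \<exists>r\<in>int_span R. r \<bullet> r = 2 \<and> r \<bullet> \<alpha> \<noteq> 0 \<and> (\<forall>c. r \<noteq> c *\<^sub>R \<alpha>)"
  shows "root_lattice (int_span R)"
proof
  show "2 \<le> x \<bullet> x" if "x \<in> int_span R" "x \<noteq> 0" for x
    using that int_span_subset_coords[OF R] by (intro inner_self_ge_2 coords_E8_inner_self) auto
  show "x \<in> int_span R" if "x \<in> span (int_span R)"
    and H: "\<And>\<eta>. (\<And>y. y \<in> int_span R \<Longrightarrow> \<eta> \<bullet> y \<in> \<int>) \<Longrightarrow> \<eta> \<bullet> x \<in> \<int>" for x
    using that(1)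
  proof (rule gen)
    show "x \<in> coords_E8"
      using H inner_root_Ints int_span_subset_coords[OF R] by (intro coords_E8I) blast
  qed
qed (use int_span_zero int_span_diff irr in auto)

lemma half_vec_diff_Ints:
  assumes "\<not> (\<forall>i. x $ i \<in> \<int>)" "x \<in> coords_E8"
  shows "(x - half_vec A) $ i \<in> \<int>"
proof -
  have "x $ i - 1 / 2 \<in> \<int>" using assms by (auto simp: coords_E8_def)
  then have "x $ i - 1 / 2 + (if i \<in> A then 1 else 0) \<in> \<int>" by simp
  then show ?thesis by (simp add: half_vec_nth algebra_simps)
qed

lemma lattice_D_subset_E8: "lattice_D \<subseteq> int_span roots_E8"
proof
  fix x :: "real ^ 8" assume x: "x \<in> lattice_D"
  obtain j k :: 8 where "j \<noteq> k"
    using card_ge_3_obtain[of "UNIV :: 8 set"] by force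
  \<comment> \<open>Twice a unit vector is a sum of two roots; this absorbs the even coordinate sum
    that root differences leave over.\<close>
  have double: "(axis k 1 + axis j 1) + (axis k 1 - axis j 1) = 2 *\<^sub>R (axis k 1 :: real ^ 8)"
    unfolding scaleR_2 by simp
  have eq: "x = (\<Sum>i\<in>UNIV. x $ i *\<^sub>R (axis i 1 - axis k 1))
      + ((\<Sum>i\<in>UNIV. x $ i) / 2) *\<^sub>R ((axis k 1 + axis j 1) + (axis k 1 - axis j 1))"
    unfolding double scaleR_scaleR using vec_eq_sum_axis_diff[of x k] by simp
  have "axis i 1 - axis k 1 \<in> int_span roots_E8" for i
    by (cases "i = k") (auto intro: int_span_zero int_span_base axis_mem_roots)
  moreover have "(axis k 1 + axis j 1) + (axis k 1 - axis j 1) \<in> int_span roots_E8"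
    using \<open>j \<noteq> k\<close> by (intro int_span_add[OF int_span_base int_span_base] axis_mem_roots) auto
  ultimately have "(\<Sum>i\<in>UNIV. x $ i *\<^sub>R (axis i 1 - axis k 1))
      + ((\<Sum>i\<in>UNIV. x $ i) / 2) *\<^sub>R ((axis k 1 + axis j 1) + (axis k 1 - axis j 1)) \<in> int_span roots_E8"
    using x by (intro int_span_add[OF int_span_sum] int_span_scale) (auto simp: mem_lattice_D_iff)
  then show "x \<in> int_span roots_E8"
    unfolding eq[symmetric] .
qed

lemma span_E8: "span (int_span roots_E8) = UNIV"
  using span_mono[OF lattice_D_subset_E8] by (simp add: span_lattice_D top.extremum_unique)

lemma root_lattice_E8: "root_lattice (int_span roots_E8)"
proof (rule root_lattice_subsystem)
  show "x \<in> int_span roots_E8" if x: "x \<in> coords_E8" for x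
  proof (cases "\<forall>i. x $ i \<in> \<int>")
    case True
    then show ?thesis
      using x lattice_D_subset_E8 by (auto simp: coords_E8_def mem_lattice_D_iff)
  next
    case False
    have "half_vec {} \<in> coords_E8"
      using half_vec_mem_roots roots_subset_coords by force
    from coords_E8_diff[OF x this] have "x - half_vec {} \<in> lattice_D"
      using half_vec_diff_Ints[OF False x] by (auto simp: coords_E8_def mem_lattice_D_iff)
    then have "x - half_vec {} \<in> int_span roots_E8"
      using lattice_D_subset_E8 by blast
    moreover have "half_vec {} \<in> int_span roots_E8"
      by (intro int_span_base half_vec_mem_roots) simp
    ultimately show ?thesis
      using int_span_add by fastforce
  qed
  show "\<exists>r\<in>int_span roots_E8. r \<bullet> r = 2 \<and> r \<bullet> \<alpha> \<noteq> 0 \<and> (\<forall>c. r \<noteq> c *\<^sub>R \<alpha>)" if "\<alpha> \<noteq> 0" for \<alpha>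
    using irreducible_D[OF _ that lattice_D_subset_E8] by simp
qed simp

section \<open>The lattice E_7\<close>

lemma axis_diff_mem_roots_E7: "i \<noteq> j \<Longrightarrow> axis i 1 - axis j 1 \<in> roots_E7"
  using axis_mem_roots(1)[of i j] by (simp add: roots_E7_def sum_subtractf axis_def)

lemma span_E7: "span (int_span roots_E7) = zero_sum"
proof (rule span_zero_sum)
  show "int_span roots_E7 \<subseteq> zero_sum"
    by (intro int_span_minimal) (auto simp: roots_E7_def zero_sum_def sum_subtractf)
qed (auto intro: int_span_base axis_diff_mem_roots_E7)

lemma root_lattice_E7: "root_lattice (int_span roots_E7)"
proof (rule root_lattice_subsystem)
  show "roots_E7 \<subseteq> roots_E8" by (auto simp: roots_E7_def)
  have integral: "x \<in> int_span roots_E7" if "x \<in> zero_sum" "\<And>i. x $ i \<in> \<int>" for x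
  proof -
    have eq: "x = (\<Sum>i\<in>UNIV. x $ i *\<^sub>R (axis i 1 - axis 1 1))"
      using vec_eq_sum_axis_diff[of x 1] that(1) by (simp add: zero_sum_def)
    have "axis i 1 - axis 1 1 \<in> int_span roots_E7" for i
      by (cases "i = 1") (auto intro: int_span_zero int_span_base axis_diff_mem_roots_E7)
    then show ?thesis
      by (subst eq) (intro int_span_sum int_span_scale that(2))
  qed
  show "x \<in> int_span roots_E7" if "x \<in> span (int_span roots_E7)" and x: "x \<in> coords_E8" for x
  proof (cases "\<forall>i. x $ i \<in> \<int>")
    case True
    then show ?thesis using that(1) integral unfolding span_E7 by blast
  next
    case False
    \<comment> \<open>Four minus signs among eight make the coordinate sum vanish, and four is
      even.\<close>
    obtain A :: "8 set" where A: "card A = 4"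
      using obtain_subset_with_card_n[of 4 "UNIV :: 8 set"] by auto
    have root: "half_vec A \<in> roots_E7"
      using half_vec_mem_roots[of A] A by (simp add: roots_E7_def sum_half_vec)
    then have "x - half_vec A \<in> zero_sum"
      using that(1) subspace_diff[OF subspace_zero_sum] unfolding span_E7
      by (auto simp: roots_E7_def zero_sum_def)
    then have "(x - half_vec A) + half_vec A \<in> int_span roots_E7"
      by (intro int_span_add int_span_base root integral half_vec_diff_Ints[OF False x])
    then show ?thesis by simp
  qed
  show "\<exists>r\<in>int_span roots_E7. r \<bullet> r = 2 \<and> r \<bullet> \<alpha> \<noteq> 0 \<and> (\<forall>c. r \<noteq> c *\<^sub>R \<alpha>)"
    if "\<alpha> \<in> span (int_span roots_E7)" "\<alpha> \<noteq> 0" for \<alpha>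
    using that unfolding span_E7
    by (intro irreducible_zero_sum) (auto intro: int_span_base axis_diff_mem_roots_E7)
qed

section \<open>The lattice E_6\<close>

definition inner_coords :: "8 set" where "inner_coords = UNIV - {1, 8}"

definition span_E6_coords :: "(real ^ 8) set" where
  "span_E6_coords = {x. x $ 1 + x $ 8 = 0 \<and> (\<Sum>i\<in>inner_coords. x $ i) = 0}"

lemma inner_coords:
  "(1::8) \<noteq> 8" "card inner_coords = 6" "1 \<notin> inner_coords" "8 \<notin> inner_coords"
  "i \<in> inner_coords \<or> i = 1 \<or> i = 8" "UNIV = insert 1 (insert 8 inner_coords)"
  by (auto simp: inner_coords_def card_Diff_subset)

lemma roots_E6_eq: "roots_E6 = roots_E8 \<inter> span_E6_coords"
  by (auto simp: roots_E6_def span_E6_coords_def inner_coords_def)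

lemma subspace_E6: "subspace span_E6_coords"
  by (rule subspaceI) (auto simp: span_E6_coords_def sum.distrib simp flip: sum_distrib_left distrib_left)

lemma axis_diff_mem_roots_E6:
  "i \<in> inner_coords \<Longrightarrow> j \<in> inner_coords \<Longrightarrow> i \<noteq> j \<Longrightarrow> axis i 1 - axis j 1 \<in> roots_E6"
  "axis 1 1 - axis 8 1 \<in> roots_E6"
  unfolding roots_E6_eq using axis_mem_roots(1)[of i j] axis_mem_roots(1)[of 1 8] inner_coords(1,3,4)
  by (auto simp: span_E6_coords_def axis_def sum_subtractf)

text \<open>This displays the sublattice of integral vectors as A_1 on the outer coordinates 1 and 8
  plus A_5 on the six inner ones.\<close>

lemma E6_coords_eq:
  assumes "x \<in> span_E6_coords" "k \<in> inner_coords"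
  shows "x = x $ 1 *\<^sub>R (axis 1 1 - axis 8 1) + (\<Sum>i\<in>inner_coords. x $ i *\<^sub>R (axis i 1 - axis k 1))"
proof -
  have "x = (\<Sum>i\<in>UNIV. x $ i *\<^sub>R axis i 1)"
    by (simp add: vec_eq_iff axis_def if_distrib cong: if_cong)
  also have "\<dots> = x $ 1 *\<^sub>R axis 1 1 + x $ 8 *\<^sub>R axis 8 1 + (\<Sum>i\<in>inner_coords. x $ i *\<^sub>R axis i 1)"
    unfolding inner_coords(6) using inner_coords(1,3,4) by (simp add: add.assoc)
  also have "x $ 8 = - x $ 1"
    using assms by (simp add: span_E6_coords_def)
  also have "(\<Sum>i\<in>inner_coords. x $ i *\<^sub>R axis i 1) = (\<Sum>i\<in>inner_coords. x $ i *\<^sub>R (axis i 1 - axis k 1))"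
    using assms by (simp add: span_E6_coords_def scaleR_diff_right sum_subtractf flip: scaleR_sum_left)
  finally show ?thesis by (simp add: scaleR_diff_right)
qed

lemma span_E6: "span (int_span roots_E6) = span_E6_coords"
proof
  have "int_span roots_E6 \<subseteq> span_E6_coords"
    using subspace_0[OF subspace_E6] subspace_diff[OF subspace_E6]
    by (intro int_span_minimal) (auto simp: roots_E6_eq)
  then show "span (int_span roots_E6) \<subseteq> span_E6_coords"
    by (rule span_minimal) (rule subspace_E6)
  show "span_E6_coords \<subseteq> span (int_span roots_E6)"
  proof
    fix x assume x: "x \<in> span_E6_coords"
    obtain k where k: "k \<in> inner_coords" using inner_coords(2) by (metis all_not_in_conv card.empty zero_neq_numeral)
    have diff: "axis i 1 - axis k 1 \<in> span (int_span roots_E6)" if "i \<in> inner_coords" for i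
      using k that by (cases "i = k") (auto intro: span_zero span_base int_span_base axis_diff_mem_roots_E6)
    have outer: "axis 1 1 - axis 8 1 \<in> span (int_span roots_E6)"
      by (intro span_base int_span_base axis_diff_mem_roots_E6)
    show "x \<in> span (int_span roots_E6)"
      by (subst E6_coords_eq[OF x k]) (intro span_add span_sum span_scale diff outer; assumption)
  qed
qed

lemma dim_E6: "dim span_E6_coords = 6"
proof -
  define a b :: "real ^ 8" where "a = axis 1 1 + axis 8 1" and "b = (\<chi> i. if i \<in> inner_coords then 1 else 0)"
  have inner_a: "a \<bullet> x = x $ 1 + x $ 8" for x
    by (simp add: a_def inner_axis_add)
  have inner_b: "b \<bullet> x = (\<Sum>i\<in>inner_coords. x $ i)" for x
    unfolding inner_vec_def by (intro sum.mono_neutral_cong_right) (auto simp: b_def)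
  have "a \<bullet> a = 2" "b \<bullet> b = 6" "a \<bullet> b = 0"
    unfolding inner_a inner_b using inner_coords by (simp_all add: a_def b_def axis_def)
  then have "a \<noteq> 0" "b \<noteq> 0" "a \<noteq> b" "pairwise orthogonal {a, b}"
    by (auto simp: pairwise_def orthogonal_def inner_commute)
  then have "independent {a, b}"
    by (intro pairwise_orthogonal_independent) auto
  then have "dim (span {a, b}) = 2"
    using \<open>a \<noteq> b\<close> by (simp add: dim_eq_card_independent)
  moreover have "{y. \<forall>x\<in>span {a, b}. orthogonal x y} = span_E6_coords"
  proof -
    have "(\<forall>x\<in>span {a, b}. orthogonal x y) \<longleftrightarrow> a \<bullet> y = 0 \<and> b \<bullet> y = 0" for y
      using orthogonal_to_span[of _ "{a, b}" y]
      by (auto simp: orthogonal_commute[of _ y] orthogonal_def inner_commute span_base)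
    then show ?thesis by (auto simp: inner_a inner_b span_E6_coords_def)
  qed
  ultimately show ?thesis
    using dim_subspace_orthogonal_to_vectors[OF subspace_span subspace_UNIV, of "{a, b}"] by simp
qed

text \<open>One minus sign in the outer pair and three among the six inner coordinates cancel both
  defining sums, and their number 4 is even. This root glues the components A_1 and A_5.\<close>

lemma E6_half_vec:
  obtains A where "half_vec A \<in> roots_E6" "1 \<notin> A" "8 \<in> A"
proof -
  obtain B where B: "B \<subseteq> inner_coords" "card B = 3" "finite B"
    using obtain_subset_with_card_n[of 3 inner_coords] inner_coords(2) by auto
  have B': "1 \<notin> B" "8 \<notin> B" "inner_coords \<inter> insert 8 B = B"
    using B(1) inner_coords(3,4) by auto
  have "card (insert 8 B) = 4" using B B' by simp
  then have "half_vec (insert 8 B) \<in> roots_E8"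
    by (intro half_vec_mem_roots) simp
  moreover have "(\<Sum>i\<in>inner_coords. half_vec (insert 8 B) $ i) = 0"
    unfolding sum_half_vec B'(3) by (simp add: B(2) inner_coords(2))
  ultimately have "half_vec (insert 8 B) \<in> roots_E6"
    unfolding roots_E6_eq span_E6_coords_def using B'(1) inner_coords(1) by (simp add: half_vec_nth)
  then show ?thesis
    using B' inner_coords(1) by (intro that[of "insert 8 B"]) auto
qed

lemma root_lattice_E6: "root_lattice (int_span roots_E6)"
proof (rule root_lattice_subsystem)
  show "roots_E6 \<subseteq> roots_E8" by (auto simp: roots_E6_def)
  obtain A where A: "half_vec A \<in> roots_E6" "1 \<notin> A" "8 \<in> A" by (rule E6_half_vec)
  obtain k where k: "k \<in> inner_coords" using inner_coords(2) by (metis all_not_in_conv card.empty zero_neq_numeral)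
  have integral: "x \<in> int_span roots_E6" if x: "x \<in> span_E6_coords" "\<And>i. x $ i \<in> \<int>" for x
  proof -
    have diff: "axis i 1 - axis k 1 \<in> int_span roots_E6" if "i \<in> inner_coords" for i
      using k that by (cases "i = k") (auto intro: int_span_zero int_span_base axis_diff_mem_roots_E6)
    have outer: "axis 1 1 - axis 8 1 \<in> int_span roots_E6"
      by (intro int_span_base axis_diff_mem_roots_E6)
    show ?thesis
      by (subst E6_coords_eq[OF x(1) k])
         (intro int_span_add int_span_sum int_span_scale x(2) diff outer; assumption)
  qed
  show "x \<in> int_span roots_E6" if "x \<in> span (int_span roots_E6)" and x: "x \<in> coords_E8" for x
  proof (cases "\<forall>i. x $ i \<in> \<int>")
    case True
    then show ?thesis using that(1) integral unfolding span_E6 by blast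
  next
    case False
    have "x - half_vec A \<in> span_E6_coords"
      using that(1) A(1) subspace_diff[OF subspace_E6] unfolding span_E6 by (auto simp: roots_E6_eq)
    then have "(x - half_vec A) + half_vec A \<in> int_span roots_E6"
      by (intro int_span_add int_span_base A(1) integral half_vec_diff_Ints[OF False x])
    then show ?thesis by simp
  qed
  show "\<exists>r\<in>int_span roots_E6. r \<bullet> r = 2 \<and> r \<bullet> \<alpha> \<noteq> 0 \<and> (\<forall>c. r \<noteq> c *\<^sub>R \<alpha>)"
    if "\<alpha> \<in> span (int_span roots_E6)" "\<alpha> \<noteq> 0" for \<alpha>
  proof (cases "\<exists>i\<in>inner_coords. \<alpha> $ i \<noteq> 0")
    case True
    have \<alpha>: "\<alpha> \<in> span_E6_coords" using that unfolding span_E6 by simp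
    obtain i where i: "i \<in> inner_coords" "\<alpha> $ i \<noteq> 0" using True by blast
    then obtain j where j: "j \<in> inner_coords" "\<alpha> $ i \<noteq> \<alpha> $ j"
      using exists_distinct_coords[of inner_coords "\<lambda>i. \<alpha> $ i" i] \<alpha> by (auto simp: span_E6_coords_def)
    obtain m where m: "m \<in> inner_coords" "m \<noteq> i" "m \<noteq> j"
      using card_ge_3_obtain[of inner_coords i j] inner_coords(2) by auto
    have "i \<noteq> j" using j by auto
    show ?thesis
      using i j m \<open>i \<noteq> j\<close>
      by (intro irreducible_axis_diff[OF j(2) m(2,3)] int_span_base axis_diff_mem_roots_E6) auto
  next
    case False
    \<comment> \<open>Now \<open>\<alpha>\<close> is a multiple of
      \<open>axis 1 1 - axis 8 1\<close>, so the integral roots are parallel or orthogonal to it;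
      only a half-integral root linking the two components works.\<close>
    have \<alpha>: "\<alpha> \<in> span_E6_coords" using that unfolding span_E6 by simp
    have eq: "\<alpha> = \<alpha> $ 1 *\<^sub>R (axis 1 1 - axis 8 1)"
      using E6_coords_eq[OF \<alpha> k] False by (simp cong: sum.cong)
    then have "\<alpha> $ 1 \<noteq> 0" using that(2) by (metis scaleR_zero_left)
    have "half_vec A \<bullet> \<alpha> = \<alpha> $ 1 * ((axis 1 1 - axis 8 1) \<bullet> half_vec A)"
      by (subst eq) (simp add: inner_commute)
    also have "\<dots> = \<alpha> $ 1"
      using A by (simp add: inner_axis_diff half_vec_nth)
    finally have "half_vec A \<bullet> \<alpha> \<noteq> 0" using \<open>\<alpha> $ 1 \<noteq> 0\<close> by simp
    moreover have "half_vec A \<noteq> c *\<^sub>R \<alpha>" for c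
    proof
      assume "half_vec A = c *\<^sub>R \<alpha>"
      then have "half_vec A $ k = c * \<alpha> $ k" by simp
      then show False using False k by (auto simp: half_vec_nth split: if_splits)
    qed
    moreover have "half_vec A \<bullet> half_vec A = 2"
      by (simp add: inner_vec_def half_vec_def if_distrib cong: if_cong)
    ultimately show ?thesis using A(1) int_span_base by blast
  qed
qed

theorem corollary2:
  fixes L :: "(real ^ 'n::finite) set" and k :: nat
  assumes "noncartesian_root_lattice L"
    and "k \<ge> 1"
  shows "\<not> (\<exists>l v. 0 < l \<and> l < 1 \<and> voronoi_refines L k l v)"
proof -
  \<comment> \<open>The ambient type stays general because A_n, E_6 and E_7 live in spaces of larger
    dimension than \<open>L\<close>.\<close>
  have main: ?thesis if "unsplit_lattice M" "dim M = CARD('n)" "similar_to L M"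
    for M :: "'b::euclidean_space set"
    using unsplit_lattice.similar_not_refines[OF that(1,3)] that(2) \<open>k \<ge> 1\<close> by auto
  note unsplit = root_lattice.unsplit_lattice root_lattice.unsplit_dual_lattice
  have A: ?thesis if "CARD('n) \<ge> 2"
      "similar_to L (lattice_A :: (real ^ 'n option) set) \<or> similar_to L (dual_lattice (lattice_A :: (real ^ 'n option) set))"
    using that main[of "lattice_A :: (real ^ 'n option) set"] main[of "dual_lattice (lattice_A :: (real ^ 'n option) set)"]
      unsplit[OF root_lattice_A[OF that(1)]] dim_lattice_A[OF that(1)]
      root_lattice.dim_dual_lattice[OF root_lattice_A[OF that(1)] lattice_A_integral] by auto
  have D: ?thesis if "CARD('n) \<ge> 3"
      "similar_to L (lattice_D :: (real ^ 'n) set) \<or> similar_to L (dual_lattice (lattice_D :: (real ^ 'n) set))"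
  proof -
    have "dim (lattice_D :: (real ^ 'n) set) = CARD('n)"
      using span_lattice_D[OF that(1)] by (simp flip: dim_eq_full)
    then show ?thesis
      using that main[of "lattice_D :: (real ^ 'n) set"] main[of "dual_lattice (lattice_D :: (real ^ 'n) set)"]
        unsplit[OF root_lattice_D[OF that(1)]]
        root_lattice.dim_dual_lattice[OF root_lattice_D[OF that(1)] lattice_D_integral] by auto
  qed
  have "dim (int_span roots_E6) = 6" "dim (int_span roots_E7) = 7" "dim (int_span roots_E8) = 8"
    using dim_span[of "int_span roots_E6"] dim_span[of "int_span roots_E7"] dim_span[of "int_span roots_E8"]
    unfolding span_E6 span_E7 span_E8 by (simp_all add: dim_E6 dim_zero_sum)
  then have E: ?thesis if "CARD('n) = 6 \<and> similar_to L (int_span roots_E6) \<or>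
     CARD('n) = 7 \<and> similar_to L (int_span roots_E7) \<or> CARD('n) = 8 \<and> similar_to L (int_span roots_E8)"
    using that main[of "int_span roots_E6"] main[of "int_span roots_E7"] main[of "int_span roots_E8"]
      root_lattice_E6 root_lattice_E7 root_lattice_E8 unsplit(1) by auto
  show ?thesis
    using assms(1) A D E unfolding noncartesian_root_lattice_def by blast
qed

end
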